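(* Let $X$ be a non-empty dense-in-itself metric space. (1) The Hilbert system $\mathrm{KD4G}_1$ is complete over $X$ for $\mathcal L_{[d]}$-formulas, and sound if $\mathrm G_1$ is valid in $X$. (2) The Hilbert system $\mathrm{KD4G}_1t$ is complete over $X$ for $\mathcal L_{[d]}^{\langle dt\rangle}$-formulas, and sound if $\mathrm G_1$ is valid in $X$.
   Context: A metric space is regarded as a topological space with its metric topology; a space is dense in itself if no singleton subset is open. For $S\subseteq X$, $\langle d\rangle S=\{x\in X: S\cap O\setminus\{x\}\neq\emptyset\text{ for every open neighbourhood }O\text{ of }x\}$ (the derivative of $S$). LANGUAGES. $\mathsf{Var}$ is a fixed set of propositional variables (atoms). $\mathcal L_{[d]}^{\langle dt\rangle}$-formulas: atoms; $\top$; $\neg\varphi$; $\varphi\wedge\psi$; $[d]\varphi$; and $\langle dt\rangle\Delta$ for each non-empty finite set $\Delta$ of formulas. $\mathcal L_{[d]}$-formulas are those not involving $\langle dt\rangle$. Abbreviations: $\vee,\to,\leftrightarrow$ as usual, $\langle d\rangle\varphi=\neg[d]\neg\varphi$, and $\Box^*\varphi=\varphi\wedge[d]\varphi$. SEMANTICS. An assignment into $X$ is a map $h:\mathsf{Var}\to\wp(X)$. Truth $(X,h),x\models\varphi$ at $x\in X$: atoms $p$ are true iff $x\in h(p)$; $\top$ and Booleans as usual; $[d]\varphi$ is true at $x$ iff some open neighbourhood $O$ of $x$ has $\varphi$ true at every $y\in O\setminus\{x\}$; $\langle dt\rangle\Delta$ is true at $x$ iff there is $S\subseteq X$ with $x\in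 S\subseteq\bigcap_{\delta\in\Delta}\langle d\rangle([\![\delta]\!]\cap S)$, where $[\![\delta]\!]=\{y\in X:(X,h),y\models\delta\}$. A formula is valid in $X$ if it is true at every point of $X$ under every assignment into $X$; a scheme is valid in $X$ if all its instances are. SYSTEMS. $\mathrm G_1$ is the scheme of all formulas $[d](\Box^*Q_0\vee\Box^*Q_1)\to([d]\neg Q_0\vee[d]\neg Q_1)$, where $Q_0=\varphi_0\wedge\neg\varphi_1$, $Q_1=\varphi_1\wedge\neg\varphi_0$, and $\varphi_0,\varphi_1$ are arbitrary formulas. $\mathrm{KD4G}_1$ (for $\mathcal L_{[d]}$): axioms are all instances of propositional tautologies; $[d](\varphi\to\psi)\to([d]\varphi\to[d]\psi)$; $\langle d\rangle\top$; $[d]\varphi\to[d][d]\varphi$; $\mathrm G_1$. Rules: modus ponens; from $\varphi$ infer $[d]\varphi$. $\mathrm{KD4G}_1t$ (for $\mathcal L_{[d]}^{\langle dt\rangle}$) has the same schemes and rules (for formulas of this language) plus (Fix) $\langle dt\rangle\Gamma\to\langle d\rangle(\gamma\wedge\langle dt\rangle\Gamma)$ for each $\gamma\in\Gamma$, and (Ind) $\Box^*(\varphi\to\bigwedge_{\gamma\in\Gamma}\langle d\rangle(\gamma\wedge\varphi))\to(\varphi\to\langle dt\rangle\Gamma)$. A Hilbert system is sound over $X$ if all its theorems are valid in $X$, and complete over $X$ if every formula of its language that is valid in $X$ is a theorem. *)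

theory Defs
  imports "HOL-Analysis.Analysis" "HOL-Library.FSet"
begin

text \<open>
  The parameter type is the set of atoms. The sets \<open>\<Delta>\<close> in \<open>Dt \<Delta>\<close> must be non-empty; since the
  datatype cannot express this, it is imposed in the definition of the languages below.
\<close>

datatype 'v form =
    Atom 'v
  | Tru  ("\<^bold>\<top>")
  | Neg "'v form"  ("\<^bold>\<not> _" [60] 60)
  | And "'v form" "'v form"  (infixr "\<^bold>\<and>" 55)
  | Box "'v form"  ("\<^bold>[d\<^bold>] _" [60] 60)
  | Dt "'v form fset"  ("\<langle>dt\<rangle> _" [60] 60)

inductive_set lang_d :: "'v form set" where
  "Atom p \<in> lang_d"
| "\<^bold>\<top> \<in> lang_d"
| "\<phi> \<in> lang_d \<Longrightarrow> \<^bold>\<not> \<phi> \<in> lang_d"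
| "\<phi> \<in> lang_d \<Longrightarrow> \<psi> \<in> lang_d \<Longrightarrow> \<phi> \<^bold>\<and> \<psi> \<in> lang_d"
| "\<phi> \<in> lang_d \<Longrightarrow> \<^bold>[d\<^bold>] \<phi> \<in> lang_d"

inductive_set lang_dt :: "'v form set" where
  "Atom p \<in> lang_dt"
| "\<^bold>\<top> \<in> lang_dt"
| "\<phi> \<in> lang_dt \<Longrightarrow> \<^bold>\<not> \<phi> \<in> lang_dt"
| "\<phi> \<in> lang_dt \<Longrightarrow> \<psi> \<in> lang_dt \<Longrightarrow> \<phi> \<^bold>\<and> \<psi> \<in> lang_dt"
| "\<phi> \<in> lang_dt \<Longrightarrow> \<^bold>[d\<^bold>] \<phi> \<in> lang_dt"
| "\<Delta> \<noteq> {||} \<Longrightarrow> (\<And>\<delta>. \<delta> |\<in>| \<Delta> \<Longrightarrow> \<delta> \<in> lang_dt) \<Longrightarrow> \<langle>dt\<rangle> \<Delta> \<in> lang_dt"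

abbreviation Or :: "'v form \<Rightarrow> 'v form \<Rightarrow> 'v form"  (infixr "\<^bold>\<or>" 54)
  where "\<phi> \<^bold>\<or> \<psi> \<equiv> \<^bold>\<not> (\<^bold>\<not> \<phi> \<^bold>\<and> \<^bold>\<not> \<psi>)"

abbreviation Imp :: "'v form \<Rightarrow> 'v form \<Rightarrow> 'v form"  (infixr "\<^bold>\<rightarrow>" 53)
  where "\<phi> \<^bold>\<rightarrow> \<psi> \<equiv> \<^bold>\<not> (\<phi> \<^bold>\<and> \<^bold>\<not> \<psi>)"

abbreviation Dia :: "'v form \<Rightarrow> 'v form"  ("\<langle>d\<rangle> _" [60] 60)
  where "\<langle>d\<rangle> \<phi> \<equiv> \<^bold>\<not> \<^bold>[d\<^bold>] \<^bold>\<not> \<phi>"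

abbreviation BoxS :: "'v form \<Rightarrow> 'v form"  ("\<box>* _" [60] 60)
  where "\<box>* \<phi> \<equiv> \<phi> \<^bold>\<and> \<^bold>[d\<^bold>] \<phi>"

fun BigAnd :: "'v form list \<Rightarrow> 'v form" where
  "BigAnd [] = \<^bold>\<top>"
| "BigAnd [\<phi>] = \<phi>"
| "BigAnd (\<phi> # \<psi> # \<chi>s) = \<phi> \<^bold>\<and> BigAnd (\<psi> # \<chi>s)"


definition deriv_set :: "'a::topological_space set \<Rightarrow> 'a set"
  where "deriv_set S = {x. x islimpt S}"

lemma size_in_fset [termination_simp]:
  fixes \<delta> :: "'v form"
  assumes "\<delta> |\<in>| \<Delta>"
  shows "size \<delta> < Suc (\<Sum>x\<in>fset \<Delta>. Suc (size x))"
proof -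
  have "Suc (size \<delta>) \<le> (\<Sum>x\<in>fset \<Delta>. Suc (size x))"
    using assms by (intro member_le_sum) auto
  then show ?thesis by simp
qed

fun sat :: "('v \<Rightarrow> 'a::topological_space set) \<Rightarrow> 'a \<Rightarrow> 'v form \<Rightarrow> bool" where
  "sat h x (Atom p) \<longleftrightarrow> x \<in> h p"
| "sat h x \<^bold>\<top> \<longleftrightarrow> True"
| "sat h x (\<^bold>\<not> \<phi>) \<longleftrightarrow> \<not> sat h x \<phi>"
| "sat h x (\<phi> \<^bold>\<and> \<psi>) \<longleftrightarrow> sat h x \<phi> \<and> sat h x \<psi>"
| "sat h x (\<^bold>[d\<^bold>] \<phi>) \<longleftrightarrow> (\<exists>U. open U \<and> x \<in> U \<and> (\<forall>y \<in> U - {x}. sat h y \<phi>))"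
| "sat h x (\<langle>dt\<rangle> \<Delta>) \<longleftrightarrow>
     (\<exists>S. x \<in> S \<and> S \<subseteq> (\<Inter>\<delta> \<in> fset \<Delta>. deriv_set ({y. sat h y \<delta>} \<inter> S)))"

definition valid_in :: "'a::topological_space itself \<Rightarrow> 'v form \<Rightarrow> bool"
  where "valid_in X \<phi> \<longleftrightarrow> (\<forall>(h :: 'v \<Rightarrow> 'a set) (x :: 'a). sat h x \<phi>)"

definition scheme_valid_in :: "'a::topological_space itself \<Rightarrow> 'v form set \<Rightarrow> bool"
  where "scheme_valid_in X A \<longleftrightarrow> (\<forall>\<phi> \<in> A. valid_in X \<phi>)"


text \<open>Propositional formulas have their own countable supply of variables, so that the set of
  tautology instances does not depend on how many atoms there are.\<close>

datatype pform = PVar nat | PTru | PNeg pform | PAnd pform pform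

primrec peval :: "(nat \<Rightarrow> bool) \<Rightarrow> pform \<Rightarrow> bool" where
  "peval v (PVar n) \<longleftrightarrow> v n"
| "peval v PTru \<longleftrightarrow> True"
| "peval v (PNeg \<pi>) \<longleftrightarrow> \<not> peval v \<pi>"
| "peval v (PAnd \<pi> \<rho>) \<longleftrightarrow> peval v \<pi> \<and> peval v \<rho>"

primrec pinst :: "(nat \<Rightarrow> 'v form) \<Rightarrow> pform \<Rightarrow> 'v form" where
  "pinst \<sigma> (PVar n) = \<sigma> n"
| "pinst \<sigma> PTru = \<^bold>\<top>"
| "pinst \<sigma> (PNeg \<pi>) = \<^bold>\<not> pinst \<sigma> \<pi>"
| "pinst \<sigma> (PAnd \<pi> \<rho>) = pinst \<sigma> \<pi> \<^bold>\<and> pinst \<sigma> \<rho>"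

text \<open>Each scheme below takes as argument the language from which its instances are drawn.\<close>

definition taut_instances :: "'v form set \<Rightarrow> 'v form set"
  where "taut_instances L =
    {pinst \<sigma> \<pi> | \<sigma> \<pi>. (\<forall>v. peval v \<pi>) \<and> range \<sigma> \<subseteq> L}"

definition K_scheme :: "'v form set \<Rightarrow> 'v form set"
  where "K_scheme L =
    {\<^bold>[d\<^bold>] (\<phi> \<^bold>\<rightarrow> \<psi>) \<^bold>\<rightarrow> (\<^bold>[d\<^bold>] \<phi> \<^bold>\<rightarrow> \<^bold>[d\<^bold>] \<psi>) | \<phi> \<psi>. \<phi> \<in> L \<and> \<psi> \<in> L}"

definition D_axiom :: "'v form"
  where "D_axiom = \<langle>d\<rangle> \<^bold>\<top>"

definition four_scheme :: "'v form set \<Rightarrow> 'v form set"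
  where "four_scheme L = {\<^bold>[d\<^bold>] \<phi> \<^bold>\<rightarrow> \<^bold>[d\<^bold>] \<^bold>[d\<^bold>] \<phi> | \<phi>. \<phi> \<in> L}"

definition G1_formula :: "'v form \<Rightarrow> 'v form \<Rightarrow> 'v form"
  where "G1_formula \<phi>0 \<phi>1 =
    (let Q0 = \<phi>0 \<^bold>\<and> \<^bold>\<not> \<phi>1; Q1 = \<phi>1 \<^bold>\<and> \<^bold>\<not> \<phi>0
     in \<^bold>[d\<^bold>] (\<box>* Q0 \<^bold>\<or> \<box>* Q1) \<^bold>\<rightarrow> (\<^bold>[d\<^bold>] \<^bold>\<not> Q0 \<^bold>\<or> \<^bold>[d\<^bold>] \<^bold>\<not> Q1))"

definition G1_scheme :: "'v form set \<Rightarrow> 'v form set"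
  where "G1_scheme L = {G1_formula \<phi>0 \<phi>1 | \<phi>0 \<phi>1. \<phi>0 \<in> L \<and> \<phi>1 \<in> L}"

definition Fix_scheme :: "'v form set \<Rightarrow> 'v form set"
  where "Fix_scheme L =
    {\<langle>dt\<rangle> \<Gamma> \<^bold>\<rightarrow> \<langle>d\<rangle> (\<gamma> \<^bold>\<and> \<langle>dt\<rangle> \<Gamma>) | \<Gamma> \<gamma>.
       \<Gamma> \<noteq> {||} \<and> fset \<Gamma> \<subseteq> L \<and> \<gamma> |\<in>| \<Gamma>}"

text \<open>The conjunction over \<open>\<Gamma>\<close> may be taken in any order: \<open>gs\<close> ranges over all the repetition-free
  enumerations of \<open>\<Gamma>\<close>.\<close>

definition Ind_scheme :: "'v form set \<Rightarrow> 'v form set"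
  where "Ind_scheme L =
    {\<box>* (\<phi> \<^bold>\<rightarrow> BigAnd (map (\<lambda>\<gamma>. \<langle>d\<rangle> (\<gamma> \<^bold>\<and> \<phi>)) gs)) \<^bold>\<rightarrow> (\<phi> \<^bold>\<rightarrow> \<langle>dt\<rangle> \<Gamma>) | \<phi> \<Gamma> gs.
       \<phi> \<in> L \<and> \<Gamma> \<noteq> {||} \<and> fset \<Gamma> \<subseteq> L \<and> distinct gs \<and> set gs = fset \<Gamma>}"

inductive_set hilbert :: "'v form set \<Rightarrow> 'v form set" for Ax :: "'v form set" where
  ax: "\<phi> \<in> Ax \<Longrightarrow> \<phi> \<in> hilbert Ax"
| mp: "\<phi> \<in> hilbert Ax \<Longrightarrow> \<phi> \<^bold>\<rightarrow> \<psi> \<in> hilbert Ax \<Longrightarrow> \<psi> \<in> hilbert Ax"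
| nec: "\<phi> \<in> hilbert Ax \<Longrightarrow> \<^bold>[d\<^bold>] \<phi> \<in> hilbert Ax"

definition KD4G1_axioms :: "'v form set \<Rightarrow> 'v form set"
  where "KD4G1_axioms L =
    taut_instances L \<union> K_scheme L \<union> {D_axiom} \<union> four_scheme L \<union> G1_scheme L"

definition KD4G1 :: "'v form set"
  where "KD4G1 = hilbert (KD4G1_axioms lang_d)"

definition KD4G1t :: "'v form set"
  where "KD4G1t = hilbert (KD4G1_axioms lang_dt \<union> Fix_scheme lang_dt \<union> Ind_scheme lang_dt)"

text \<open>A system is identified with its set of theorems.\<close>

definition sound_over :: "'a::topological_space itself \<Rightarrow> 'v form set \<Rightarrow> bool"
  where "sound_over X H \<longleftrightarrow> (\<forall>\<phi> \<in> H. valid_in X \<phi>)"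

definition complete_over :: "'a::topological_space itself \<Rightarrow> 'v form set \<Rightarrow> 'v form set \<Rightarrow> bool"
  where "complete_over X L H \<longleftrightarrow> (\<forall>\<phi> \<in> L. valid_in X \<phi> \<longrightarrow> \<phi> \<in> H)"

end

theory Submission
  imports Defs
begin

text \<open>Soundness is routine. For completeness let \<open>\<phi>\<close> be a non-theorem and \<open>\<Phi>\<close> the set of its
  subformulas. The type of a maximal consistent set \<open>w\<close> is \<open>w \<inter> \<Phi>\<close>, and \<open>V w\<close> is the set of the types of
  its successors in the canonical frame. The points of \<open>X\<close> are labelled by types in such a way that every
  point has, for some \<open>w\<close>, the type of \<open>w\<close> as its label and \<open>V w\<close> as the set of labels
  accumulating at it; this gives the truth lemma for \<open>[d]\<close>. For \<open>\<langle>dt\<rangle>\<close> one needs in addition that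
  the points near \<open>x\<close> with the same accumulation set as \<open>x\<close> have labels in a nucleus, a set of
  types whose members see each other in the canonical frame, so that the induction axiom applies to it.

  The labelling is built by induction on the cardinality of \<open>V w\<close>. If there is a nucleus with the
  value \<open>V w\<close>, Tarski's dissection theorem splits an open set into open parts, treated inductively, and a
  remainder, labelled by the nucleus, each point of which is a limit of everything. If there is none, the
  points with the type of \<open>w\<close> are isolated from each other and surrounded by shrinking shells, which
  are treated inductively; \<open>G\<^sub>1\<close> is what allows the shells to be arranged so that neighbouring ones
  fit together along their common frontier. No finite frames are needed.\<close>

subsection \<open>Separated sets and dissection\<close>

text \<open>The canonical frame is infinite, so clusters and last points cannot simply be chosen in
  it. Instead, cardinalities of finite sets of types are minimised, and each property to which the
  induction axiom or G1 is applied is shown to be expressed by a formula. This is why definability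
  is pursued throughout.

  On the space, pieces of the labelling are built independently and glued, while a witness of a
  tangle may run through many pieces. Two devices control this: one nucleus \<open>Bn U\<close> is
  fixed for each value \<open>U\<close>, so that all pieces draw on the same one, and each piece has
  a known accumulation set along its frontier. Restricting only the neighbours with an equal
  accumulation set suffices for tangles: close to a point, accumulation sets can only shrink, so a
  witness contains a point whose accumulation set is locally least, and around that point the
  witness stays inside one nucleus.

  Points whose labels are prescribed form a separated set: they never accumulate, and one piece can
  serve many of them at once.\<close>

definition separated :: "real \<Rightarrow> 'a::metric_space set \<Rightarrow> bool" where
  "separated e M \<longleftrightarrow> 0 < e \<and> (\<forall>x\<in>M. \<forall>y\<in>M. x \<noteq> y \<longrightarrow> e \<le> dist x y)"

lemma separated_not_islimpt:
  assumes "separated e M"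
  shows "\<not> x islimpt M"
proof
  assume lim: "x islimpt M"
  have e: "0 < e" using assms by (simp add: separated_def)
  then obtain y where y: "y \<in> M" "y \<noteq> x" "dist y x < e / 2"
    using lim unfolding islimpt_approachable by (meson half_gt_zero)
  then obtain z where z: "z \<in> M" "z \<noteq> x" "dist z x < dist y x"
    using lim unfolding islimpt_approachable by (meson zero_less_dist_iff)
  have "dist y z < e"
    using y z dist_triangle2[of y z x] by linarith
  moreover have "y \<noteq> z" using z by auto
  ultimately show False
    using assms y z by (force simp: separated_def)
qed

lemma closed_of_not_islimpt: "(\<And>x. \<not> x islimpt M) \<Longrightarrow> closed M"
  by (simp add: closed_limpt)

text \<open>Zorn's lemma: a point at distance at least \<open>e\<close> from a maximal separated set
  could be added to it.\<close>

lemma maximal_separated_exists: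
  fixes S :: "'a::metric_space set"
  assumes "0 < e"
  shows "\<exists>M\<subseteq>S. separated e M \<and> (\<forall>y\<in>S. \<exists>m\<in>M. dist m y < e)"
proof -
  let ?A = "{M. M \<subseteq> S \<and> separated e M}"
  have "\<Union>C \<in> ?A" if "subset.chain ?A C" for C
  proof -
    have C: "C \<subseteq> ?A" "\<And>P Q. P \<in> C \<Longrightarrow> Q \<in> C \<Longrightarrow> P \<subseteq> Q \<or> Q \<subseteq> P"
      using that unfolding subset_chain_def by blast+
    have "e \<le> dist x y" if "x \<in> \<Union>C" "y \<in> \<Union>C" "x \<noteq> y" for x y
    proof -
      from that obtain P Q where "x \<in> P" "P \<in> C" "y \<in> Q" "Q \<in> C" by blast
      then obtain P' where "P' \<in> C" "x \<in> P'" "y \<in> P'" using C(2) by blast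
      then have "separated e P'" using C(1) by blast
      then show ?thesis
        using \<open>x \<noteq> y\<close> \<open>x \<in> P'\<close> \<open>y \<in> P'\<close> by (simp add: separated_def)
    qed
    then have "separated e (\<Union>C)"
      unfolding separated_def using assms by blast
    moreover have "\<Union>C \<subseteq> S" using C(1) by blast
    ultimately show ?thesis by blast
  qed
  then have "\<exists>M\<in>?A. \<forall>X\<in>?A. M \<subseteq> X \<longrightarrow> X = M"
    by (rule subset_Zorn')
  then obtain M where M: "M \<in> ?A" "\<And>X. X \<in> ?A \<Longrightarrow> M \<subseteq> X \<Longrightarrow> X = M"
    by metis
  have "\<exists>m\<in>M. dist m y < e" if "y \<in> S" for y
  proof (rule ccontr)
    assume n: "\<not> ?thesis"
    then have "insert y M \<in> ?A"
      using M(1) that by (auto simp: separated_def not_less dist_commute)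
    then have "y \<in> M" using M(2) by blast
    then show False using n assms by auto
  qed
  then show ?thesis using M(1) by blast
qed

text \<open>Normality gives an open set around \<open>M\<close> with closure inside
  \<open>T\<close>; replacing it by the interior of its closure makes it regular without enlarging
  the closure. Regularity is wanted because a point outside such a set is always a limit of points
  outside its closure, or one of them.\<close>

lemma regular_neighbourhood_exists:
  fixes M :: "'a::t4_space set"
  assumes "closed M" "open T" "M \<subseteq> T"
  shows "\<exists>N. open N \<and> M \<subseteq> N \<and> closure N \<subseteq> T \<and> interior (closure N) = N"
proof -
  obtain P Q where PQ: "open P" "open Q" "M \<subseteq> P" "- T \<subseteq> Q" "P \<inter> Q = {}"
    using t4_space[of M "- T"] assms closed_Compl[OF assms(2)] by blast
  have cl: "closure P \<subseteq> T"
    using PQ by (metis Compl_subset_Compl_iff closure_minimal closed_Compl disjoint_eq_subset_Compl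
        double_compl order_trans)
  let ?N = "interior (closure P)"
  have clN: "closure ?N \<subseteq> closure P"
    by (metis closed_closure closure_minimal interior_subset)
  then have "interior (closure ?N) = ?N"
    by (meson closure_subset interior_maximal interior_mono open_interior subset_antisym)
  moreover have "M \<subseteq> ?N"
    using PQ by (meson closure_subset interior_maximal order_trans)
  ultimately show ?thesis using clN cl by (meson open_interior order_trans)
qed

text \<open>For use with closures: the union of two regular open sets with disjoint closures is
  again regular.\<close>

lemma interior_Un_disjoint_closed:
  assumes "closed A" "closed B" "A \<inter> B = {}"
  shows "interior (A \<union> B) = interior A \<union> interior B"
proof
  have "interior (A \<union> B) - B \<subseteq> interior A" "interior (A \<union> B) - A \<subseteq> interior B"
    using interior_subset[of "A \<union> B"] assms by (intro interior_maximal; force)+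
  then show "interior (A \<union> B) \<subseteq> interior A \<union> interior B"
    using assms by blast
qed (simp add: interior_mono)

lemma open_not_subset_no_limpt:
  fixes S :: "'a::perfect_space set"
  assumes "open S" "S \<noteq> {}" "\<And>x. \<not> x islimpt A"
  obtains y where "y \<in> S" "y \<notin> A"
proof -
  obtain x where x: "x \<in> S" using assms by blast
  then have "x islimpt S"
    by (simp add: assms(1) interior_open interior_limit_point)
  then have "\<not> S \<subseteq> A"
    using assms(3) islimpt_subset by blast
  then show ?thesis using that by blast
qed

text \<open>A form of Tarski's dissection theorem. The sets \<open>M n\<close> are ever finer nets in what is left of
  \<open>C\<close> at stage \<open>n\<close>; those with \<open>p n\<close> are swallowed by open sets \<open>N n\<close> to be removed, the others are
  kept for ever. Regularity of the removed sets makes every remaining point a limit of what is left.\<close>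

lemma dissection:
  fixes C M0 :: "'a::{metric_space,perfect_space} set" and p :: "nat \<Rightarrow> bool"
  assumes "open C" "M0 \<subseteq> C" "separated e0 M0"
  obtains M N :: "nat \<Rightarrow> 'a set" where
    "\<And>n. M n \<subseteq> C" "\<And>n. separated (1 / 2 ^ n) (M n)" "\<And>n. open (N n)" "\<And>n. closure (N n) \<subseteq> C"
    "\<And>n m. n \<noteq> m \<Longrightarrow> N n \<inter> N m = {}" "\<And>n. p n \<Longrightarrow> M n \<subseteq> N n"
    "\<And>n. \<not> p n \<Longrightarrow> N n = {}" "\<And>n m. \<not> p n \<Longrightarrow> M n \<inter> N m = {}" "\<And>n. M0 \<inter> N n = {}"
    "\<And>n. \<not> p n \<Longrightarrow> M n \<inter> M0 = {}"
    "\<And>n m. \<not> p n \<Longrightarrow> \<not> p m \<Longrightarrow> n \<noteq> m \<Longrightarrow> M n \<inter> M m = {}"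
    "\<And>n x. x \<in> closure C \<Longrightarrow> x \<notin> (\<Union>m. N m) \<Longrightarrow> \<exists>m\<in>M n. dist m x < 2 / 2 ^ n"
proof -
  \<comment> \<open>In a state, \<open>P\<close> is the union of the open sets removed so far and
    \<open>A\<close> the set of points kept so far, \<open>M0\<close> being kept from the start. As
    \<open>A\<close> has no limit points, \<open>C - closure P - A\<close> is open and the next
    stage can work inside it.\<close>
  define inv :: "'a set \<times> 'a set \<Rightarrow> bool" where "inv = (\<lambda>(P, A). open P \<and> interior (closure P) = P \<and>
    closure P \<subseteq> C \<and> A \<subseteq> C \<and> (\<forall>x. \<not> x islimpt A) \<and> A \<inter> closure P = {} \<and> M0 \<subseteq> A)"
  define stp :: "nat \<Rightarrow> 'a set \<times> 'a set \<Rightarrow> 'a set \<times> 'a set \<Rightarrow> 'a set \<Rightarrow> 'a set \<Rightarrow> bool" where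
    "stp = (\<lambda>n (P, A) (P', A') M N. M \<subseteq> C - closure P - A \<and> separated (1 / 2 ^ n) M \<and>
      (\<forall>y\<in>C - closure P - A. \<exists>m\<in>M. dist m y < 1 / 2 ^ n) \<and> open N \<and> 
      closure N \<subseteq> C - closure P - A \<and> P' = P \<union> N \<and>
      (if p n then M \<subseteq> N \<and> A' = A else N = {} \<and> A' = A \<union> M))"
  have step: "\<exists>s'. inv s' \<and> (\<exists>M N. stp n s s' M N)" if "inv s" for s n
  proof -
    obtain P A where s: "s = (P, A)" by force
    have I: "open P" "interior (closure P) = P" "closure P \<subseteq> C" "A \<subseteq> C" "\<And>x. \<not> x islimpt A"
       "A \<inter> closure P = {}" "M0 \<subseteq> A"
      using that by (auto simp: s inv_def)
    obtain M where M: "M \<subseteq> C - closure P - A" "separated (1 / 2 ^ n) M"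
        "\<forall>y\<in>C - closure P - A. \<exists>m\<in>M. dist m y < 1 / 2 ^ n"
      using maximal_separated_exists[of "1 / 2 ^ n" "C - closure P - A"] by auto
    have nl: "\<not> x islimpt M" for x using M(2) separated_not_islimpt by blast
    show ?thesis
    proof (cases "p n")
      case True
      have "open (C - closure P - A)"
        by (intro open_Diff assms closed_closure closed_of_not_islimpt I)
      then obtain N where N: "open N" "M \<subseteq> N" "closure N \<subseteq> C - closure P - A" 
          "interior (closure N) = N"
        using regular_neighbourhood_exists[of M "C - closure P - A"] M(1) nl
          closed_of_not_islimpt by blast
      have "interior (closure (P \<union> N)) = P \<union> N"
        using interior_Un_disjoint_closed[of "closure P" "closure N"] N I by (auto simp: closure_Un)
      then have "inv (P \<union> N, A)"
        using I N by (auto simp: inv_def closure_Un)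
      moreover have "stp n s (P \<union> N, A) M N"
        using M N True by (auto simp: stp_def s)
      ultimately show ?thesis by blast
    next
      case False
      have "inv (P, A \<union> M)"
        using I M nl by (auto simp: inv_def islimpt_Un)
      moreover have "stp n s (P, A \<union> M) M {}"
        using M False by (auto simp: stp_def s)
      ultimately show ?thesis by blast
    qed
  qed
  have "inv ({}, M0)"
    using assms separated_not_islimpt by (auto simp: inv_def)
  then have "\<exists>s. \<forall>n. (inv (s n) \<and> (n = 0 \<longrightarrow> s n = ({}, M0))) \<and> (\<exists>M N. stp n (s n) (s (Suc n)) M N)"
    using dependent_nat_choice[of "\<lambda>n s. inv s \<and> (n = 0 \<longrightarrow> s = ({}, M0))" "\<lambda>n s s'. \<exists>M N. stp n s s' M N"]
      step by auto
  then obtain s where s: "\<And>n. inv (s n)" "\<forall>n. \<exists>M N. stp n (s n) (s (Suc n)) M N"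
      and s0: "s 0 = ({}, M0)"
    by auto
  from s(2) obtain M where "\<forall>n. \<exists>N. stp n (s n) (s (Suc n)) (M n) N"
    by (rule choice[THEN exE])
  then obtain N where sMN: "\<And>n. stp n (s n) (s (Suc n)) (M n) (N n)"
    by (rule choice[THEN exE]) blast
  define P A where "P = (\<lambda>n. fst (s n))" and "A = (\<lambda>n. snd (s n))"
  have s_eq: "s n = (P n, A n)" for n by (simp add: P_def A_def)
  have I: "open (P n)" "interior (closure (P n)) = P n" "closure (P n) \<subseteq> C" "A n \<subseteq> C"
       "\<not> x islimpt A n" "A n \<inter> closure (P n) = {}" "M0 \<subseteq> A n" for n x
    using s(1)[of n] by (auto simp: s_eq inv_def)
  have S: "M n \<subseteq> C - closure (P n) - A n" "separated (1 / 2 ^ n) (M n)"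
      "\<And>y. y\<in>C - closure (P n) - A n \<Longrightarrow> \<exists>m\<in>M n. dist m y < 1 / 2 ^ n"
      "open (N n)" "closure (N n) \<subseteq> C - closure (P n) - A n" "P (Suc n) = P n \<union> N n"
      "p n \<Longrightarrow> M n \<subseteq> N n" "p n \<Longrightarrow> A (Suc n) = A n" "\<not> p n \<Longrightarrow> N n = {}"
      "\<not> p n \<Longrightarrow> A (Suc n) = A n \<union> M n" for n
    using sMN[of n] by (auto simp: s_eq stp_def split: if_splits)
  have Nc: "N n \<inter> closure (P n) = {}" "N n \<inter> A n = {}" for n
    using S(5)[of n] closure_subset[of "N n"] by blast+
  have monoP: "P n \<subseteq> P m" if "n \<le> m" for n m
    by (rule lift_Suc_mono_le[OF _ that]) (use S(6) in blast)
  have monoA: "A n \<subseteq> A m" if "n \<le> m" for n m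
    by (rule lift_Suc_mono_le[OF _ that]) (use S(8,10) in blast)
  have NP: "N n \<subseteq> P m" if "n < m" for n m
    using monoP[of "Suc n" m] S(6)[of n] that by auto
  have MA: "M n \<subseteq> A m" if "n < m" "\<not> p n" for n m
    using monoA[of "Suc n" m] S(10)[of n] that by auto
  have NN: "N n \<inter> N m = {}" if "n < m" for n m
    using NP[OF that] Nc(1)[of m] closure_subset[of "P m"] by blast
  have MM: "M n \<inter> M m = {}" if "n < m" "\<not> p n" "\<not> p m" for n m
    using MA[OF that(1,2)] S(1)[of m] by blast
  have MN: "M n \<inter> N m = {}" if "\<not> p n" for n m
  proof (cases n m rule: linorder_cases)
    case less
    then show ?thesis using MA[OF less that] Nc(2)[of m] by blast
  next
    case equal
    then show ?thesis using S(9) that by blast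
  next
    case greater
    then show ?thesis using NP[OF greater] S(1)[of n] closure_subset[of "P n"] by blast
  qed
  have net: "\<exists>m\<in>M n. dist m x < 2 / 2 ^ n" if "x \<in> closure C" "x \<notin> (\<Union>m. N m)" for n x
  proof -
    have "P n \<subseteq> (\<Union>m. N m)"
    proof (induction n)
      case 0
      show ?case using s0 by (simp add: P_def)
    next
      case (Suc n)
      then show ?case using S(6) by blast
    qed
    then have xP: "x \<notin> P n" using that by blast
    let ?S = "ball x (1 / 2 ^ n) \<inter> (C - closure (P n))"
    \<comment> \<open>Regularity enters here: if a neighbourhood of \<open>x\<close> in
      \<open>C\<close> lay in \<open>closure (P n)\<close>, then \<open>x\<close> would be in its
      interior \<open>P n\<close>. On the frontier of \<open>C\<close> it is enough that
      \<open>closure (P n)\<close> lies inside \<open>C\<close>.\<close>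
    have "?S \<noteq> {}"
    proof (cases "x \<in> C")
      case True
      show ?thesis
      proof
        assume "?S = {}"
        then have "ball x (1 / 2 ^ n) \<inter> C \<subseteq> closure (P n)" by blast
        then have "ball x (1 / 2 ^ n) \<inter> C \<subseteq> P n"
          using I(2)[of n] interior_maximal[of "ball x (1 / 2 ^ n) \<inter> C" "closure (P n)"] assms(1) by auto
        moreover have "x \<in> ball x (1 / 2 ^ n)" by simp
        ultimately show False using True xP by blast
      qed
    next
      case False
      then have "x \<in> ball x (1 / 2 ^ n) - closure (P n)" using I(3) by auto
      moreover have "open (ball x (1 / 2 ^ n) - closure (P n))" by auto
      ultimately have "(ball x (1 / 2 ^ n) - closure (P n)) \<inter> C \<noteq> {}"
        using \<open>x \<in> closure C\<close> open_Int_closure_eq_empty by blast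
      then show ?thesis by blast
    qed
    moreover have "open ?S" using assms by auto
    \<comment> \<open>The net is dense only in the region still free, to which \<open>x\<close> need
      not belong. The detour through a free point \<open>y\<close> within \<open>1 / 2 ^ n\<close>
      of \<open>x\<close> doubles the mesh.\<close>
    ultimately obtain y where y: "y \<in> ?S" "y \<notin> A n"
      using open_not_subset_no_limpt[of ?S "A n"] I(5) by blast
    then obtain m where m: "m \<in> M n" "dist m y < 1 / 2 ^ n" using S(3) by blast
    then have "dist m x < 2 / 2 ^ n"
      using y dist_triangle[of m x y] by (auto simp: dist_commute)
    then show ?thesis using m by blast
  qed
  show ?thesis
  proof
    show "M n \<subseteq> C" "separated (1 / 2 ^ n) (M n)" "open (N n)" "p n \<Longrightarrow> M n \<subseteq> N n" for n
      using S(1,2,4,7)[of n] by blast+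
    show "N n = {}" if "\<not> p n" for n using S(9) that by blast
    show "closure (N n) \<subseteq> C" for n using S(5) by blast
    show "N n \<inter> N m = {}" if "n \<noteq> m" for n m
      using NN[of n m] NN[of m n] that by (metis Int_commute nat_neq_iff)
    show "M n \<inter> N m = {}" if "\<not> p n" for n m using MN that by blast
    show "M0 \<inter> N n = {}" for n using Nc(2)[of n] I(7)[of n] by blast
    show "M n \<inter> M0 = {}" for n using S(1)[of n] I(7)[of n] by blast
    show "M n \<inter> M m = {}" if "\<not> p n" "\<not> p m" "n \<noteq> m" for n m
      using MM[of n m] MM[of m n] that by (metis Int_commute nat_neq_iff)
  qed (use net in blast)
qed

section \<open>Scales, recurrent sequences and shrinking neighbourhoods\<close>

lemma two_div_power_less:
  fixes e :: real
  assumes "0 < e"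
  obtains N :: nat where "\<And>n. N \<le> n \<Longrightarrow> 2 / 2 ^ n < e"
proof -
  obtain N where N: "(1 / 2) ^ N < e / 2"
    using real_arch_pow_inv[of "e / 2" "1 / 2"] assms by auto
  have "2 / 2 ^ n < e" if "N \<le> n" for n
  proof -
    have "(1 / 2 :: real) ^ n \<le> (1 / 2) ^ N"
      by (rule power_decreasing) (use that in auto)
    moreover have "2 / 2 ^ n = 2 * (1 / 2 :: real) ^ n" by (simp add: power_one_over)
    ultimately show ?thesis using N by linarith
  qed
  then show ?thesis using that by blast
qed

lemma sequence_hitting_infinitely_often:
  assumes "finite K" "K \<noteq> {}"
  obtains c :: "nat \<Rightarrow> 'b" where "\<And>n. c n \<in> K" "\<And>k N. k \<in> K \<Longrightarrow> \<exists>n\<ge>N. c n = k"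
proof -
  obtain xs where xs: "set xs = K" using assms(1) finite_list by blast
  then have len: "0 < length xs" using assms(2) by auto
  show ?thesis
  proof
    show "xs ! (n mod length xs) \<in> K" for n using xs len by (metis mod_less_divisor nth_mem)
    fix k N assume "k \<in> K"
    then obtain i where i: "i < length xs" "xs ! i = k" using xs by (metis in_set_conv_nth)
    then have "N \<le> i + N * length xs" "(i + N * length xs) mod length xs = i"
      using len by (auto intro: trans_le_add2)
    then show "\<exists>n\<ge>N. xs ! (n mod length xs) = k" using i by metis
  qed
qed

lemma neighbourhood_avoiding_separated:
  assumes "separated e M"
  obtains T where "open T" "x \<in> T" "T \<inter> M \<subseteq> {x}"
proof -
  have "\<exists>T. x \<in> T \<and> open T \<and> (\<forall>y\<in>M. y \<in> T \<longrightarrow> y = x)"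
    using separated_not_islimpt[OF assms, of x] unfolding islimpt_def by blast
  then show ?thesis using that by blast
qed

lemma islimpt_Int_open:
  assumes "x islimpt S" "open T" "x \<in> T"
  shows "x islimpt (S \<inter> T)"
  using assms islimpt_Int_eventually eventually_at_in_open'
  unfolding islimpt_def by (metis IntE IntI open_Int)

text \<open>Since \<open>cmp\<close> is reflexive, paths can be padded by standing still, so there
  is one \<open>N\<close> such that any two members of \<open>J\<close> are joined by a path of
  exactly \<open>N\<close> steps. Blocks of this common length are strung together along a sequence
  that visits every member infinitely often.\<close>

lemma recurrent_walk:
  assumes "finite J" "j0 \<in> J" and refl: "\<And>j. j \<in> J \<Longrightarrow> cmp j j"
    and conn: "\<And>i j. i \<in> J \<Longrightarrow> j \<in> J \<Longrightarrow> (i, j) \<in> {(i, j). i \<in> J \<and> j \<in> J \<and> cmp i j}\<^sup>*"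
  obtains s :: "nat \<Rightarrow> 'b" where "s 0 = j0" "\<And>n. s n \<in> J" "\<And>n. cmp (s n) (s (Suc n))"
    "\<And>j N. j \<in> J \<Longrightarrow> \<exists>n\<ge>N. s n = j"
proof -
  let ?E = "{(i, j). i \<in> J \<and> j \<in> J \<and> cmp i j}"
  have grow: "(i, j) \<in> ?E ^^ (n + k)" if "(i, j) \<in> ?E ^^ n" "j \<in> J" for i j n k
    using that refl by (induction k) auto
  define len where "len i j = (SOME n. (i, j) \<in> ?E ^^ n)" for i j
  have len: "(i, j) \<in> ?E ^^ len i j" if "i \<in> J" "j \<in> J" for i j
    unfolding len_def by (rule someI_ex) (use conn[OF that] in \<open>simp add: rtrancl_power\<close>)
  define N where "N = Suc (Max (case_prod len ` (J \<times> J)))"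
  have "0 < N" by (simp add: N_def)
  have uniform: "(i, j) \<in> ?E ^^ N" if "i \<in> J" "j \<in> J" for i j
  proof -
    have "len i j \<le> Max (case_prod len ` (J \<times> J))"
      using that \<open>finite J\<close> by (intro Max_ge) auto
    then have "N = len i j + (N - len i j)" by (simp add: N_def)
    then show ?thesis using grow[OF len[OF that] that(2), of "N - len i j"] by simp
  qed
  define path where "path i j f \<longleftrightarrow> f 0 = i \<and> f N = j \<and> (\<forall>k<N. (f k, f (Suc k)) \<in> ?E)" for i j f
  define f where "f i j = (SOME f. path i j f)" for i j
  have "path i j (f i j)" if "i \<in> J" "j \<in> J" for i j
  proof -
    have "\<exists>g. path i j g" using uniform[OF that] unfolding path_def relpow_fun_conv .
    then show ?thesis unfolding f_def by (rule someI_ex)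
  qed
  then have f: "\<And>i j. i \<in> J \<Longrightarrow> j \<in> J \<Longrightarrow> f i j 0 = i" "\<And>i j. i \<in> J \<Longrightarrow> j \<in> J \<Longrightarrow> f i j N = j"
      "\<And>i j k. i \<in> J \<Longrightarrow> j \<in> J \<Longrightarrow> k < N \<Longrightarrow> (f i j k, f i j (Suc k)) \<in> ?E"
    unfolding path_def by blast+
  have "J \<noteq> {}" using assms(2) by blast
  obtain c :: "nat \<Rightarrow> 'b" where c: "\<And>n. c n \<in> J" "\<And>k N. k \<in> J \<Longrightarrow> \<exists>n\<ge>N. c n = k"
    by (rule sequence_hitting_infinitely_often[OF assms(1) \<open>J \<noteq> {}\<close>]) blast
  \<comment> \<open>Only the first stop is altered, so that the walk starts at
    \<open>j0\<close>.\<close>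
  define a where "a n = (if n = 0 then j0 else c n)" for n
  have a: "a n \<in> J" for n using c \<open>j0 \<in> J\<close> by (simp add: a_def)
  define s where "s n = f (a (n div N)) (a (Suc (n div N))) (n mod N)" for n
  have step: "(s n, s (Suc n)) \<in> ?E" for n
  proof -
    have "n mod N < N" using \<open>0 < N\<close> by simp
    then have E: "(s n, f (a (n div N)) (a (Suc (n div N))) (Suc (n mod N))) \<in> ?E"
      unfolding s_def using f(3) a by blast
    show ?thesis
    proof (cases "Suc (n mod N) = N")
      case True
      then have "Suc n mod N = 0" "Suc n div N = Suc (n div N)"
        by (simp_all add: mod_Suc div_Suc)
      then show ?thesis using E True f(1,2) a by (simp add: s_def)
    next
      case False
      then have "Suc n mod N = Suc (n mod N)" "Suc n div N = n div N"
        by (simp_all add: mod_Suc div_Suc)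
      then show ?thesis using E by (simp add: s_def)
    qed
  qed
  show ?thesis
  proof
    show "s 0 = j0" using f(1) a[of 1] \<open>j0 \<in> J\<close> \<open>0 < N\<close> by (simp add: s_def a_def)
    show "s n \<in> J" "cmp (s n) (s (Suc n))" for n using step[of n] by auto
    fix j M assume "j \<in> J"
    \<comment> \<open>\<open>Suc M\<close> excludes \<open>n = 0\<close>, the one index at which
      \<open>a\<close> may differ from \<open>c\<close>.\<close>
    then obtain n where n: "n \<ge> Suc M" "c n = j" using c by blast
    have "s (n * N) = a n" using f(1)[OF a[of n] a[of "Suc n"]] \<open>0 < N\<close> by (simp add: s_def)
    then have "s (n * N) = j" using n by (simp add: a_def)
    moreover have "M \<le> n * N" using n \<open>0 < N\<close> by (cases N) auto
    ultimately show "\<exists>n\<ge>M. s n = j" by blast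
  qed
qed

text \<open>Each shell between \<open>W n\<close> and \<open>W (Suc n)\<close> contains a set
  \<open>Q n\<close> with a member close to every point of \<open>M\<close>. These will be the
  prescribed points of the labelling of the shell, through which the points of \<open>M\<close> see
  everything that occurs in it. The points for \<open>Q n\<close> are chosen first;
  \<open>W (Suc n)\<close> is then taken small enough to miss them.\<close>

lemma shrinking_neighbourhoods:
  fixes C M :: "'a::{metric_space,perfect_space} set"
  assumes "open C" "M \<subseteq> C" "separated e M"
  obtains W Q :: "nat \<Rightarrow> 'a set" where "W 0 = C" "\<And>n. open (W n)" "\<And>n. M \<subseteq> W n"
    "\<And>n. Q n \<subseteq> W n - closure (W (Suc n))" "\<And>n. separated (e / 2) (Q n)"
    "\<And>n m. m \<in> M \<Longrightarrow> \<exists>q\<in>Q n. q \<noteq> m \<and> dist q m < 1 / 2 ^ n"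
    "\<And>n. closure (W (Suc n)) \<subseteq> W n" "\<And>n. interior (closure (W (Suc n))) = W (Suc n)"
    "\<And>x. (\<And>n. x \<in> W n) \<Longrightarrow> x \<in> M"
proof -
  define stp :: "nat \<Rightarrow> 'a set \<Rightarrow> 'a set \<Rightarrow> 'a set \<Rightarrow> bool" where
    "stp = (\<lambda>n W W' Q. Q \<subseteq> W - closure W' \<and> separated (e / 2) Q \<and>
      (\<forall>m\<in>M. \<exists>q\<in>Q. q \<noteq> m \<and> dist q m < 1 / 2 ^ n) \<and> closure W' \<subseteq> W \<and> interior (closure W') = W' \<and>
      W' \<subseteq> (\<Union>m\<in>M. ball m (1 / 2 ^ n)))"
  have e: "0 < e" and sep: "\<And>x y. x \<in> M \<Longrightarrow> y \<in> M \<Longrightarrow> x \<noteq> y \<Longrightarrow> e \<le> dist x y"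
    using assms(3) by (auto simp: separated_def)
  have closedM: "closed M"
    using assms(3) closed_of_not_islimpt separated_not_islimpt by blast
  have step: "\<exists>W'. (open W' \<and> M \<subseteq> W') \<and> (\<exists>Q. stp n W W' Q)" if W: "open W \<and> M \<subseteq> W" for n W
  proof -
    \<comment> \<open>With \<open>e / 4\<close>, moving two points of \<open>M\<close> still leaves
      them \<open>e / 2\<close> apart, and a moved point cannot be another point of
      \<open>M\<close>.\<close>
    have "\<exists>q. q \<in> W \<and> q \<noteq> m \<and> dist q m < min (e / 4) (1 / 2 ^ n)" if "m \<in> M" for m
    proof -
      have "m islimpt W"
        using W that by (metis interior_open interior_limit_point subsetD)
      moreover have "0 < min (e / 4) (1 / 2 ^ n)" using e by simp
      ultimately show ?thesis unfolding islimpt_approachable by blast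
    qed
    then obtain q where q: "\<And>m. m \<in> M \<Longrightarrow> q m \<in> W" "\<And>m. m \<in> M \<Longrightarrow> q m \<noteq> m"
        "\<And>m. m \<in> M \<Longrightarrow> dist (q m) m < min (e / 4) (1 / 2 ^ n)"
      by metis
    have sepQ: "e / 2 \<le> dist (q x) (q y)" if "x \<in> M" "y \<in> M" "x \<noteq> y" for x y
      using sep[OF that] q(3)[OF that(1)] q(3)[OF that(2)] dist_triangle[of x y "q x"]
        dist_triangle[of "q x" y "q y"] by (auto simp: dist_commute)
    then have Q: "separated (e / 2) (q ` M)"
      using e unfolding separated_def by (auto) 
    have QM: "q m \<notin> M" if "m \<in> M" for m
      using sep[of "q m" m] q(2,3)[OF that] that e by auto
    have "open (W - q ` M)"
      using W Q by (intro open_Diff closed_of_not_islimpt separated_not_islimpt) auto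
    then have "open ((W - q ` M) \<inter> (\<Union>m\<in>M. ball m (1 / 2 ^ n)))" by auto
    moreover have "M \<subseteq> (W - q ` M) \<inter> (\<Union>m\<in>M. ball m (1 / 2 ^ n))"
    proof
      fix m assume m: "m \<in> M"
      moreover have "m \<in> ball m (1 / 2 ^ n)" by simp
      ultimately show "m \<in> (W - q ` M) \<inter> (\<Union>m\<in>M. ball m (1 / 2 ^ n))" using W QM by blast
    qed
    ultimately have "\<exists>W'. open W' \<and> M \<subseteq> W' \<and>
        closure W' \<subseteq> (W - q ` M) \<inter> (\<Union>m\<in>M. ball m (1 / 2 ^ n)) \<and> interior (closure W') = W'"
      by (rule regular_neighbourhood_exists[OF closedM])
    then obtain W' where W': "open W'" "M \<subseteq> W'" 
       "closure W' \<subseteq> (W - q ` M) \<inter> (\<Union>m\<in>M. ball m (1 / 2 ^ n))"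
       "interior (closure W') = W'"
      by metis
    have "\<forall>m\<in>M. \<exists>q\<in>q ` M. q \<noteq> m \<and> dist q m < 1 / 2 ^ n"
      using q(2,3) by auto
    moreover have "q ` M \<subseteq> W - closure W'" using q(1) W'(3) by blast
    moreover have "W' \<subseteq> (\<Union>m\<in>M. ball m (1 / 2 ^ n))" using W'(3) closure_subset[of W'] by blast
    moreover have "closure W' \<subseteq> W" using W'(3) by blast
    ultimately have "stp n W W' (q ` M)" using Q W'(4) unfolding stp_def by blast
    then show ?thesis using W' by blast
  qed
  have "\<exists>W. \<forall>n. ((open (W n) \<and> M \<subseteq> W n) \<and> (n = 0 \<longrightarrow> W n = C)) \<and> (\<exists>Q. stp n (W n) (W (Suc n)) Q)"
    using dependent_nat_choice[of "\<lambda>n W. (open W \<and> M \<subseteq> W) \<and> (n = 0 \<longrightarrow> W = C)"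
        "\<lambda>n W W'. \<exists>Q. stp n W W' Q"] step assms by auto
  then obtain W where W: "\<And>n. open (W n)" "\<And>n. M \<subseteq> W n" "W 0 = C" "\<forall>n. \<exists>Q. stp n (W n) (W (Suc n)) Q"
    by metis
  from W(4) obtain Q where "\<forall>n. stp n (W n) (W (Suc n)) (Q n)"
    by (rule choice[THEN exE])
  then have Q: "Q n \<subseteq> W n - closure (W (Suc n))" "separated (e / 2) (Q n)"
      "\<forall>m\<in>M. \<exists>q\<in>Q n. q \<noteq> m \<and> dist q m < 1 / 2 ^ n" "closure (W (Suc n)) \<subseteq> W n"
      "interior (closure (W (Suc n))) = W (Suc n)" "W (Suc n) \<subseteq> (\<Union>m\<in>M. ball m (1 / 2 ^ n))" for n
    unfolding stp_def by blast+
  have "x \<in> M" if x: "\<And>n. x \<in> W n" for x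
  proof -
    have "\<exists>y\<in>M. dist y x < d" if "0 < d" for d
    proof -
      obtain N where N: "\<And>n. N \<le> n \<Longrightarrow> 2 / 2 ^ n < d"
        using two_div_power_less[OF \<open>0 < d\<close>] by blast
      obtain y where "y \<in> M" "dist y x < 1 / 2 ^ N" using x[of "Suc N"] Q(6)[of N] by auto
      moreover have "(1 :: real) / 2 ^ N \<le> 2 / 2 ^ N" by (simp add: divide_right_mono)
      ultimately show ?thesis using N[of N] by force
    qed
    then have "x \<in> closure M" unfolding closure_approachable by blast
    then show ?thesis using closedM by simp
  qed
  then show ?thesis using that[of W Q] W Q by blast
qed

subsection \<open>Labellings\<close>

definition acc :: "('a::topological_space \<Rightarrow> 't) \<Rightarrow> 'a set \<Rightarrow> 'a \<Rightarrow> 't set" where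
  "acc f C x = {t. x islimpt {y\<in>C. f y = t}}"

lemma acc_cong:
  assumes "open T" "x \<in> T" "\<And>y. y \<in> T \<Longrightarrow> y \<noteq> x \<Longrightarrow> (y \<in> C \<longleftrightarrow> y \<in> D) \<and> (y \<in> C \<longrightarrow> f y = g y)"
  shows "acc f C x = acc g D x"
proof -
  have "x islimpt {y\<in>C. f y = t} \<longleftrightarrow> x islimpt {y\<in>D. g y = t}" for t
  proof -
    have "x islimpt S'" if "x islimpt S" and "\<And>y. y \<in> T \<Longrightarrow> y \<noteq> x \<Longrightarrow> y \<in> S \<Longrightarrow> y \<in> S'" for S S'
      using islimpt_Int_open[OF that(1) assms(1,2)] that(2) unfolding islimpt_def by blast
    from this[of "{y\<in>C. f y = t}" "{y\<in>D. g y = t}"] this[of "{y\<in>D. g y = t}" "{y\<in>C. f y = t}"]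
    show ?thesis using assms(3) by force
  qed
  then show ?thesis by (simp add: acc_def)
qed

lemma acc_subset:
  assumes "open T" "x \<in> T" "\<And>y. y \<in> T \<Longrightarrow> y \<in> C \<Longrightarrow> y \<noteq> x \<Longrightarrow> f y \<in> A"
  shows "acc f C x \<subseteq> A"
  using assms unfolding acc_def islimpt_def by blast

text \<open>A label that does not accumulate at \<open>x\<close> is avoided by some punctured
  neighbourhood, and finitely many labels allow these to be intersected.\<close>

lemma acc_nearby:
  assumes "finite (f ` C)"
  obtains T where "open T" "x \<in> T" "\<And>y. y \<in> T \<Longrightarrow> y \<in> C \<Longrightarrow> y \<noteq> x \<Longrightarrow> f y \<in> acc f C x"
proof -
  have "\<exists>T. open T \<and> x \<in> T \<and> (\<forall>y\<in>T. y \<in> C \<longrightarrow> y \<noteq> x \<longrightarrow> f y = t \<longrightarrow> t \<in> acc f C x)" for t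
    unfolding acc_def islimpt_def by blast
  then obtain T where T: "\<And>t. open (T t)" "\<And>t. x \<in> T t"
      "\<And>t y. y \<in> T t \<Longrightarrow> y \<in> C \<Longrightarrow> y \<noteq> x \<Longrightarrow> f y = t \<Longrightarrow> t \<in> acc f C x"
    by metis
  show ?thesis
  proof
    show "open (\<Inter>t\<in>f ` C. T t)" using assms T(1) by blast
    show "x \<in> (\<Inter>t\<in>f ` C. T t)" using T(2) by blast
  qed (use T(3) in blast)
qed

locale labelling =
  fixes Ok :: "'t \<Rightarrow> 't set \<Rightarrow> bool" and Bn :: "'t set \<Rightarrow> 't set"
begin

text \<open>\<open>Ok b U\<close> is to mean that some canonical point has type \<open>b\<close> and sees exactly the types in \<open>U\<close>;
  \<open>Bn U\<close> is to be a nucleus with value \<open>U\<close>, or empty if there is none.\<close>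

definition settles :: "('a::topological_space \<Rightarrow> 't) \<Rightarrow> 'a set \<Rightarrow> 't set \<Rightarrow> 'a \<Rightarrow> bool" where
  "settles f C U x \<longleftrightarrow>
    (\<exists>T. open T \<and> x \<in> T \<and> (\<forall>y\<in>T. y \<in> C \<longrightarrow> y \<noteq> x \<longrightarrow> acc f C y = U \<longrightarrow> f y \<in> Bn U))"

definition good :: "('a::topological_space \<Rightarrow> 't) \<Rightarrow> 'a set \<Rightarrow> 'a \<Rightarrow> bool" where
  "good f C x \<longleftrightarrow> Ok (f x) (acc f C x) \<and> settles f C (acc f C x) x"

text \<open>\<open>U\<close> is the collar: the accumulation set at the frontier of \<open>C\<close>, along which the labelling can be
  glued to others.\<close>

definition rep :: "'a::metric_space itself \<Rightarrow> 't \<Rightarrow> 't set \<Rightarrow> 't set \<Rightarrow> bool" where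
  "rep X b V U \<longleftrightarrow> (\<forall>C M e. open (C :: 'a set) \<longrightarrow> M \<subseteq> C \<longrightarrow> separated e M \<longrightarrow>
    (\<exists>f. (\<forall>x\<in>C. f x \<in> insert b V \<and> acc f C x \<subseteq> V \<and> good f C x) \<and>
         (\<forall>x\<in>M. f x = b \<and> acc f C x = V) \<and>
         (\<forall>x\<in>closure C - C. acc f C x = U \<and> settles f C U x)))"

lemma repD:
  assumes "rep TYPE('a::metric_space) b V U" "open (C :: 'a set)" "M \<subseteq> C" "separated e M"
  obtains f where "\<And>x. x \<in> C \<Longrightarrow> f x \<in> insert b V" "\<And>x. x \<in> C \<Longrightarrow> acc f C x \<subseteq> V"
    "\<And>x. x \<in> C \<Longrightarrow> good f C x" "\<And>x. x \<in> M \<Longrightarrow> f x = b" "\<And>x. x \<in> M \<Longrightarrow> acc f C x = V"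
    "\<And>x. x \<in> closure C \<Longrightarrow> x \<notin> C \<Longrightarrow> acc f C x = U"
    "\<And>x. x \<in> closure C \<Longrightarrow> x \<notin> C \<Longrightarrow> settles f C U x"
proof -
  obtain f where "(\<forall>x\<in>C. f x \<in> insert b V \<and> acc f C x \<subseteq> V \<and> good f C x) \<and>
         (\<forall>x\<in>M. f x = b \<and> acc f C x = V) \<and>
         (\<forall>x\<in>closure C - C. acc f C x = U \<and> settles f C U x)"
    using assms(1)[unfolded rep_def, rule_format, OF assms(2-4)] by (rule exE)
  then show ?thesis by (intro that[of f]) simp_all
qed

text \<open>Accumulation, settling and goodness are local, so a piece keeps them inside any larger
  labelling that agrees with it near the point. The point itself may lie outside the piece, as on a
  frontier.\<close>

lemma settles_cong:
  assumes "open T" "x \<in> T" "\<And>y. y \<in> T \<Longrightarrow> y \<noteq> x \<Longrightarrow> (y \<in> C \<longleftrightarrow> y \<in> D) \<and> (y \<in> C \<longrightarrow> f y = g y)"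
    and x: "x \<in> C \<longleftrightarrow> x \<in> D" "x \<in> C \<Longrightarrow> f x = g x"
    and "settles f C U x"
  shows "settles g D U x"
proof -
  obtain T' where T': "open T'" "x \<in> T'"
      "\<And>y. y\<in>T' \<Longrightarrow> y \<in> C \<Longrightarrow> y \<noteq> x \<Longrightarrow> acc f C y = U \<Longrightarrow> f y \<in> Bn U"
    using assms(6) unfolding settles_def by blast
  have "acc f C y = acc g D y" if "y \<in> T" for y
    by (rule acc_cong[OF assms(1) that]) (use assms(3) x in blast)
  then have "\<forall>y\<in>T \<inter> T'. y \<in> D \<longrightarrow> y \<noteq> x \<longrightarrow> acc g D y = U \<longrightarrow> g y \<in> Bn U"
    using T'(3) assms(3) by (metis IntE)
  then show ?thesis
    unfolding settles_def using T'(1,2) assms(1,2) by (meson IntI open_Int)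
qed

lemma good_cong:
  assumes "open T" "x \<in> T" "\<And>y. y \<in> T \<Longrightarrow> (y \<in> C \<longleftrightarrow> y \<in> D) \<and> (y \<in> C \<longrightarrow> f y = g y)"
    and "x \<in> C" "good f C x"
  shows "good g D x"
proof -
  have "acc f C x = acc g D x"
    by (rule acc_cong[OF assms(1,2)]) (use assms(3) in blast)
  moreover have "settles g D (acc f C x) x"
    by (rule settles_cong[OF assms(1,2), of C D f g]) (use assms in \<open>auto simp: good_def\<close>)
  ultimately show ?thesis using assms by (auto simp: good_def)
qed

text \<open>The kept points of the dissection carry the labels of the nucleus, the removed open sets carry
  representations of the children.\<close>

lemma rep_nucleus:
  assumes "finite V" and nuc: "Bn V \<noteq> {}" "Bn V \<subseteq> V" "\<And>c. c \<in> Bn V \<Longrightarrow> Ok c V" and "Ok b V"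
    and child: "\<And>b' V'. (b', V') \<in> J \<Longrightarrow>
      b' \<in> V \<and> V' \<subset> V \<and> (\<exists>U. rep TYPE('a::{metric_space,perfect_space}) b' V' U)"
    and cover: "V \<subseteq> Bn V \<union> (\<Union>(b', V')\<in>J. insert b' V')"
  shows "rep TYPE('a) b V V"
  unfolding rep_def
proof (intro allI impI)
  fix C M0 :: "'a set" and e
  assume C: "open C" "M0 \<subseteq> C" "separated e M0"
  have "J \<subseteq> V \<times> Pow V" using child by auto
  then have "finite J" using \<open>finite V\<close> by (meson finite_Pow_iff finite_SigmaI finite_subset)
  then have "finite (Inl ` Bn V \<union> Inr ` J)" "Inl ` Bn V \<union> Inr ` J \<noteq> {}"
    using nuc \<open>finite V\<close> by (auto intro: finite_subset)
  \<comment> \<open>Stage \<open>n\<close> of the dissection serves the task \<open>c n\<close>: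
    \<open>Inl\<close> keeps a net for one label of the nucleus, \<open>Inr\<close> removes a
    neighbourhood of the net in which a child is represented with the net as its prescribed points.
    Each task must recur at ever finer scales, because the net of one stage comes only within
    \<open>2 / 2 ^ n\<close> of a given point.\<close>
  then obtain c :: "nat \<Rightarrow> 't + ('t \<times> 't set)" where
    c: "\<And>n. c n \<in> Inl ` Bn V \<union> Inr ` J" "\<And>k N. k \<in> Inl ` Bn V \<union> Inr ` J \<Longrightarrow> \<exists>n\<ge>N. c n = k"
    by (rule sequence_hitting_infinitely_often) blast
  define p where "p = (\<lambda>n. \<not> isl (c n))"
  define pb where "pb = (\<lambda>n. fst (projr (c n)))"
  define pV where "pV = (\<lambda>n. snd (projr (c n)))"
  have pJ: "(pb n, pV n) \<in> J" if "p n" for n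
    using c(1)[of n] that by (auto simp: p_def pb_def pV_def)
  have np: "projl (c n) \<in> Bn V" if "\<not> p n" for n
    using c(1)[of n] that by (auto simp: p_def)
  obtain M N where MN: "\<And>n. M n \<subseteq> C" "\<And>n. separated (1 / 2 ^ n) (M n)" "\<And>n. open (N n)" 
    "\<And>n. closure (N n) \<subseteq> C"
    "\<And>n m. n \<noteq> m \<Longrightarrow> N n \<inter> N m = {}" "\<And>n. p n \<Longrightarrow> M n \<subseteq> N n" "\<And>n. \<not> p n \<Longrightarrow> N n = {}"
    "\<And>n m. \<not> p n \<Longrightarrow> M n \<inter> N m = {}" "\<And>n. M0 \<inter> N n = {}"
    "\<And>n. \<not> p n \<Longrightarrow> M n \<inter> M0 = {}"
    "\<And>n m. \<not> p n \<Longrightarrow> \<not> p m \<Longrightarrow> n \<noteq> m \<Longrightarrow> M n \<inter> M m = {}"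
    "\<And>n x. x \<in> closure C \<Longrightarrow> x \<notin> (\<Union>m. N m) \<Longrightarrow> \<exists>m\<in>M n. dist m x < 2 / 2 ^ n"
    by (rule dissection[OF C, of p]) blast
  have NC: "N n \<subseteq> C" for n using MN(4) closure_subset by blast
  define chi where "chi = (\<lambda>n g. (\<forall>x\<in>N n. g x \<in> insert (pb n) (pV n) \<and> acc g (N n) x \<subseteq> pV n \<and> good g (N n) x) \<and>
      (\<forall>x\<in>M n. g x = pb n \<and> acc g (N n) x = pV n))"
  have "\<exists>g. p n \<longrightarrow> chi n g" for n
  proof (cases "p n")
    case True
    then obtain U where U: "rep TYPE('a) (pb n) (pV n) U" using child pJ by blast
    show ?thesis
      by (rule repD[OF U MN(3) MN(6)[OF True] MN(2)]) (use True in \<open>simp add: chi_def; blast\<close>)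
  qed auto
  then obtain g where "\<And>n. p n \<Longrightarrow> chi n (g n)" by metis
  then have g: "\<And>n x. p n \<Longrightarrow> x \<in> N n \<Longrightarrow> g n x \<in> insert (pb n) (pV n)"
      "\<And>n x. p n \<Longrightarrow> x \<in> N n \<Longrightarrow> acc (g n) (N n) x \<subseteq> pV n" 
      "\<And>n x. p n \<Longrightarrow> x \<in> N n \<Longrightarrow> good (g n) (N n) x"
      "\<And>n x. p n \<Longrightarrow> x \<in> M n \<Longrightarrow> g n x = pb n"
      "\<And>n x. p n \<Longrightarrow> x \<in> M n \<Longrightarrow> acc (g n) (N n) x = pV n"
    by (auto simp: chi_def)
  \<comment> \<open>A default for the remaining points that lie in no kept net; settling requires a
    label of the nucleus for them too.\<close>
  obtain c0 where c0: "c0 \<in> Bn V" using nuc by blast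
  define f where "f = (\<lambda>x. if \<exists>n. x \<in> N n then g (THE n. x \<in> N n) x else if x \<in> M0 then b
    else if \<exists>n. \<not> p n \<and> x \<in> M n then projl (c (THE n. \<not> p n \<and> x \<in> M n)) else c0)"
  have pN: "p n" if "x \<in> N n" for x n using MN(7) that by blast
  have fN: "f x = g n x" if "x \<in> N n" for x n
  proof -
    have "(THE n. x \<in> N n) = n" using that MN(5) by blast
    then show ?thesis using that by (auto simp: f_def)
  qed
  have fM0: "f x = b" if "x \<in> M0" for x using that MN(9) by (auto simp: f_def)
  have fM: "f x = projl (c n)" if "x \<in> M n" "\<not> p n" for x n
  proof -
    have "(THE n. \<not> p n \<and> x \<in> M n) = n" using that MN(11) by blast
    then show ?thesis using that MN(8)[of n] MN(10)[of n] by (auto simp: f_def)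
  qed
  have fK: "f x \<in> Bn V" if "x \<notin> (\<Union>n. N n)" "x \<notin> M0" for x
  proof (cases "\<exists>n. \<not> p n \<and> x \<in> M n")
    case True
    then show ?thesis using fM np by metis
  next
    case False
    then show ?thesis using that c0 by (auto simp: f_def)
  qed
  have accN: "acc f C x = acc (g n) (N n) x" if "x \<in> N n" for x n
    by (rule acc_cong[OF MN(3) that]) (use fN NC in auto)
  have goodN: "good f C x" if "x \<in> N n" for x n
    by (rule good_cong[OF MN(3) that _ that g(3)[OF pN[OF that] that]]) (use fN NC in auto)
  have fV: "f x \<in> V" if "x \<notin> M0" for x
  proof (cases "x \<in> (\<Union>n. N n)")
    case True
    then show ?thesis using fN g(1) pN pJ child by (metis UN_E insert_iff psubsetD)
  next
    case False
    then show ?thesis using fK nuc that by blast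
  qed
  have acc_less: "acc f C x \<subset> V" if "x \<in> N n" for x n
    using accN g(2) pN pJ child that by (metis subset_psubset_trans)
  have accV: "acc f C x = V" if x: "x \<in> closure C" "x \<notin> (\<Union>n. N n)" for x
  proof
    obtain T where "open T" "x \<in> T" "T \<inter> M0 \<subseteq> {x}"
      using neighbourhood_avoiding_separated[OF C(3)] by blast
    then show "acc f C x \<subseteq> V"
      by (intro acc_subset[of T]) (use fV in auto)
    show "V \<subseteq> acc f C x"
    proof
      fix t assume t: "t \<in> V"
      have "\<exists>y\<in>{y\<in>C. f y = t}. y \<noteq> x \<and> dist y x < d" if d: "0 < d" for d
      proof -
        obtain N0 where N0: "\<And>n. N0 \<le> n \<Longrightarrow> 2 / 2 ^ n < d"
          using two_div_power_less[OF d] by blast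
        show ?thesis
        proof (cases "t \<in> Bn V")
          case True
          \<comment> \<open>\<open>x\<close> may itself belong to the net of a stage. Kept nets of
            different stages are disjoint, so of two suitable stages at least one provides a point
            other than \<open>x\<close>.\<close>
          then obtain n1 where n1: "N0 \<le> n1" "c n1 = Inl t" using c(2) by blast
          then obtain n2 where n2: "Suc n1 \<le> n2" "c n2 = Inl t" using True c(2) by blast
          obtain n where n: "N0 \<le> n" "c n = Inl t" "x \<notin> M n"
          proof (cases "x \<in> M n1")
            case True
            then have "x \<notin> M n2" using MN(11)[of n1 n2] n1 n2 by (auto simp: p_def)
            moreover have "N0 \<le> n2" using n1 n2 by simp
            ultimately show ?thesis using that n2 by blast
          qed (use that n1 in blast)
          obtain m where m: "m \<in> M n" "dist m x < d"
            using MN(12)[OF x, of n] N0[OF n(1)] by force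
          then show ?thesis using n fM[of m n] MN(1) by (force simp: p_def)
        next
          case False
          then obtain b' V' where J: "(b', V') \<in> J" "t \<in> insert b' V'" using cover t by blast
          then obtain n where n: "N0 \<le> n" "c n = Inr (b', V')" using c(2) by blast
          then have pn: "p n" "pb n = b'" "pV n = V'" by (auto simp: p_def pb_def pV_def)
          obtain m where m: "m \<in> M n" "dist m x < d"
            using MN(12)[OF x, of n] N0[OF n(1)] by force
          have mN: "m \<in> N n" using m MN(6) pn by blast
          then have "m \<noteq> x" using x by blast
          show ?thesis
          proof (cases "t = b'")
            case True
            then show ?thesis using fN[OF mN] g(4) m pn \<open>m \<noteq> x\<close> MN(1) by force
          next
            case False
            then have "m islimpt {y\<in>C. f y = t}"
              using J accN[OF mN] g(5) m pn by (auto simp: acc_def)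
            moreover have "open (ball x d - {x})" "m \<in> ball x d - {x}"
              using m \<open>m \<noteq> x\<close> by (auto simp: dist_commute)
            ultimately show ?thesis
              unfolding islimpt_def by (metis DiffE dist_commute mem_ball singletonI)
          qed
        qed
      qed
      then show "t \<in> acc f C x" by (auto simp: acc_def islimpt_approachable)
    qed
  qed
  \<comment> \<open>Points of the removed sets have strictly smaller accumulation sets. Hence the
    value \<open>V\<close> occurs only at remaining points, whose labels are in the nucleus unless
    they belong to \<open>M0\<close>, and \<open>M0\<close> is sparse.\<close>
  have settles: "settles f C V x" for x
  proof -
    obtain T where T: "open T" "x \<in> T" "T \<inter> M0 \<subseteq> {x}"
      using neighbourhood_avoiding_separated[OF C(3)] by blast
    have "f y \<in> Bn V" if "y \<in> T" "y \<noteq> x" "acc f C y = V" for y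
      using fK[of y] acc_less[of y] that T by blast
    then show ?thesis using T unfolding settles_def by blast
  qed
  have good: "good f C x" if "x \<in> C" for x
  proof (cases "x \<in> (\<Union>n. N n)")
    case True
    then show ?thesis using goodN by blast
  next
    case False
    moreover have "x \<in> closure C" using that closure_subset by blast
    moreover have "Ok (f x) V"
      using fM0 fK False nuc \<open>Ok b V\<close> by metis
    ultimately show ?thesis using accV settles by (simp add: good_def)
  qed
  have "acc f C x \<subseteq> V" if "x \<in> C" for x
    using acc_less[of x] accV[of x] that closure_subset[of C] by blast
  moreover have "f x \<in> insert b V" for x using fV fM0 by blast
  moreover have "acc f C x = V" if "x \<in> M0" for x
    using that accV[of x] C(2) MN(9) closure_subset[of C] by blast
  moreover have "acc f C x = V" if "x \<in> closure C - C" for x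
    using that accV[of x] NC by blast
  ultimately show "\<exists>f. (\<forall>x\<in>C. f x \<in> insert b V \<and> acc f C x \<subseteq> V \<and> good f C x) \<and>
         (\<forall>x\<in>M0. f x = b \<and> acc f C x = V) \<and>
         (\<forall>x\<in>closure C - C. acc f C x = V \<and> settles f C V x)"
    using fM0 good settles by blast
qed

text \<open>The shells around \<open>M\<close> are labelled according to an infinite walk \<open>s\<close>. Collars of consecutive
  shells are comparable, and the frontier between two shells gets a label of the larger one.\<close>

lemma rep_shells:
  fixes s :: "nat \<Rightarrow> 't \<times> 't set \<times> 't set"
  assumes "finite V" "Ok b V"
    and J: "\<And>b' V' U. (b', V', U) \<in> J \<Longrightarrow> rep TYPE('a::{metric_space,perfect_space}) b' V' U \<and>
      b' \<in> V \<and> V' \<subset> V \<and> U \<subseteq> V' \<and> Bn U \<noteq> {} \<and> Bn U \<subseteq> U \<and> (\<forall>c\<in>Bn U. Ok c U)"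
    and cover: "V \<subseteq> (\<Union>(b', V', U)\<in>J. insert b' V')"
    and s: "\<And>n. s n \<in> J" "\<And>j N. j \<in> J \<Longrightarrow> \<exists>n\<ge>N. s n = j"
      "\<And>n. snd (snd (s n)) \<subseteq> snd (snd (s (Suc n))) \<or> snd (snd (s (Suc n))) \<subseteq> snd (snd (s n))"
      "snd (snd (s 0)) = U0"
  shows "rep TYPE('a) b V U0"
  unfolding rep_def
proof (intro allI impI)
  fix C M :: "'a set" and e
  assume C: "open C" "M \<subseteq> C" "separated e M"
  obtain W Q where W: "W 0 = C" "\<And>n. open (W n)" "\<And>n. M \<subseteq> W n"
    "\<And>n. Q n \<subseteq> W n - closure (W (Suc n))" "\<And>n. separated (e / 2) (Q n)"
    "\<And>n m. m \<in> M \<Longrightarrow> \<exists>q\<in>Q n. q \<noteq> m \<and> dist q m < 1 / 2 ^ n"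
    "\<And>n. closure (W (Suc n)) \<subseteq> W n" "\<And>n. interior (closure (W (Suc n))) = W (Suc n)"
    "\<And>x. (\<And>n. x \<in> W n) \<Longrightarrow> x \<in> M"
    by (rule shrinking_neighbourhoods[OF C]) blast
  define R where "R n = W n - closure (W (Suc n))" for n
  define sb where "sb n = fst (s n)" for n
  define sV where "sV n = fst (snd (s n))" for n
  define sU where "sU n = snd (snd (s n))" for n
  have sJ: "(sb n, sV n, sU n) \<in> J" for n using s(1)[of n] by (simp add: sb_def sV_def sU_def)
  have sJ': "rep TYPE('a) (sb n) (sV n) (sU n)" "sb n \<in> V" "sV n \<subset> V" "sU n \<subseteq> sV n" 
    "Bn (sU n) \<noteq> {}" "Bn (sU n) \<subseteq> sU n" "c \<in> Bn (sU n) \<Longrightarrow> Ok c (sU n)" for n c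
    using J[OF sJ[of n]] by blast+
  have sU: "sU n \<subseteq> sU (Suc n) \<or> sU (Suc n) \<subseteq> sU n" for n using s(3) by (simp add: sU_def)
  \<comment> \<open>A frontier point between two consecutive shells sees the collars of both. By
    comparability the union is one of the two, so it carries a nucleus from which the frontier can
    be labelled.\<close>
  define F where "F n = sU n \<union> sU (Suc n)" for n
  have F: "F n = sU n \<or> F n = sU (Suc n)" for n using sU[of n] by (auto simp: F_def)
  have F': "F n \<subset> V" "Bn (F n) \<noteq> {}" "Bn (F n) \<subseteq> F n" for n
    using F[of n] sJ'(3-6)[of n] sJ'(3-6)[of "Suc n"] by auto
  have F'': "Ok c (F n)" if "c \<in> Bn (F n)" for n c
    using F[of n] sJ'(7) that by metis
  have Wmono: "W n \<subseteq> W m" if "m \<le> n" for m n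
    by (rule lift_Suc_antimono_le[OF _ that]) (use W(7) closure_subset in blast)
  have WC: "W n \<subseteq> C" for n using Wmono[of 0 n] W(1) by simp
  have openR: "open (R n)" for n using W(2) by (auto simp: R_def)
  define chi where "chi n g \<longleftrightarrow> (\<forall>x\<in>R n. g x \<in> insert (sb n) (sV n) \<and> acc g (R n) x \<subseteq> sV n \<and> good g (R n) x) \<and>
         (\<forall>x\<in>Q n. g x = sb n \<and> acc g (R n) x = sV n) \<and>
         (\<forall>x\<in>closure (R n) - R n. acc g (R n) x = sU n \<and> settles g (R n) (sU n) x)" for n g
  have "\<exists>g. chi n g" for n
    using sJ'(1)[of n, unfolded rep_def, rule_format, OF openR W(4,5)[of n, folded R_def]]
    unfolding chi_def .
  then obtain g where "\<And>n. chi n (g n)" by metis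
  then have g: "\<And>n x. x \<in> R n \<Longrightarrow> g n x \<in> insert (sb n) (sV n)"
      "\<And>n x. x \<in> R n \<Longrightarrow> acc (g n) (R n) x \<subseteq> sV n" 
      "\<And>n x. x \<in> R n \<Longrightarrow> good (g n) (R n) x"
      "\<And>n x. x \<in> Q n \<Longrightarrow> g n x = sb n"
      "\<And>n x. x \<in> Q n \<Longrightarrow> acc (g n) (R n) x = sV n"
      "\<And>n x. x \<in> closure (R n) \<Longrightarrow> x \<notin> R n \<Longrightarrow> acc (g n) (R n) x = sU n"
      "\<And>n x. x \<in> closure (R n) \<Longrightarrow> x \<notin> R n \<Longrightarrow> settles (g n) (R n) (sU n) x"
    by (auto simp: chi_def)
  define lev where "lev x = (THE n. x \<in> W n - W (Suc n))" for x
  have lev: "lev x = n" if "x \<in> W n" "x \<notin> W (Suc n)" for x n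
    unfolding lev_def
  proof (rule the_equality)
    fix m assume m: "x \<in> W m - W (Suc m)"
    show "m = n"
    proof (rule ccontr)
      assume "m \<noteq> n"
      then consider "Suc m \<le> n" | "Suc n \<le> m" by linarith
      then show False using Wmono m that by cases blast+
    qed
  qed (use that in blast)
  have ex_lev: "\<exists>n. x \<in> W n \<and> x \<notin> W (Suc n)" if "x \<in> C" "x \<notin> M" for x
  proof (rule ccontr)
    assume n: "\<not> ?thesis"
    have "x \<in> W n" for n by (induction n) (use n that W(1) in auto)
    then show False using W(9) that by blast
  qed
  define lab where "lab n = (SOME c. c \<in> Bn (F n))" for n
  have lab: "lab n \<in> Bn (F n)" for n unfolding lab_def using F'(2) by (simp add: some_in_eq)
  define f where "f x = (if x \<in> M then b else if x \<in> R (lev x) then g (lev x) x else lab (lev x))" for x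
  have fM: "f x = b" if "x \<in> M" for x using that by (simp add: f_def)
  have RW: "x \<in> W n" "x \<notin> W (Suc n)" "x \<notin> M" "x \<in> C" if "x \<in> R n" for x n
    using that closure_subset[of "W (Suc n)"] W(3)[of "Suc n"] WC[of n] by (auto simp: R_def)
  have fR: "f x = g n x" if "x \<in> R n" for x n
    using lev[OF RW(1,2)[OF that]] RW(3)[OF that] that by (simp add: f_def)
  define B where "B n = closure (W (Suc n)) - W (Suc n)" for n
  have BW: "x \<in> W n" "x \<notin> W (Suc n)" "x \<notin> M" "x \<in> C" "x \<notin> R n" if "x \<in> B n" for x n
    using that W(7)[of n] W(3)[of "Suc n"] WC[of n] by (auto simp: B_def R_def)
  have fB: "f x = lab n" if "x \<in> B n" for x n
    using lev[OF BW(1,2)[OF that]] BW(3,5)[OF that] by (simp add: f_def)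
  have cases: "x \<in> M \<or> (\<exists>n. x \<in> R n) \<or> (\<exists>n. x \<in> B n)" if "x \<in> C" for x
    using ex_lev[OF that] by (auto simp: R_def B_def)
  have gV: "g n x \<in> V" if "x \<in> R n" for x n using g(1)[OF that] sJ'(2,3)[of n] by auto
  have fV: "f x \<in> V" if "x \<in> C" "x \<notin> M" for x
    using cases[OF that(1)] that fR gV fB lab F'(1,3) by (metis psubsetD subsetD)
  have fin_g: "finite (g n ` R n)" for n
    using gV[of _ n] \<open>finite V\<close> by (meson finite_subset image_subsetI)
  have accR: "acc f C x = acc (g n) (R n) x" if "x \<in> R n" for x n
    by (rule acc_cong[OF openR that]) (use fR RW in auto)
  have goodR: "good f C x" if "x \<in> R n" for x n
    by (rule good_cong[OF openR that _ that g(3)[OF that]]) (use fR RW in auto)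
  have R_less: "acc f C x \<subset> V" if "x \<in> R n" for x n
    using accR[OF that] g(2)[OF that] sJ'(3)[of n] by simp
  have clR: "x \<in> closure (R n)" "x \<in> closure (R (Suc n))" "x \<notin> R (Suc n)" if x: "x \<in> B n" for x n
  proof -
    \<comment> \<open>Regularity of \<open>W (Suc n)\<close>: a frontier point with a neighbourhood
      missing the outer shell would be interior to \<open>closure (W (Suc n))\<close>, hence in
      \<open>W (Suc n)\<close>.\<close>
    show "x \<in> closure (R n)"
    proof (rule ccontr)
      assume "x \<notin> closure (R n)"
      then have T: "open (W n - closure (R n))" "x \<in> W n - closure (R n)"
        using W(2) BW(1)[OF x] by auto
      have "W n - closure (R n) \<subseteq> closure (W (Suc n))"
        using closure_subset[of "R n"] by (auto simp: R_def)
      then have "x \<in> interior (closure (W (Suc n)))"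
        using T interiorI by blast
      then show False using W(8) BW(2)[OF x] by simp
    qed
    have "x \<notin> closure (W (Suc (Suc n)))" using x W(7)[of "Suc n"] by (auto simp: B_def)
    then show "x \<in> closure (R (Suc n))"
      using x closure_Un[of "R (Suc n)" "closure (W (Suc (Suc n)))"]
        closure_mono[of "W (Suc n)" "R (Suc n) \<union> closure (W (Suc (Suc n)))"]
      by (auto simp: B_def R_def)
    show "x \<notin> R (Suc n)" using BW(2)[OF x] by (simp add: R_def)
  qed
  have T0: "open (W n - closure (W (Suc (Suc n))))" for n using W(2) by auto
  have xT0: "x \<in> W n - closure (W (Suc (Suc n)))" if "x \<in> B n" for x n
    using BW(1,2)[OF that] W(7)[of "Suc n"] by auto
  have T0_cases: "y \<in> R n \<or> y \<in> B n \<or> y \<in> R (Suc n)" if "y \<in> W n - closure (W (Suc (Suc n)))" for y n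
    using that by (auto simp: R_def B_def)
  have accB: "acc f C x = F n" if x: "x \<in> B n" for x n
  proof
    have "acc (g m) (R m) x \<subseteq> acc f C x" for m
      using fR[of _ m] RW(4)[of _ m] unfolding acc_def by (auto elim!: islimpt_subset)
    then show "F n \<subseteq> acc f C x"
      using g(6)[OF clR(1)[OF x] BW(5)[OF x]] g(6)[OF clR(2,3)[OF x]] F_def by blast
    show "acc f C x \<subseteq> F n"
    proof
      fix t assume "t \<in> acc f C x"
      then have "x islimpt {y\<in>C. f y = t} \<inter> (W n - closure (W (Suc (Suc n))))"
        using islimpt_Int_open[OF _ T0 xT0[OF x]] by (simp add: acc_def)
      \<comment> \<open>The frontier contributes only its own label \<open>lab n\<close>, which
        causes no growth because a nucleus is contained in its value.\<close>
      moreover have "{y\<in>C. f y = t} \<inter> (W n - closure (W (Suc (Suc n)))) \<subseteq>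
         {y\<in>R n. g n y = t} \<union> {y\<in>R (Suc n). g (Suc n) y = t} \<union> {y\<in>B n. lab n = t}"
      proof
        fix y assume "y \<in> {y\<in>C. f y = t} \<inter> (W n - closure (W (Suc (Suc n))))"
        then show "y \<in> {y\<in>R n. g n y = t} \<union> {y\<in>R (Suc n). g (Suc n) y = t} \<union> {y\<in>B n. lab n = t}"
          using T0_cases[of y n] fR[of y n] fR[of y "Suc n"] fB[of y n] by auto
      qed
      ultimately have "x islimpt {y\<in>R n. g n y = t} \<union> {y\<in>R (Suc n). g (Suc n) y = t} \<union> {y\<in>B n. lab n = t}"
        using islimpt_subset by blast
      then have "t \<in> acc (g n) (R n) x \<or> t \<in> acc (g (Suc n)) (R (Suc n)) x \<or>
          x islimpt {y\<in>B n. lab n = t}"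
        by (simp add: islimpt_Un acc_def)
      then consider "t \<in> acc (g n) (R n) x" | "t \<in> acc (g (Suc n)) (R (Suc n)) x" |
          "x islimpt {y\<in>B n. lab n = t}"
        by metis
      then show "t \<in> F n"
      proof cases
        case 1
        then show ?thesis using g(6)[OF clR(1)[OF x] BW(5)[OF x]] by (simp add: F_def)
      next
        case 2
        then show ?thesis using g(6)[OF clR(2,3)[OF x]] by (simp add: F_def)
      next
        case 3
        then have "lab n = t" by (cases "lab n = t") auto
        then show ?thesis using lab F'(3) by blast
      qed
    qed
  qed
  \<comment> \<open>If the collar of the shell is all of \<open>F n\<close>, the shell settles there
    already. If it is smaller, then points of the shell near \<open>x\<close> accumulate only labels
    of that collar, so none of them has accumulation set \<open>F n\<close>.\<close>
  have side: "\<exists>T. open T \<and> x \<in> T \<and> (\<forall>y\<in>T. y \<in> R m \<longrightarrow> acc f C y = F n \<longrightarrow> f y \<in> Bn (F n))"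
    if x: "x \<in> closure (R m)" "x \<notin> R m" and m: "sU m \<subseteq> F n" for x m n
  proof (cases "F n = sU m")
    case True
    then show ?thesis
      using g(7)[OF x] accR fR x(2) unfolding settles_def by metis
  next
    case False
    obtain T where T: "open T" "x \<in> T" "\<And>y. y \<in> T \<Longrightarrow> y \<in> R m \<Longrightarrow> y \<noteq> x \<Longrightarrow> g m y \<in> acc (g m) (R m) x"
      using acc_nearby[OF fin_g] by blast
    have "acc f C y \<noteq> F n" if "y \<in> T" "y \<in> R m" for y
    proof -
      have "acc (g m) (R m) y \<subseteq> sU m"
        by (rule acc_subset[OF T(1) that(1)]) (use T(3) g(6)[OF x] x(2) in blast)
      then show ?thesis using accR[OF that(2)] False m by auto
    qed
    then show ?thesis using T(1,2) by blast
  qed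
  have settlesB: "settles f C (F n) x" if x: "x \<in> B n" for x n
  proof -
    have "sU n \<subseteq> F n" "sU (Suc n) \<subseteq> F n" by (auto simp: F_def)
    then obtain T1 T2 where T: "open T1" "x \<in> T1" "\<forall>y\<in>T1. y \<in> R n \<longrightarrow> acc f C y = F n \<longrightarrow> f y \<in> Bn (F n)"
      "open T2" "x \<in> T2" "\<forall>y\<in>T2. y \<in> R (Suc n) \<longrightarrow> acc f C y = F n \<longrightarrow> f y \<in> Bn (F n)"
      using side[OF clR(1)[OF x] BW(5)[OF x]] side[OF clR(2,3)[OF x]] by meson
    let ?T = "(W n - closure (W (Suc (Suc n)))) \<inter> T1 \<inter> T2"
    have "open ?T" "x \<in> ?T" using T T0 xT0[OF x] by (auto intro!: open_Int)
    moreover have "f y \<in> Bn (F n)" if "y \<in> ?T" "acc f C y = F n" for y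
      using T0_cases[of y n] T that fB lab by (metis IntE)
    ultimately show ?thesis unfolding settles_def by blast
  qed
  have goodB: "good f C x" if "x \<in> B n" for x n
    using accB settlesB fB lab F'' that by (simp add: good_def)
  have accM: "acc f C x = V" if x: "x \<in> M" for x
  proof
    obtain T where "open T" "x \<in> T" "T \<inter> M \<subseteq> {x}"
      using neighbourhood_avoiding_separated[OF C(3)] by blast
    then show "acc f C x \<subseteq> V"
      by (intro acc_subset[of T]) (use fV in auto)
    show "V \<subseteq> acc f C x"
    proof
      fix t assume t: "t \<in> V"
      then obtain b' V' U' where j: "(b', V', U') \<in> J" "t \<in> insert b' V'" using cover by blast
      have "\<exists>y\<in>{y\<in>C. f y = t}. y \<noteq> x \<and> dist y x < d" if d: "0 < d" for d
      proof -
        obtain N0 where N0: "\<And>n. N0 \<le> n \<Longrightarrow> 2 / 2 ^ n < d"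
          using two_div_power_less[OF d] by blast
        obtain n where n: "N0 \<le> n" "s n = (b', V', U')" using s(2)[OF j(1)] by blast
        obtain q where q: "q \<in> Q n" "q \<noteq> x" "dist q x < 1 / 2 ^ n" using W(6)[OF x] by blast
        moreover have "(1 :: real) / 2 ^ n \<le> 2 / 2 ^ n" by (simp add: divide_right_mono)
        ultimately have qd: "dist q x < d" using N0[OF n(1)] by linarith
        have qR: "q \<in> R n" using q W(4) by (auto simp: R_def)
        show ?thesis
        proof (cases "t = b'")
          case True
          then have "f q = t" using fR[OF qR] g(4)[OF q(1)] n by (simp add: sb_def)
          then show ?thesis using RW(4)[OF qR] q qd by blast
        next
          case False
          then have "t \<in> acc f C q" using j accR[OF qR] g(5)[OF q(1)] n by (simp add: sV_def)
          then have "q islimpt {y\<in>C. f y = t}" by (simp add: acc_def)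
          moreover have "open (ball x d - {x})" "q \<in> ball x d - {x}"
            using q qd by (auto simp: dist_commute)
          ultimately show ?thesis
            unfolding islimpt_def by (metis DiffE dist_commute mem_ball singletonI)
        qed
      qed
      then show "t \<in> acc f C x" by (auto simp: acc_def islimpt_approachable)
    qed
  qed
  \<comment> \<open>All other points near \<open>x\<close> have accumulation sets strictly below
    \<open>V\<close>, so settling at \<open>V\<close> is vacuous: this is how a value without a
    nucleus can be realised.\<close>
  have goodM: "good f C x" if x: "x \<in> M" for x
  proof -
    obtain T where T: "open T" "x \<in> T" "T \<inter> M \<subseteq> {x}"
      using neighbourhood_avoiding_separated[OF C(3)] by blast
    have "acc f C y \<noteq> V" if "y \<in> T" "y \<in> C" "y \<noteq> x" for y
      using cases[OF that(2)] that T R_less accB F'(1) by blast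
    then have "settles f C V x" unfolding settles_def using T by blast
    then show ?thesis using accM[OF x] fM[OF x] \<open>Ok b V\<close> by (simp add: good_def)
  qed
  have "good f C x \<and> acc f C x \<subseteq> V" if "x \<in> C" for x
    using cases[OF that] goodM goodB goodR accM accB F'(1) R_less by (metis order_refl psubset_imp_subset)
  \<comment> \<open>Since \<open>closure (W (Suc 0))\<close> lies inside \<open>C\<close>, only
    shell 0 reaches the frontier of \<open>C\<close>; the start of the walk therefore decides the
    collar of the whole.\<close>
  moreover have "acc f C x = U0 \<and> settles f C U0 x" if x: "x \<in> closure C - C" for x
  proof -
    have T: "open (- closure (W (Suc 0)))" "x \<in> - closure (W (Suc 0))"
      using x W(7)[of 0] W(1) by auto
    have eq: "(y \<in> R 0 \<longleftrightarrow> y \<in> C) \<and> (y \<in> R 0 \<longrightarrow> g 0 y = f y)" if "y \<in> - closure (W (Suc 0))" for y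
      using that W(1) fR[of y 0] by (auto simp: R_def)
    have "x \<in> closure (R 0)"
    proof (rule ccontr)
      assume n: "x \<notin> closure (R 0)"
      have "open (- closure (W (Suc 0)) - closure (R 0))" by auto
      moreover have "x \<in> - closure (W (Suc 0)) - closure (R 0)" using T n by blast
      ultimately have "(- closure (W (Suc 0)) - closure (R 0)) \<inter> C \<noteq> {}"
        using x open_Int_closure_eq_empty by blast
      then show False using eq closure_subset[of "R 0"] by blast
    qed
    moreover have "x \<notin> R 0" using eq T x by blast
    ultimately have "acc (g 0) (R 0) x = sU 0" "settles (g 0) (R 0) (sU 0) x" using g(6,7) by blast+
    moreover have "acc (g 0) (R 0) x = acc f C x"
      by (rule acc_cong[OF T]) (use eq in blast)
    moreover have "settles f C (sU 0) x"
      by (rule settles_cong[OF T, of "R 0" C "g 0" f]) (use eq T calculation in blast)+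
    ultimately show ?thesis using s(4) by (simp add: sU_def)
  qed
  ultimately show "\<exists>f. (\<forall>x\<in>C. f x \<in> insert b V \<and> acc f C x \<subseteq> V \<and> good f C x) \<and>
         (\<forall>x\<in>M. f x = b \<and> acc f C x = V) \<and>
         (\<forall>x\<in>closure C - C. acc f C x = U0 \<and> settles f C U0 x)"
    using fM accM fV by (intro exI[of _ f]) blast
qed

end

subsection \<open>Propositional reasoning\<close>

fun pval :: "('v form \<Rightarrow> bool) \<Rightarrow> 'v form \<Rightarrow> bool" where
  "pval v \<^bold>\<top> \<longleftrightarrow> True"
| "pval v (\<^bold>\<not> \<phi>) \<longleftrightarrow> \<not> pval v \<phi>"
| "pval v (\<phi> \<^bold>\<and> \<psi>) \<longleftrightarrow> pval v \<phi> \<and> pval v \<psi>"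
| "pval v \<phi> \<longleftrightarrow> v \<phi>"

fun primes :: "'v form \<Rightarrow> 'v form set" where
  "primes \<^bold>\<top> = {}"
| "primes (\<^bold>\<not> \<phi>) = primes \<phi>"
| "primes (\<phi> \<^bold>\<and> \<psi>) = primes \<phi> \<union> primes \<psi>"
| "primes \<phi> = {\<phi>}"

fun pabs :: "('v form \<Rightarrow> nat) \<Rightarrow> 'v form \<Rightarrow> pform" where
  "pabs i \<^bold>\<top> = PTru"
| "pabs i (\<^bold>\<not> \<phi>) = PNeg (pabs i \<phi>)"
| "pabs i (\<phi> \<^bold>\<and> \<psi>) = PAnd (pabs i \<phi>) (pabs i \<psi>)"
| "pabs i \<phi> = PVar (i \<phi>)"

lemma finite_primes: "finite (primes \<phi>)"
  by (induction \<phi> rule: primes.induct) auto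

lemma pinst_pabs: "(\<And>\<xi>. \<xi> \<in> primes \<phi> \<Longrightarrow> \<sigma> (i \<xi>) = \<xi>) \<Longrightarrow> pinst \<sigma> (pabs i \<phi>) = \<phi>"
  by (induction i \<phi> rule: pabs.induct) auto

lemma peval_pabs: "peval v (pabs i \<phi>) \<longleftrightarrow> pval (\<lambda>\<xi>. v (i \<xi>)) \<phi>"
  by (induction i \<phi> rule: pabs.induct) auto

lemma pval_foldr_Imp: "pval v (foldr Imp xs \<phi>) \<longleftrightarrow> ((\<forall>x\<in>set xs. pval v x) \<longrightarrow> pval v \<phi>)"
  by (induction xs) auto

text \<open>One completeness proof serves both systems: every condition on tangles is restricted to
  tangles in \<open>L\<close>, and \<open>lang_d\<close> has none.\<close>

locale tangle_logic =
  fixes L H :: "'v form set"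
  assumes L_Tru: "\<^bold>\<top> \<in> L" and L_Neg: "\<^bold>\<not> \<phi> \<in> L \<longleftrightarrow> \<phi> \<in> L"
    and L_And: "\<phi> \<^bold>\<and> \<psi> \<in> L \<longleftrightarrow> \<phi> \<in> L \<and> \<psi> \<in> L" and L_Box: "\<^bold>[d\<^bold>] \<phi> \<in> L \<longleftrightarrow> \<phi> \<in> L"
    and L_Dt: "\<langle>dt\<rangle> \<Gamma> \<in> L \<Longrightarrow> \<Gamma> \<noteq> {||} \<and> fset \<Gamma> \<subseteq> L"
    and H_L: "H \<subseteq> L"
    and H_taut: "taut_instances L \<subseteq> H" and H_K: "K_scheme L \<subseteq> H" and H_D: "D_axiom \<in> H"
    and H_four: "four_scheme L \<subseteq> H" and H_G1: "G1_scheme L \<subseteq> H"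
    and H_Fix: "\<langle>dt\<rangle> \<Gamma> \<in> L \<Longrightarrow> \<gamma> |\<in>| \<Gamma> \<Longrightarrow> \<langle>dt\<rangle> \<Gamma> \<^bold>\<rightarrow> \<langle>d\<rangle> (\<gamma> \<^bold>\<and> \<langle>dt\<rangle> \<Gamma>) \<in> H"
    and H_Ind: "\<langle>dt\<rangle> \<Gamma> \<in> L \<Longrightarrow> \<phi> \<in> L \<Longrightarrow> distinct gs \<Longrightarrow> set gs = fset \<Gamma> \<Longrightarrow>
      \<box>* (\<phi> \<^bold>\<rightarrow> BigAnd (map (\<lambda>\<gamma>. \<langle>d\<rangle> (\<gamma> \<^bold>\<and> \<phi>)) gs)) \<^bold>\<rightarrow> (\<phi> \<^bold>\<rightarrow> \<langle>dt\<rangle> \<Gamma>) \<in> H"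
    and H_mp: "\<phi> \<in> H \<Longrightarrow> \<phi> \<^bold>\<rightarrow> \<psi> \<in> H \<Longrightarrow> \<psi> \<in> H"
    and H_nec: "\<phi> \<in> H \<Longrightarrow> \<^bold>[d\<^bold>] \<phi> \<in> H"
begin

lemmas L_simps = L_Tru L_Neg L_And L_Box

lemma primes_L: "\<phi> \<in> L \<Longrightarrow> primes \<phi> \<subseteq> L"
  by (induction \<phi> rule: primes.induct) (auto simp: L_simps)

text \<open>Prime formulas, the propositionally indecomposable ones, are finitely many in \<phi>.
  Numbering them injectively turns \<phi> into a propositional formula of which it is an
  instance.\<close>

lemma tautology_in_H:
  assumes "\<phi> \<in> L" "\<And>v. pval v \<phi>"
  shows "\<phi> \<in> H"
proof -
  define i where "i = to_nat_on (primes \<phi>)"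
  \<comment> \<open>Numbers of no prime formula are sent to truth, which keeps the whole
    substitution inside \<open>L\<close>.\<close>
  define \<sigma> where "\<sigma> n = (if n \<in> i ` primes \<phi> then inv_into (primes \<phi>) i n else \<^bold>\<top>)" for n
  have inj: "inj_on i (primes \<phi>)"
    unfolding i_def by (intro inj_on_to_nat_on countable_finite finite_primes)
  then have "pinst \<sigma> (pabs i \<phi>) = \<phi>"
    by (intro pinst_pabs) (simp add: \<sigma>_def)
  moreover have "range \<sigma> \<subseteq> L"
  proof clarify
    fix n show "\<sigma> n \<in> L"
    proof (cases "n \<in> i ` primes \<phi>")
      case True
      then show ?thesis using inv_into_into[OF True] primes_L[OF assms(1)] by (simp add: \<sigma>_def subset_iff)
    qed (simp add: \<sigma>_def L_Tru)
  qed
  moreover have "\<forall>v. peval v (pabs i \<phi>)"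
    using assms(2) by (simp add: peval_pabs)
  ultimately have "\<phi> \<in> taut_instances L" unfolding taut_instances_def by (intro CollectI exI[of _ \<sigma>] exI[of _ "pabs i \<phi>"]) simp
  then show ?thesis using H_taut by blast
qed

lemma foldr_Imp_L: "foldr Imp xs \<phi> \<in> L \<longleftrightarrow> set xs \<subseteq> L \<and> \<phi> \<in> L"
  by (induction xs) (auto simp: L_simps)

lemma foldr_Imp_mp: "foldr Imp xs \<phi> \<in> H \<Longrightarrow> set xs \<subseteq> H \<Longrightarrow> \<phi> \<in> H"
  by (induction xs) (auto intro: H_mp)

lemma propositional_consequence:
  assumes "set xs \<subseteq> H" "\<phi> \<in> L" "\<And>v. \<forall>\<xi>\<in>set xs. pval v \<xi> \<Longrightarrow> pval v \<phi>"
  shows "\<phi> \<in> H"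
proof (rule foldr_Imp_mp)
  show "foldr Imp xs \<phi> \<in> H"
    by (rule tautology_in_H) (use assms H_L in \<open>auto simp: foldr_Imp_L pval_foldr_Imp\<close>)
qed (use assms in auto)

text \<open>Necessitation is confined to theorems and never applied to members of \<open>S\<close>,
  so that the deduction theorem holds.\<close>

definition ded :: "'v form set \<Rightarrow> 'v form \<Rightarrow> bool" where
  "ded S \<phi> \<longleftrightarrow> (\<exists>xs. set xs \<subseteq> S \<and> foldr Imp xs \<phi> \<in> H)"

lemma ded_member: "\<phi> \<in> S \<Longrightarrow> \<phi> \<in> L \<Longrightarrow> ded S \<phi>"
  unfolding ded_def by (intro exI[of _ "[\<phi>]"]) (auto intro!: tautology_in_H simp: L_simps)

lemma ded_theorem: "\<phi> \<in> H \<Longrightarrow> ded S \<phi>"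
  unfolding ded_def by (intro exI[of _ "[]"]) auto

lemma ded_common:
  assumes "S \<subseteq> L" "\<forall>\<xi>\<in>set ys. ded S \<xi>"
  shows "\<exists>xs. set xs \<subseteq> S \<and> (\<forall>\<xi>\<in>set ys. foldr Imp xs \<xi> \<in> H)"
  using assms(2)
proof (induction ys)
  case (Cons y ys)
  then obtain xs zs where *: "set xs \<subseteq> S" "\<forall>\<xi>\<in>set ys. foldr Imp xs \<xi> \<in> H" "set zs \<subseteq> S"
      "foldr Imp zs y \<in> H"
    by (auto simp: ded_def)
  have "foldr Imp (xs @ zs) \<xi> \<in> H" if "foldr Imp us \<xi> \<in> H" "set us \<subseteq> set xs \<union> set zs" for us \<xi>
    by (rule propositional_consequence[of "[foldr Imp us \<xi>]"])
      (use that H_L * \<open>S \<subseteq> L\<close> foldr_Imp_L[of us \<xi>] in \<open>auto simp: foldr_Imp_L pval_foldr_Imp simp del: foldr_append\<close>)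
  then have "\<forall>\<xi>\<in>set (y # ys). foldr Imp (xs @ zs) \<xi> \<in> H" using * by auto
  then show ?case using * by (intro exI[of _ "xs @ zs"]) auto
qed (auto intro: exI[of _ "[]"])

lemma ded_consequence:
  assumes "S \<subseteq> L" "\<forall>\<xi>\<in>set ys. ded S \<xi>" "\<phi> \<in> L" "\<And>v. \<forall>\<xi>\<in>set ys. pval v \<xi> \<Longrightarrow> pval v \<phi>"
  shows "ded S \<phi>"
proof -
  obtain xs where xs: "set xs \<subseteq> S" "\<forall>\<xi>\<in>set ys. foldr Imp xs \<xi> \<in> H"
    using ded_common[OF assms(1,2)] by blast
  have "foldr Imp xs \<phi> \<in> H"
    by (rule propositional_consequence[of "map (foldr Imp xs) ys"])
      (use xs assms in \<open>auto simp: foldr_Imp_L pval_foldr_Imp\<close>)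
  then show ?thesis using xs unfolding ded_def by blast
qed

lemma ded_insert:
  assumes "ded (insert \<phi> S) \<psi>" "S \<subseteq> L" "\<phi> \<in> L"
  shows "ded S (\<phi> \<^bold>\<rightarrow> \<psi>)"
proof -
  obtain xs where xs: "set xs \<subseteq> insert \<phi> S" "foldr Imp xs \<psi> \<in> H" using assms(1) ded_def by blast
  then have "\<psi> \<in> L" using H_L foldr_Imp_L[of xs \<psi>] by blast
  have "foldr Imp (filter (\<lambda>\<xi>. \<xi> \<noteq> \<phi>) xs) (\<phi> \<^bold>\<rightarrow> \<psi>) \<in> H"
    by (rule propositional_consequence[of "[foldr Imp xs \<psi>]"])
      (use xs assms \<open>\<psi> \<in> L\<close> in \<open>auto simp: foldr_Imp_L pval_foldr_Imp L_simps\<close>)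
  then show ?thesis
    unfolding ded_def using xs by (intro exI[of _ "filter (\<lambda>\<xi>. \<xi> \<noteq> \<phi>) xs"]) auto
qed

subsection \<open>Maximal consistent sets\<close>

definition consistent :: "'v form set \<Rightarrow> bool" where
  "consistent S \<longleftrightarrow> S \<subseteq> L \<and> \<not> ded S (\<^bold>\<not> \<^bold>\<top>)"

definition W :: "'v form set set" where
  "W = {w. consistent w \<and> (\<forall>\<phi>\<in>L. \<phi> \<in> w \<or> \<^bold>\<not> \<phi> \<in> w)}"

lemma W_L: "w \<in> W \<Longrightarrow> w \<subseteq> L"
  by (simp add: W_def consistent_def)

text \<open>There may be uncountably many atoms, hence Zorn's lemma instead of an enumeration.
  Chains are harmless because a deduction uses finitely many premises.\<close>

lemma Lindenbaum:
  assumes "consistent S"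
  obtains w where "w \<in> W" "S \<subseteq> w"
proof -
  let ?A = "{T. S \<subseteq> T \<and> consistent T}"
  have "\<Union>C \<in> ?A" if C: "C \<noteq> {}" "subset.chain ?A C" for C
  proof -
    have CA: "C \<subseteq> ?A" using C unfolding subset_chain_def by blast
    have "\<not> ded (\<Union>C) (\<^bold>\<not> \<^bold>\<top>)"
    proof
      assume "ded (\<Union>C) (\<^bold>\<not> \<^bold>\<top>)"
      then obtain xs where xs: "set xs \<subseteq> \<Union>C" "foldr Imp xs (\<^bold>\<not> \<^bold>\<top>) \<in> H"
        unfolding ded_def by blast
      obtain T where "T \<in> C" "set xs \<subseteq> T"
        using finite_subset_Union_chain[OF finite_set xs(1) C] by blast
      then show False using CA xs unfolding consistent_def ded_def by blast
    qed
    moreover have "\<Union>C \<subseteq> L" "S \<subseteq> \<Union>C" using CA C(1) unfolding consistent_def by blast+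
    ultimately show ?thesis by (simp add: consistent_def)
  qed
  then have "\<exists>M\<in>?A. \<forall>X\<in>?A. M \<subseteq> X \<longrightarrow> X = M"
    using assms by (intro subset_Zorn_nonempty) auto
  then obtain M where M: "S \<subseteq> M" "consistent M" "\<And>X. M \<subseteq> X \<Longrightarrow> consistent X \<Longrightarrow> X = M"
    by (metis (mono_tags, lifting) mem_Collect_eq order_trans)
  have M_sub: "M \<subseteq> L" using M(2) by (simp add: consistent_def)
  have ex: "ded M (\<phi> \<^bold>\<rightarrow> \<^bold>\<not> \<^bold>\<top>)" if "\<phi> \<in> L" "\<phi> \<notin> M" for \<phi>
  proof -
    have "\<not> consistent (insert \<phi> M)" using M(3) that by blast
    then have "ded (insert \<phi> M) (\<^bold>\<not> \<^bold>\<top>)" using that M_sub by (auto simp: consistent_def)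
    then show ?thesis using M_sub that by (intro ded_insert)
  qed
  have "\<phi> \<in> M \<or> \<^bold>\<not> \<phi> \<in> M" if "\<phi> \<in> L" for \<phi>
  proof (rule ccontr)
    assume "\<not> ?thesis"
    then have "ded M (\<phi> \<^bold>\<rightarrow> \<^bold>\<not> \<^bold>\<top>)" "ded M (\<^bold>\<not> \<phi> \<^bold>\<rightarrow> \<^bold>\<not> \<^bold>\<top>)"
      using ex that by (auto simp: L_simps)
    then have "ded M (\<^bold>\<not> \<^bold>\<top>)"
      by (intro ded_consequence[OF M_sub, of "[\<phi> \<^bold>\<rightarrow> \<^bold>\<not> \<^bold>\<top>, \<^bold>\<not> \<phi> \<^bold>\<rightarrow> \<^bold>\<not> \<^bold>\<top>]"]) (auto simp: L_simps)
    then show False using M(2) by (simp add: consistent_def)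
  qed
  then show ?thesis using that[of M] M by (simp add: W_def)
qed

lemma W_ded: "w \<in> W \<Longrightarrow> \<phi> \<in> L \<Longrightarrow> ded w \<phi> \<Longrightarrow> \<phi> \<in> w"
proof (rule ccontr)
  assume w: "w \<in> W" "\<phi> \<in> L" "ded w \<phi>" "\<phi> \<notin> w"
  then have "\<^bold>\<not> \<phi> \<in> w" unfolding W_def by blast
  then have "ded w (\<^bold>\<not> \<phi>)" by (rule ded_member) (simp add: L_Neg w)
  then have "ded w (\<^bold>\<not> \<^bold>\<top>)"
    using w by (intro ded_consequence[OF W_L[OF w(1)], of "[\<phi>, \<^bold>\<not> \<phi>]"]) (simp_all add: L_simps)
  then show False using w by (simp add: W_def consistent_def)
qed

lemma W_consequence:
  assumes "w \<in> W" "set xs \<subseteq> w" "\<phi> \<in> L" "\<And>v. \<forall>\<xi>\<in>set xs. pval v \<xi> \<Longrightarrow> pval v \<phi>"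
  shows "\<phi> \<in> w"
proof (rule W_ded[OF assms(1,3)], rule ded_consequence[OF W_L[OF assms(1)] _ assms(3,4)])
  show "\<forall>\<xi>\<in>set xs. ded w \<xi>" using assms(2) W_L[OF assms(1)] ded_member by blast
qed

lemma W_theorem: "w \<in> W \<Longrightarrow> \<phi> \<in> H \<Longrightarrow> \<phi> \<in> w"
  using H_L W_ded ded_theorem by blast

lemma W_Tru: "w \<in> W \<Longrightarrow> \<^bold>\<top> \<in> w"
  by (rule W_consequence[of _ "[]"]) (auto simp: L_simps)

lemma W_Neg: "w \<in> W \<Longrightarrow> \<phi> \<in> L \<Longrightarrow> \<^bold>\<not> \<phi> \<in> w \<longleftrightarrow> \<phi> \<notin> w"
proof -
  assume w: "w \<in> W" "\<phi> \<in> L"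
  have "\<^bold>\<not> \<^bold>\<top> \<in> w" if "\<phi> \<in> w" "\<^bold>\<not> \<phi> \<in> w"
    by (rule W_consequence[of _ "[\<phi>, \<^bold>\<not> \<phi>]"]) (use w that in \<open>auto simp: L_simps\<close>)
  moreover have "\<^bold>\<not> \<^bold>\<top> \<notin> w"
    using w ded_member[of "\<^bold>\<not> \<^bold>\<top>" w] by (auto simp: W_def consistent_def L_simps)
  ultimately show ?thesis using w by (auto simp: W_def)
qed

lemma W_And: "w \<in> W \<Longrightarrow> \<phi> \<^bold>\<and> \<psi> \<in> w \<longleftrightarrow> \<phi> \<in> w \<and> \<psi> \<in> w"
proof -
  assume w: "w \<in> W"
  have "\<phi> \<in> w \<and> \<psi> \<in> w" if "\<phi> \<^bold>\<and> \<psi> \<in> w"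
    by (rule conjI; rule W_consequence[of _ "[\<phi> \<^bold>\<and> \<psi>]"]) (use w that W_L[OF w] in \<open>auto simp: L_simps\<close>)
  moreover have "\<phi> \<^bold>\<and> \<psi> \<in> w" if "\<phi> \<in> w" "\<psi> \<in> w"
    by (rule W_consequence[of _ "[\<phi>, \<psi>]"]) (use w that W_L[OF w] in \<open>auto simp: L_simps\<close>)
  ultimately show ?thesis by blast
qed

lemma W_Or: "w \<in> W \<Longrightarrow> \<phi> \<in> L \<Longrightarrow> \<psi> \<in> L \<Longrightarrow> \<phi> \<^bold>\<or> \<psi> \<in> w \<longleftrightarrow> \<phi> \<in> w \<or> \<psi> \<in> w"
  by (simp add: W_And W_Neg L_simps)

lemmas W_simps = W_Tru W_Neg W_And L_simps

definition R :: "'v form set \<Rightarrow> 'v form set \<Rightarrow> bool" where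
  "R w y \<longleftrightarrow> (\<forall>\<phi>. \<^bold>[d\<^bold>] \<phi> \<in> w \<longrightarrow> \<phi> \<in> y)"

lemma W_Box:
  assumes w: "w \<in> W" and \<phi>: "\<phi> \<in> L"
  shows "\<^bold>[d\<^bold>] \<phi> \<in> w \<longleftrightarrow> (\<forall>y\<in>W. R w y \<longrightarrow> \<phi> \<in> y)"
proof
  assume all: "\<forall>y\<in>W. R w y \<longrightarrow> \<phi> \<in> y"
  let ?S = "{\<psi>. \<^bold>[d\<^bold>] \<psi> \<in> w}"
  have SL: "?S \<subseteq> L" using W_L[OF w] L_Box by blast
  have "\<not> consistent (insert (\<^bold>\<not> \<phi>) ?S)"
  proof
    assume "consistent (insert (\<^bold>\<not> \<phi>) ?S)"
    then obtain y where y: "y \<in> W" "insert (\<^bold>\<not> \<phi>) ?S \<subseteq> y" by (rule Lindenbaum)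
    then have "R w y" by (auto simp: R_def)
    then show False using all y W_Neg \<phi> by blast
  qed
  then have "ded (insert (\<^bold>\<not> \<phi>) ?S) (\<^bold>\<not> \<^bold>\<top>)" using SL \<phi> by (auto simp: consistent_def L_simps)
  then have "ded ?S (\<^bold>\<not> \<phi> \<^bold>\<rightarrow> \<^bold>\<not> \<^bold>\<top>)" by (rule ded_insert) (use SL \<phi> in \<open>auto simp: L_simps\<close>)
  then have "ded ?S \<phi>"
    by (intro ded_consequence[OF SL, of "[\<^bold>\<not> \<phi> \<^bold>\<rightarrow> \<^bold>\<not> \<^bold>\<top>]"]) (use \<phi> in auto)
  then obtain xs where xs: "set xs \<subseteq> ?S" "foldr Imp xs \<phi> \<in> H" by (auto simp: ded_def)
  have "\<^bold>[d\<^bold>] (foldr Imp xs \<phi>) \<in> w" by (rule W_theorem[OF w H_nec[OF xs(2)]])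
  \<comment> \<open>Necessitation boxed the whole iterated implication; K distributes this box, and
    the premises, whose boxes are in \<open>w\<close>, are discharged one by one.\<close>
  then show "\<^bold>[d\<^bold>] \<phi> \<in> w" using xs(1)
  proof (induction xs)
    case (Cons x xs)
    have x: "x \<in> L" "foldr Imp xs \<phi> \<in> L" "\<^bold>[d\<^bold>] x \<in> w" using Cons.prems SL \<phi> by (auto simp: foldr_Imp_L)
    then have "\<^bold>[d\<^bold>] (x \<^bold>\<rightarrow> foldr Imp xs \<phi>) \<^bold>\<rightarrow> (\<^bold>[d\<^bold>] x \<^bold>\<rightarrow> \<^bold>[d\<^bold>] foldr Imp xs \<phi>) \<in> H"
      using H_K by (auto simp: K_scheme_def)
    then have "\<^bold>[d\<^bold>] (x \<^bold>\<rightarrow> foldr Imp xs \<phi>) \<^bold>\<rightarrow> (\<^bold>[d\<^bold>] x \<^bold>\<rightarrow> \<^bold>[d\<^bold>] foldr Imp xs \<phi>) \<in> w"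
      using W_theorem w by blast
    then have "\<^bold>[d\<^bold>] foldr Imp xs \<phi> \<in> w" using Cons.prems x w by (simp add: W_simps)
    then show ?case using Cons by simp
  qed auto
qed (simp add: R_def)

lemma W_Dia: "w \<in> W \<Longrightarrow> \<phi> \<in> L \<Longrightarrow> \<^bold>[d\<^bold>] \<^bold>\<not> \<phi> \<notin> w \<longleftrightarrow> (\<exists>y\<in>W. R w y \<and> \<phi> \<in> y)"
  using W_Neg by (auto simp: W_Box L_simps)

lemma W_BoxS: "w \<in> W \<Longrightarrow> \<phi> \<in> L \<Longrightarrow> \<box>* \<phi> \<in> w \<longleftrightarrow> \<phi> \<in> w \<and> (\<forall>y\<in>W. R w y \<longrightarrow> \<phi> \<in> y)"
  by (simp add: W_And W_Box)

lemma W_serial: "w \<in> W \<Longrightarrow> \<exists>y\<in>W. R w y"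
  using W_theorem[OF _ H_D] W_Dia[of w "\<^bold>\<top>"] by (auto simp: D_axiom_def W_simps)

lemma W_trans:
  assumes "w \<in> W" "R w y" "R y z"
  shows "R w z"
  unfolding R_def
proof (intro allI impI)
  fix \<phi> assume \<phi>: "\<^bold>[d\<^bold>] \<phi> \<in> w"
  then have "\<phi> \<in> L" using W_L assms L_Box by blast
  have "\<^bold>[d\<^bold>] \<phi> \<^bold>\<rightarrow> \<^bold>[d\<^bold>] \<^bold>[d\<^bold>] \<phi> \<in> w"
    by (rule W_theorem) (use H_four assms \<open>\<phi> \<in> L\<close> in \<open>auto simp: four_scheme_def\<close>)
  then have "\<^bold>[d\<^bold>] \<^bold>[d\<^bold>] \<phi> \<in> w" using \<phi> \<open>\<phi> \<in> L\<close> assms by (simp add: W_simps)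
  then show "\<phi> \<in> z" using assms by (simp add: R_def)
qed

subsection \<open>Definable properties of maximal consistent sets\<close>

text \<open>Axioms speak about formulas only, so a property of canonical points can be fed to Ind or
  G1 only if some formula expresses it.\<close>

definition definable :: "('v form set \<Rightarrow> bool) \<Rightarrow> bool" where
  "definable P \<longleftrightarrow> (\<exists>\<phi>\<in>L. \<forall>w\<in>W. \<phi> \<in> w \<longleftrightarrow> P w)"

lemma definable_cong: "definable P \<Longrightarrow> (\<And>w. w \<in> W \<Longrightarrow> P w \<longleftrightarrow> Q w) \<Longrightarrow> definable Q"
  unfolding definable_def by blast

lemma definable_formula: "\<phi> \<in> L \<Longrightarrow> definable (\<lambda>w. \<phi> \<in> w)"
  unfolding definable_def by blast

lemma definable_not: "definable P \<Longrightarrow> definable (\<lambda>w. \<not> P w)"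
  unfolding definable_def by (metis W_Neg L_Neg)

lemma definable_conj: "definable P \<Longrightarrow> definable Q \<Longrightarrow> definable (\<lambda>w. P w \<and> Q w)"
  unfolding definable_def by (metis W_And L_And)

lemma definable_disj: "definable P \<Longrightarrow> definable Q \<Longrightarrow> definable (\<lambda>w. P w \<or> Q w)"
  using definable_not[OF definable_conj[OF definable_not[of P] definable_not[of Q]]] by simp

lemma definable_const: "definable (\<lambda>w. b)"
proof -
  have T: "definable (\<lambda>w. True)" unfolding definable_def using W_Tru L_Tru by auto
  show ?thesis using T definable_not[OF T] by (cases b) auto
qed

lemma definable_bex: "finite A \<Longrightarrow> (\<And>a. a \<in> A \<Longrightarrow> definable (P a)) \<Longrightarrow> definable (\<lambda>w. \<exists>a\<in>A. P a w)"
  by (induction A rule: finite_induct) (auto intro: definable_const definable_disj)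

lemma definable_ball: "finite A \<Longrightarrow> (\<And>a. a \<in> A \<Longrightarrow> definable (P a)) \<Longrightarrow> definable (\<lambda>w. \<forall>a\<in>A. P a w)"
  by (induction A rule: finite_induct) (auto intro: definable_const definable_conj)

lemma definable_dia: 
  assumes "definable P"
  shows "definable (\<lambda>w. \<exists>y\<in>W. R w y \<and> P y)"
proof -
  obtain \<phi> where \<phi>: "\<phi> \<in> L" "\<forall>w\<in>W. \<phi> \<in> w \<longleftrightarrow> P w" using assms definable_def by blast
  then have "\<forall>w\<in>W. \<langle>d\<rangle> \<phi> \<in> w \<longleftrightarrow> (\<exists>y\<in>W. R w y \<and> P y)"
    using W_Dia[OF _ \<phi>(1)] by (auto simp: W_Neg L_simps)
  then show ?thesis unfolding definable_def using \<phi>(1) by (auto simp: L_simps intro!: bexI[of _ "\<langle>d\<rangle> \<phi>"])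
qed

text \<open>This is G1 read in the canonical frame, with a formula for \<open>P\<close> and its
  negation in the two places: the successors of a point cannot be split into two non-empty definable
  parts with no arrow between them.\<close>

lemma locally_connected:
  assumes "definable P" "w \<in> W"
    and sat: "\<And>y. y \<in> W \<Longrightarrow> R w y \<Longrightarrow> (\<forall>z\<in>W. R y z \<longrightarrow> P z = P y)"
  shows "(\<forall>y\<in>W. R w y \<longrightarrow> P y) \<or> (\<forall>y\<in>W. R w y \<longrightarrow> \<not> P y)"
proof -
  obtain \<phi> where \<phi>: "\<phi> \<in> L" "\<forall>w\<in>W. \<phi> \<in> w \<longleftrightarrow> P w" using assms definable_def by blast
  let ?Q0 = "\<phi> \<^bold>\<and> \<^bold>\<not> \<^bold>\<not> \<phi>" and ?Q1 = "\<^bold>\<not> \<phi> \<^bold>\<and> \<^bold>\<not> \<phi>"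
  have Q: "?Q0 \<in> L" "?Q1 \<in> L" using \<phi> by (auto simp: L_simps)
  have QP: "?Q0 \<in> y \<longleftrightarrow> P y" "?Q1 \<in> y \<longleftrightarrow> \<not> P y" if "y \<in> W" for y
    using \<phi> that by (auto simp: W_simps)
  have "\<^bold>[d\<^bold>] (\<box>* ?Q0 \<^bold>\<or> \<box>* ?Q1) \<in> w"
  proof -
    have "\<box>* ?Q0 \<^bold>\<or> \<box>* ?Q1 \<in> y" if y: "y \<in> W" "R w y" for y
    proof -
      have "\<box>* ?Q0 \<in> y \<or> \<box>* ?Q1 \<in> y"
        unfolding W_BoxS[OF y(1) Q(1)] W_BoxS[OF y(1) Q(2)] using QP sat[OF y] y by blast
      moreover have "\<box>* ?Q0 \<in> L" "\<box>* ?Q1 \<in> L" using Q by (auto simp: L_simps)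
      ultimately show ?thesis using W_Or[OF y(1)] by blast
    qed
    then show ?thesis using assms(2) Q by (subst W_Box) (auto simp: L_simps)
  qed
  moreover have "\<^bold>[d\<^bold>] (\<box>* ?Q0 \<^bold>\<or> \<box>* ?Q1) \<^bold>\<rightarrow> (\<^bold>[d\<^bold>] \<^bold>\<not> ?Q0 \<^bold>\<or> \<^bold>[d\<^bold>] \<^bold>\<not> ?Q1) \<in> w"
    by (rule W_theorem) (use H_G1 \<phi> assms(2) in \<open>auto simp: G1_scheme_def G1_formula_def Let_def L_simps\<close>)
  moreover have boxes: "\<^bold>[d\<^bold>] \<^bold>\<not> ?Q0 \<in> L" "\<^bold>[d\<^bold>] \<^bold>\<not> ?Q1 \<in> L" using Q by (simp_all add: L_simps)
  ultimately have "\<^bold>[d\<^bold>] \<^bold>\<not> ?Q0 \<^bold>\<or> \<^bold>[d\<^bold>] \<^bold>\<not> ?Q1 \<in> w"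
    by (intro W_consequence[OF assms(2), of "[\<^bold>[d\<^bold>] (\<box>* ?Q0 \<^bold>\<or> \<box>* ?Q1), \<^bold>[d\<^bold>] (\<box>* ?Q0 \<^bold>\<or> \<box>* ?Q1) \<^bold>\<rightarrow>
        (\<^bold>[d\<^bold>] \<^bold>\<not> ?Q0 \<^bold>\<or> \<^bold>[d\<^bold>] \<^bold>\<not> ?Q1)]"]) (simp_all add: L_simps)
  then have "\<^bold>[d\<^bold>] \<^bold>\<not> ?Q0 \<in> w \<or> \<^bold>[d\<^bold>] \<^bold>\<not> ?Q1 \<in> w"
    using W_Or[OF assms(2) boxes] by blast
  then show ?thesis
    using W_Dia[OF assms(2) Q(1)] W_Dia[OF assms(2) Q(2)] QP by blast
qed

lemma BigAnd_L: "BigAnd gs \<in> L \<longleftrightarrow> set gs \<subseteq> L"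
  by (induction gs rule: BigAnd.induct) (auto simp: L_simps)

lemma W_BigAnd: "w \<in> W \<Longrightarrow> BigAnd gs \<in> w \<longleftrightarrow> set gs \<subseteq> w"
  by (induction gs rule: BigAnd.induct) (auto simp: W_simps)

text \<open>The induction axiom for a formula expressing \<open>P\<close>. Its premise is boxed only
  at \<open>w\<close>, so the step is needed just at \<open>w\<close> and its successors.\<close>

lemma tangle_induct:
  assumes Dt: "\<langle>dt\<rangle> \<Gamma> \<in> L" and "definable P" "w \<in> W" "P w"
    and step: "\<And>y \<gamma>. y \<in> W \<Longrightarrow> y = w \<or> R w y \<Longrightarrow> P y \<Longrightarrow> \<gamma> |\<in>| \<Gamma> \<Longrightarrow> \<exists>z\<in>W. R y z \<and> \<gamma> \<in> z \<and> P z"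
  shows "\<langle>dt\<rangle> \<Gamma> \<in> w"
proof -
  obtain \<phi> where \<phi>: "\<phi> \<in> L" "\<forall>w\<in>W. \<phi> \<in> w \<longleftrightarrow> P w" using assms definable_def by blast
  obtain gs where gs: "set gs = fset \<Gamma>" "distinct gs" using finite_distinct_list[of "fset \<Gamma>"] by auto
  have gsL: "set gs \<subseteq> L" using gs L_Dt[OF Dt] by blast
  let ?ds = "map (\<lambda>\<gamma>. \<langle>d\<rangle> (\<gamma> \<^bold>\<and> \<phi>)) gs"
  have dsL: "BigAnd ?ds \<in> L" using gsL \<phi> by (auto simp: BigAnd_L L_simps)
  have "\<phi> \<^bold>\<rightarrow> BigAnd ?ds \<in> y" if y: "y \<in> W" "y = w \<or> R w y" for y
  proof -
    have "BigAnd ?ds \<in> y" if "\<phi> \<in> y"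
    proof -
      have "P y" using that \<phi> y by blast
      have "\<langle>d\<rangle> (\<gamma> \<^bold>\<and> \<phi>) \<in> y" if \<gamma>: "\<gamma> \<in> set gs" for \<gamma>
      proof -
        have "\<gamma> \<^bold>\<and> \<phi> \<in> L" using \<gamma> gsL \<phi> by (auto simp: L_simps)
        moreover obtain z where "z \<in> W" "R y z" "\<gamma> \<^bold>\<and> \<phi> \<in> z"
          using step[OF y \<open>P y\<close>, of \<gamma>] \<gamma> gs \<phi> by (auto simp: W_And)
        ultimately show ?thesis using W_Dia[OF y(1)] W_Neg[OF y(1)] L_Box L_Neg by metis
      qed
      then show ?thesis using y(1) by (auto simp: W_BigAnd)
    qed
    then show ?thesis using y(1) \<phi> dsL by (auto simp: W_simps)
  qed
  then have "\<box>* (\<phi> \<^bold>\<rightarrow> BigAnd ?ds) \<in> w"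
    using assms(3) \<phi> dsL by (subst W_BoxS) (auto simp: L_simps)
  moreover have "\<box>* (\<phi> \<^bold>\<rightarrow> BigAnd ?ds) \<^bold>\<rightarrow> (\<phi> \<^bold>\<rightarrow> \<langle>dt\<rangle> \<Gamma>) \<in> w"
    using H_Ind[OF Dt \<phi>(1) gs(2,1)] assms(3) W_theorem by blast
  moreover have "\<phi> \<in> w" using \<phi> assms by blast
  ultimately show ?thesis
    by (intro W_consequence[OF assms(3), of "[\<box>* (\<phi> \<^bold>\<rightarrow> BigAnd ?ds), \<box>* (\<phi> \<^bold>\<rightarrow> BigAnd ?ds) \<^bold>\<rightarrow> (\<phi> \<^bold>\<rightarrow> \<langle>dt\<rangle> \<Gamma>), \<phi>]"])
      (use Dt in auto)
qed

lemma tangle_unfold: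
  assumes Dt: "\<langle>dt\<rangle> \<Gamma> \<in> w" and w: "w \<in> W" and \<gamma>: "\<gamma> |\<in>| \<Gamma>"
  shows "\<exists>y\<in>W. R w y \<and> \<gamma> \<in> y \<and> \<langle>dt\<rangle> \<Gamma> \<in> y"
proof -
  have DtL: "\<langle>dt\<rangle> \<Gamma> \<in> L" "\<gamma> \<in> L" using Dt w \<gamma> W_L L_Dt by blast+
  then have L: "\<gamma> \<^bold>\<and> \<langle>dt\<rangle> \<Gamma> \<in> L" by (simp add: L_simps)
  have "\<langle>dt\<rangle> \<Gamma> \<^bold>\<rightarrow> \<langle>d\<rangle> (\<gamma> \<^bold>\<and> \<langle>dt\<rangle> \<Gamma>) \<in> w" using H_Fix DtL \<gamma> w W_theorem by blast
  then have "\<langle>d\<rangle> (\<gamma> \<^bold>\<and> \<langle>dt\<rangle> \<Gamma>) \<in> w"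
    by (intro W_consequence[OF w, of "[\<langle>dt\<rangle> \<Gamma> \<^bold>\<rightarrow> \<langle>d\<rangle> (\<gamma> \<^bold>\<and> \<langle>dt\<rangle> \<Gamma>), \<langle>dt\<rangle> \<Gamma>]"])
      (use Dt DtL in \<open>auto simp: L_simps\<close>)
  then have "\<^bold>[d\<^bold>] \<^bold>\<not> (\<gamma> \<^bold>\<and> \<langle>dt\<rangle> \<Gamma>) \<notin> w" using W_Neg[OF w] L L_Box L_Neg by metis
  then show ?thesis using W_Dia[OF w L] W_And by blast
qed

text \<open>Induction for the property of having a successor that contains the tangle. Two
  unfoldings are made: the first finds a successor containing \<gamma> and the tangle, the second
  shows that it has the property itself.\<close>

lemma tangle_backward:
  assumes "\<langle>dt\<rangle> \<Gamma> \<in> y" "R w y" "w \<in> W" "y \<in> W"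
  shows "\<langle>dt\<rangle> \<Gamma> \<in> w"
proof -
  have Dt: "\<langle>dt\<rangle> \<Gamma> \<in> L" using assms W_L by blast
  show ?thesis
  proof (rule tangle_induct[OF Dt _ \<open>w \<in> W\<close>])
    show "definable (\<lambda>w. \<exists>y\<in>W. R w y \<and> \<langle>dt\<rangle> \<Gamma> \<in> y)"
      by (intro definable_dia definable_formula Dt)
    show "\<exists>y\<in>W. R w y \<and> \<langle>dt\<rangle> \<Gamma> \<in> y" using assms by blast
    fix u \<gamma> assume u: "u \<in> W" "\<exists>y\<in>W. R u y \<and> \<langle>dt\<rangle> \<Gamma> \<in> y" and \<gamma>: "\<gamma> |\<in>| \<Gamma>"
    then obtain v where v: "v \<in> W" "R u v" "\<langle>dt\<rangle> \<Gamma> \<in> v" by blast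
    obtain z where z: "z \<in> W" "R v z" "\<gamma> \<in> z" "\<langle>dt\<rangle> \<Gamma> \<in> z"
      using tangle_unfold[OF v(3,1) \<gamma>] by blast
    then show "\<exists>z\<in>W. R u z \<and> \<gamma> \<in> z \<and> (\<exists>y\<in>W. R z y \<and> \<langle>dt\<rangle> \<Gamma> \<in> y)"
      using tangle_unfold[OF z(4,1) \<gamma>] W_trans[OF u(1) v(2) z(2)] z by blast
  qed
qed

lemma nontheorem_refuted:
  assumes "\<phi> \<in> L" "\<phi> \<notin> H"
  obtains w where "w \<in> W" "\<phi> \<notin> w"
proof -
  have "consistent {\<^bold>\<not> \<phi>}"
  proof -
    have "\<phi> \<in> H" if "ded {\<^bold>\<not> \<phi>} (\<^bold>\<not> \<^bold>\<top>)"
    proof -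
      have "ded {} (\<^bold>\<not> \<phi> \<^bold>\<rightarrow> \<^bold>\<not> \<^bold>\<top>)" by (rule ded_insert) (use that assms in \<open>auto simp: L_simps\<close>)
      then have "\<^bold>\<not> \<phi> \<^bold>\<rightarrow> \<^bold>\<not> \<^bold>\<top> \<in> H" by (auto simp: ded_def)
      then show ?thesis
        by (intro propositional_consequence[of "[\<^bold>\<not> \<phi> \<^bold>\<rightarrow> \<^bold>\<not> \<^bold>\<top>]"]) (use assms in auto)
    qed
    then show ?thesis using assms by (auto simp: consistent_def L_simps)
  qed
  then obtain w where "w \<in> W" "{\<^bold>\<not> \<phi>} \<subseteq> w" by (rule Lindenbaum)
  then show ?thesis using that W_Neg assms by blast
qed

end

section \<open>Types relative to a finite set of formulas, and the definability of values\<close>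

locale tangle_types = tangle_logic L H for L H :: "'v form set" +
  fixes Phi :: "'v form set"
  assumes finite_Phi: "finite Phi" and Phi_L: "Phi \<subseteq> L"
begin

definition tau :: "'v form set \<Rightarrow> 'v form set" where "tau w = w \<inter> Phi"

definition V :: "'v form set \<Rightarrow> 'v form set set" where "V w = tau ` {y\<in>W. R w y}"

lemma V_Pow: "V w \<subseteq> Pow Phi"
  by (auto simp: V_def tau_def)

lemma finite_V: "finite (V w)"
  using V_Pow finite_Phi by (meson finite_Pow_iff finite_subset)

lemma V_I: "y \<in> W \<Longrightarrow> R w y \<Longrightarrow> tau y \<in> V w"
  by (auto simp: V_def)

lemma V_E: "t \<in> V w \<Longrightarrow> (\<And>y. y \<in> W \<Longrightarrow> R w y \<Longrightarrow> tau y = t \<Longrightarrow> thesis) \<Longrightarrow> thesis"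
  by (auto simp: V_def)

lemma V_antimono: "w \<in> W \<Longrightarrow> R w y \<Longrightarrow> V y \<subseteq> V w"
  using W_trans by (auto simp: V_def)

lemma definable_if: "definable P \<Longrightarrow> definable Q \<Longrightarrow> definable (\<lambda>w. if b then P w else Q w)"
  by (cases b) simp_all

lemma definable_tau: "t \<subseteq> Phi \<Longrightarrow> definable (\<lambda>w. tau w = t)"
proof -
  assume t: "t \<subseteq> Phi"
  have "definable (\<lambda>w. \<forall>\<phi>\<in>Phi. if \<phi> \<in> t then \<phi> \<in> w else \<not> \<phi> \<in> w)"
    by (intro definable_ball finite_Phi definable_if definable_not definable_formula)
      (use Phi_L in blast)+
  then show ?thesis
    by (rule definable_cong) (use t in \<open>auto simp: tau_def split: if_splits\<close>)
qed

text \<open>There are finitely many types, so a finite conjunction can say of each whether it is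
  seen.\<close>

lemma definable_V: "definable (\<lambda>w. V w = U)"
proof (cases "U \<subseteq> Pow Phi")
  case True
  have "definable (\<lambda>w. \<forall>t\<in>Pow Phi. if t \<in> U then \<exists>y\<in>W. R w y \<and> tau y = t else \<not> (\<exists>y\<in>W. R w y \<and> tau y = t))"
    by (intro definable_ball definable_if definable_not definable_dia definable_tau)
      (use finite_Phi in auto)
  then show ?thesis
  proof (rule definable_cong)
    fix w
    have V_iff: "(\<exists>y\<in>W. R w y \<and> tau y = t) \<longleftrightarrow> t \<in> V w" for t by (auto simp: V_def)
    show "(\<forall>t\<in>Pow Phi. if t \<in> U then \<exists>y\<in>W. R w y \<and> tau y = t else \<not> (\<exists>y\<in>W. R w y \<and> tau y = t)) \<longleftrightarrow> V w = U"
      unfolding V_iff using True V_Pow[of w] by (auto split: if_splits)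
  qed
next
  case False
  then show ?thesis
    using V_Pow by (intro definable_cong[OF definable_const[of False]]) auto
qed

subsection \<open>Nuclei\<close>

text \<open>A nucleus plays the role of a reflexive cluster of a finite model: the definable property \<open>P\<close>
  witnesses, through the induction axiom, every tangle all of whose members are met by \<open>B\<close>.\<close>

definition nucleus :: "'v form set set \<Rightarrow> 'v form set set \<Rightarrow> bool" where
  "nucleus U B \<longleftrightarrow> (\<exists>x\<in>W. \<exists>P. definable P \<and> P x \<and> B = tau ` {y\<in>W. (y = x \<or> R x y) \<and> P y} \<and>
    (\<forall>y\<in>W. y = x \<or> R x y \<longrightarrow> P y \<longrightarrow> V y = U \<and> (\<forall>b\<in>B. \<exists>z\<in>W. R y z \<and> P z \<and> tau z = b)))"

text \<open>If \<open>P\<close> never dies out above \<open>x\<close>, choose a point with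
  \<open>P\<close> that sees the fewest types of points with \<open>P\<close>. By minimality this
  set of types stays constant from there on, so each later point with \<open>P\<close> sees all of
  it.\<close>

lemma nucleus_exists:
  assumes "x \<in> W" "definable P" "P x"
    and step: "\<And>y. y \<in> W \<Longrightarrow> y = x \<or> R x y \<Longrightarrow> P y \<Longrightarrow> V y = U \<and> (\<exists>z\<in>W. R y z \<and> P z)"
  shows "\<exists>x'\<in>W. R x x' \<and> P x' \<and> nucleus U (tau ` {z\<in>W. R x' z \<and> P z})"
proof -
  define B where "B y = tau ` {z\<in>W. R y z \<and> P z}" for y
  have finB: "finite (B y)" for y
    using finite_V[of y] by (rule rev_finite_subset) (auto simp: B_def V_def)
  have mono: "B z \<subseteq> B y" if "y \<in> W" "R y z" for y z
    using W_trans that by (auto simp: B_def)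
  obtain y where y: "y \<in> W" "y = x \<or> R x y" "P y"
      and min: "\<And>z. z \<in> W \<Longrightarrow> z = x \<or> R x z \<Longrightarrow> P z \<Longrightarrow> card (B y) \<le> card (B z)"
    using ex_has_least_nat[of "\<lambda>y. y \<in> W \<and> (y = x \<or> R x y) \<and> P y" x "\<lambda>y. card (B y)"] assms(1,3) by blast
  have above: "z = x \<or> R x z" if "R y z" for z using y W_trans assms(1) that by blast
  have B_const: "B z = B y" if "z \<in> W" "R y z" "P z" for z
    using min[OF that(1) above[OF that(2)] that(3)] mono[OF y(1) that(2)] finB
    by (intro card_subset_eq) (auto intro: le_antisym card_mono)
  \<comment> \<open>One step further: the minimal point \<open>y\<close> need not see its own type,
    whereas the type of \<open>x'\<close> is among those seen from \<open>y\<close>.\<close>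
  obtain x' where x': "x' \<in> W" "R y x'" "P x'" using step[OF y] by blast
  have Bx': "B y = tau ` {z\<in>W. (z = x' \<or> R x' z) \<and> P z}"
  proof -
    have "{z\<in>W. (z = x' \<or> R x' z) \<and> P z} = insert x' {z\<in>W. R x' z \<and> P z}" using x' by blast
    moreover have "tau x' \<in> B y" using x' by (auto simp: B_def)
    ultimately show ?thesis using B_const[OF x'] by (simp add: B_def insert_absorb)
  qed
  have "V u = U \<and> (\<forall>b\<in>B y. \<exists>z\<in>W. R u z \<and> P z \<and> tau z = b)" if u: "u \<in> W" "u = x' \<or> R x' u" "P u" for u
  proof -
    have yu: "R y u" using u(2) x' W_trans y(1) by blast
    then have Bu: "B u = B y" using B_const u by blast
    have "\<exists>z\<in>W. R u z \<and> P z \<and> tau z = b" if "b \<in> B y" for b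
      using that unfolding Bu[symmetric] by (auto simp: B_def)
    then show ?thesis using step[OF u(1) above[OF yu] u(3)] by blast
  qed
  then have all: "\<forall>u\<in>W. u = x' \<or> R x' u \<longrightarrow> P u \<longrightarrow> V u = U \<and> (\<forall>b\<in>B y. \<exists>z\<in>W. R u z \<and> P z \<and> tau z = b)"
    by blast
  have "nucleus U (B y)"
    unfolding nucleus_def by (intro bexI[OF _ x'(1)] exI[of _ P] conjI assms(2) x'(3) Bx' all)
  moreover have "R x x'" using y(2) x'(2) W_trans[OF assms(1), of y x'] by auto
  moreover have "B y = tau ` {z\<in>W. R x' z \<and> P z}" using B_const[OF x'] by (simp add: B_def)
  ultimately show ?thesis using x'(1,3) by metis
qed

lemma nucleusE:
  assumes "nucleus U B"
  obtains x P where "x \<in> W" "definable P" "P x" "B = tau ` {y\<in>W. (y = x \<or> R x y) \<and> P y}"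
    "\<And>y. y\<in>W \<Longrightarrow> y = x \<or> R x y \<Longrightarrow> P y \<Longrightarrow> V y = U \<and> (\<forall>b\<in>B. \<exists>z\<in>W. R y z \<and> P z \<and> tau z = b)"
proof -
  obtain x where x: "x \<in> W" "\<exists>P. definable P \<and> P x \<and> B = tau ` {y\<in>W. (y = x \<or> R x y) \<and> P y} \<and>
    (\<forall>y\<in>W. y = x \<or> R x y \<longrightarrow> P y \<longrightarrow> V y = U \<and> (\<forall>b\<in>B. \<exists>z\<in>W. R y z \<and> P z \<and> tau z = b))"
    using assms unfolding nucleus_def by (rule bexE)
  from x(2) obtain P where P: "definable P \<and> P x \<and> B = tau ` {y\<in>W. (y = x \<or> R x y) \<and> P y} \<and>
    (\<forall>y\<in>W. y = x \<or> R x y \<longrightarrow> P y \<longrightarrow> V y = U \<and> (\<forall>b\<in>B. \<exists>z\<in>W. R y z \<and> P z \<and> tau z = b))"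
    by (rule exE)
  note p = P[THEN conjunct1] P[THEN conjunct2, THEN conjunct1]
    P[THEN conjunct2, THEN conjunct2, THEN conjunct1] P[THEN conjunct2, THEN conjunct2, THEN conjunct2]
  show ?thesis
    by (rule that[OF x(1) p(1-3)], rule p(4)[THEN bspec, THEN HOL.mp, THEN HOL.mp])
qed

lemma nucleus_props:
  assumes "nucleus U B"
  shows "B \<noteq> {}" "B \<subseteq> U" "b \<in> B \<Longrightarrow> \<exists>w\<in>W. tau w = b \<and> V w = U"
proof -
  obtain x P where x: "x \<in> W" "definable P" "P x" "B = tau ` {y\<in>W. (y = x \<or> R x y) \<and> P y}"
    "\<And>y. y\<in>W \<Longrightarrow> y = x \<or> R x y \<Longrightarrow> P y \<Longrightarrow> V y = U \<and> (\<forall>b\<in>B. \<exists>z\<in>W. R y z \<and> P z \<and> tau z = b)"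
    by (rule nucleusE[OF assms]) (rule that, assumption+)
  have "tau x \<in> B" using x(1,3) by (simp add: x(4))
  then show "B \<noteq> {}" by blast
  have Vx: "V x = U" "\<forall>b\<in>B. \<exists>z\<in>W. R x z \<and> P z \<and> tau z = b" using x(5)[OF x(1) disjI1[OF refl] x(3)] by auto
  show "B \<subseteq> U"
  proof
    fix b assume "b \<in> B"
    then obtain z where "z \<in> W" "R x z" "tau z = b" using Vx(2) by blast
    then show "b \<in> U" using V_I[of z x] Vx(1) by simp
  qed
  show "\<exists>w\<in>W. tau w = b \<and> V w = U" if "b \<in> B"
  proof -
    obtain y where "y \<in> W" "y = x \<or> R x y" "P y" "b = tau y"
      using \<open>b \<in> B\<close>[unfolded x(4)] by auto
    then show ?thesis using x(5)[of y] by auto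
  qed
qed

lemma nucleus_tangle:
  assumes "nucleus U B" "\<langle>dt\<rangle> \<Gamma> \<in> Phi" "\<And>\<gamma>. \<gamma> |\<in>| \<Gamma> \<Longrightarrow> \<exists>b\<in>B. \<gamma> \<in> b"
  shows "\<exists>b\<in>B. \<langle>dt\<rangle> \<Gamma> \<in> b"
proof -
  obtain x P where x: "x \<in> W" "definable P" "P x" "B = tau ` {y\<in>W. (y = x \<or> R x y) \<and> P y}"
    "\<And>y. y\<in>W \<Longrightarrow> y = x \<or> R x y \<Longrightarrow> P y \<Longrightarrow> V y = U \<and> (\<forall>b\<in>B. \<exists>z\<in>W. R y z \<and> P z \<and> tau z = b)"
    by (rule nucleusE[OF assms(1)]) (rule that, assumption+)
  have "\<langle>dt\<rangle> \<Gamma> \<in> L" using assms(2) Phi_L by blast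
  then have "\<langle>dt\<rangle> \<Gamma> \<in> x"
  proof (rule tangle_induct[OF _ x(2,1,3)])
    fix y \<gamma> assume y: "y \<in> W" "y = x \<or> R x y" "P y" and "\<gamma> |\<in>| \<Gamma>"
    then obtain b where b: "b \<in> B" "\<gamma> \<in> b" using assms(3) by blast
    then obtain z where "z \<in> W" "R y z" "P z" "tau z = b" using x(5)[OF y] by blast
    then show "\<exists>z\<in>W. R y z \<and> \<gamma> \<in> z \<and> P z" using b by (auto simp: tau_def)
  qed
  then have "\<langle>dt\<rangle> \<Gamma> \<in> tau x" using assms(2) by (simp add: tau_def)
  moreover have "tau x \<in> B" using x(1,3) by (simp add: x(4))
  ultimately show ?thesis by blast
qed

definition reflx :: "'v form set set \<Rightarrow> bool" where "reflx U \<longleftrightarrow> (\<exists>B. nucleus U B)"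

definition lower :: "'v form set set \<Rightarrow> ('v form set \<times> 'v form set set) set" where
  "lower U = {(tau y, V y) | y. y \<in> W \<and> tau y \<in> U \<and> V y \<subset> U}"

definition covers :: "'v form set set \<Rightarrow> 'v form set set \<Rightarrow> bool" where
  "covers U B \<longleftrightarrow> U \<subseteq> B \<union> (\<Union>(b, V')\<in>lower U. insert b V')"

text \<open>If some point of value \<open>U\<close> has no successor of value \<open>U\<close>, its
  successors show that lower pairs alone supply every type in \<open>U\<close>, and any nucleus will
  do. Otherwise having value \<open>U\<close> is a property that never dies out, and the nucleus it
  yields contains exactly the types of the successors of value \<open>U\<close> of some point of
  value \<open>U\<close>; the other successors give lower pairs.\<close>

lemma covers_exists:
  assumes "reflx U"
  shows "\<exists>B. nucleus U B \<and> covers U B"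
proof -
  obtain B where B: "nucleus U B" using assms reflx_def by blast
  have low: "t \<in> (\<Union>(b, V')\<in>lower U. insert b V')" if "y \<in> W" "tau y = t" "R w y" "w \<in> W" "V w = U" "V y \<noteq> U" for t y w
  proof -
    have "(tau y, V y) \<in> lower U" using that V_I[of y w] V_antimono[of w y] by (auto simp: lower_def)
    then show ?thesis using that by blast
  qed
  show ?thesis
  proof (cases "\<exists>e\<in>W. V e = U \<and> (\<forall>z\<in>W. R e z \<longrightarrow> V z \<noteq> U)")
    case True
    then obtain e where e: "e \<in> W" "V e = U" "\<And>z. z \<in> W \<Longrightarrow> R e z \<Longrightarrow> V z \<noteq> U" by blast
    have "covers U B"
      unfolding covers_def
    proof
      fix t assume "t \<in> U"
      then obtain y where y: "y \<in> W" "R e y" "tau y = t" using e(2) by (auto elim: V_E)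
      have "t \<in> (\<Union>(b, V')\<in>lower U. insert b V')"
        by (rule low[OF y(1,3,2) e(1,2) e(3)[OF y(1,2)]])
      then show "t \<in> B \<union> (\<Union>(b, V')\<in>lower U. insert b V')" by (rule UnI2)
    qed
    then show ?thesis using B by blast
  next
    case False
    obtain b where "b \<in> B" using nucleus_props(1)[OF B] by blast
    then obtain x where x: "x \<in> W" "V x = U" using nucleus_props(3)[OF B] by blast
    have st: "V y = U \<and> (\<exists>z\<in>W. R y z \<and> V z = U)" if "y \<in> W" "y = x \<or> R x y" "V y = U" for y
      using False that by blast
    have "\<exists>x'\<in>W. R x x' \<and> V x' = U \<and> nucleus U (tau ` {z\<in>W. R x' z \<and> V z = U})"
      by (rule nucleus_exists[OF x(1) definable_V[of U] x(2) st])
    then obtain x' where x': "x' \<in> W" "V x' = U" "nucleus U (tau ` {z\<in>W. R x' z \<and> V z = U})"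
      by blast
    define B' where "B' = tau ` {z\<in>W. R x' z \<and> V z = U}"
    have "covers U B'"
      unfolding covers_def
    proof
      fix t assume "t \<in> U"
      then obtain y where y: "y \<in> W" "R x' y" "tau y = t" using x'(2) by (auto elim: V_E)
      show "t \<in> B' \<union> (\<Union>(b, V')\<in>lower U. insert b V')"
      proof (cases "V y = U")
        case True
        then have "t \<in> B'" using y by (auto simp: B'_def)
        then show ?thesis by (rule UnI1)
      next
        case False
        then show ?thesis by (intro UnI2 low[OF y(1,3,2) x'(1,2)])
      qed
    qed
    then show ?thesis using x'(3) unfolding B'_def by blast
  qed
qed

text \<open>The choice is made once for each value, so that pieces built separately use the same
  nucleus where they meet.\<close>

definition Bn :: "'v form set set \<Rightarrow> 'v form set set" where
  "Bn U = (if reflx U then SOME B. nucleus U B \<and> covers U B else {})"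

definition Ok :: "'v form set \<Rightarrow> 'v form set set \<Rightarrow> bool" where
  "Ok b U \<longleftrightarrow> (\<exists>w\<in>W. tau w = b \<and> V w = U)"

lemma Bn:
  assumes "reflx U"
  shows "nucleus U (Bn U)" "covers U (Bn U)"
  using someI_ex[OF covers_exists[OF assms]] assms by (simp_all add: Bn_def)

lemma Bn_props:
  assumes "reflx U"
  shows "Bn U \<noteq> {}" "Bn U \<subseteq> U" "c \<in> Bn U \<Longrightarrow> Ok c U"
  using nucleus_props[OF Bn(1)[OF assms]] by (auto simp: Ok_def)

subsection \<open>Collars\<close>

text \<open>The collars of \<open>w\<close> are the \<open>V\<close>-values, carrying a nucleus, that may surround a point with the
  type of \<open>w\<close> in the space. Axiom \<open>G\<^sub>1\<close> makes them connected under comparability.\<close>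

inductive collar :: "'v form set \<Rightarrow> 'v form set set \<Rightarrow> bool" where
  here: "reflx (V w) \<Longrightarrow> collar w (V w)"
| above: "\<not> reflx (V w) \<Longrightarrow> y \<in> W \<Longrightarrow> R w y \<Longrightarrow> V y \<noteq> V w \<Longrightarrow> collar y U \<Longrightarrow> collar w U"

lemma collar_reflx: "collar w U \<Longrightarrow> reflx U"
  by (induction rule: collar.induct)

lemma collar_subset: "collar w U \<Longrightarrow> w \<in> W \<Longrightarrow> U \<subseteq> V w"
  by (induction rule: collar.induct) (use V_antimono in blast)+

lemma collar_of_reflx: "reflx (V w) \<Longrightarrow> collar w U \<longleftrightarrow> U = V w"
  using collar.cases collar.here by metis

text \<open>If \<open>z\<close> has the value of \<open>w\<close>, the clause \<open>above\<close>
  does not apply to \<open>z\<close> directly, but the successor of \<open>z\<close> that supplies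
  the collar is a successor of \<open>w\<close> by transitivity.\<close>

lemma collar_upward:
  assumes "w \<in> W" "z \<in> W" "R w z" "\<not> reflx (V w)" "collar z U"
  shows "collar w U"
proof (cases "V z = V w")
  case True
  then have "\<not> reflx (V z)" using assms by simp
  then obtain y where "y \<in> W" "R z y" "V y \<noteq> V z" "collar y U"
    using assms(5) by (metis collar.cases)
  then show ?thesis using collar.above[OF assms(4), of y U] W_trans assms True by metis
next
  case False
  then show ?thesis using collar.above assms by blast
qed

lemma card_V_less: "w \<in> W \<Longrightarrow> R w y \<Longrightarrow> V y \<noteq> V w \<Longrightarrow> card (V y) < card (V w)"
  using V_antimono finite_V by (meson psubsetI psubset_card_mono)

text \<open>The substitute for last points: a definable property within a value without a nucleus
  must die out, since otherwise \<open>nucleus_exists\<close> would produce a nucleus.\<close>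

lemma irreflexive_end:
  assumes "w \<in> W" "\<not> reflx (V w)" "definable P" "P w" "\<And>y. P y \<Longrightarrow> V y = V w"
  obtains e where "e \<in> W" "e = w \<or> R w e" "P e" "\<And>z. z \<in> W \<Longrightarrow> R e z \<Longrightarrow> \<not> P z"
proof -
  have "\<exists>e\<in>W. (e = w \<or> R w e) \<and> P e \<and> (\<forall>z\<in>W. R e z \<longrightarrow> \<not> P z)"
  proof (rule ccontr)
    assume n: "\<not> ?thesis"
    have "V y = V w \<and> (\<exists>z\<in>W. R y z \<and> P z)" if "y \<in> W" "y = w \<or> R w y" "P y" for y
      using n assms(5) that by blast
    then have "\<exists>x'\<in>W. R w x' \<and> P x' \<and> nucleus (V w) (tau ` {z\<in>W. R x' z \<and> P z})"
      by (rule nucleus_exists[OF assms(1,3,4)])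
    then show False using assms(2) by (auto simp: reflx_def)
  qed
  then show ?thesis using that by blast
qed

text \<open>Without a nucleus, some last point has the value of \<open>w\<close>. Seriality gives it
  a successor, which has a smaller value and so, by induction, a collar.\<close>

lemma collar_exists: "w \<in> W \<Longrightarrow> \<exists>U. collar w U"
proof (induction "card (V w)" arbitrary: w rule: less_induct)
  case less
  show ?case
  proof (cases "reflx (V w)")
    case True
    then show ?thesis using collar.here by blast
  next
    case False
    obtain e where e: "e \<in> W" "e = w \<or> R w e" "V e = V w" "\<And>z. z \<in> W \<Longrightarrow> R e z \<Longrightarrow> V z \<noteq> V w"
      using irreflexive_end[OF less.prems False definable_V, of "V w"] by blast
    obtain z where z: "z \<in> W" "R e z" using W_serial e by blast
    then have wz: "R w z" "V z \<noteq> V w" using e W_trans less.prems by blast+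
    then obtain U where "collar z U" using less z card_V_less by blast
    then show ?thesis using collar.above[OF False z(1) wz] by blast
  qed
qed

text \<open>The recursion behind \<open>collar\<close> strictly lowers the cardinality of the value.
  Finitely many unfoldings decide it below any given bound, and the number of types bounds all
  values.\<close>

lemma definable_collar: "definable (\<lambda>w. collar w U)"
proof -
  have "definable (\<lambda>w. card (V w) < n \<and> collar w U)" for n
  proof (induction n)
    case 0
    show ?case by (simp add: definable_const)
  next
    case (Suc n)
    let ?Q = "\<lambda>V' w. if card V' < Suc n then (if reflx V' then U = V' else
       \<exists>y\<in>W. R w y \<and> (\<not> V y = V' \<and> (card (V y) < n \<and> collar y U))) else False"
    have "definable (?Q V')" for V'
      by (intro definable_if definable_dia definable_conj[OF definable_not[OF definable_V]] Suc definable_const)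
    then have "definable (\<lambda>w. \<exists>V'\<in>Pow (Pow Phi). V w = V' \<and> ?Q V' w)"
      using finite_Phi by (intro definable_bex definable_conj definable_V) auto
    then show ?case
    proof (rule definable_cong)
      fix w assume w: "w \<in> W"
      have "(\<exists>V'\<in>Pow (Pow Phi). V w = V' \<and> ?Q V' w) \<longleftrightarrow> ?Q (V w) w" using V_Pow[of w] by auto
      also have "\<dots> \<longleftrightarrow> card (V w) < Suc n \<and> collar w U"
      proof (cases "reflx (V w)")
        case True
        then show ?thesis using collar_of_reflx by auto
      next
        case False
        have "card (V y) < n" if "y \<in> W" "R w y" "V y \<noteq> V w" "card (V w) < Suc n" for y
          using card_V_less[OF w that(2,3)] that by simp
        moreover have "collar w U \<longleftrightarrow> (\<exists>y\<in>W. R w y \<and> V y \<noteq> V w \<and> collar y U)"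
          using False by (subst collar.simps) auto
        ultimately show ?thesis using False by auto
      qed
      finally show "(\<exists>V'\<in>Pow (Pow Phi). V w = V' \<and> ?Q V' w) \<longleftrightarrow> card (V w) < Suc n \<and> collar w U" .
    qed
  qed
  from this[of "Suc (card (Pow Phi))"] show ?thesis
  proof (rule definable_cong)
    fix w
    have "card (V w) \<le> card (Pow Phi)" using V_Pow finite_Phi by (simp add: card_mono)
    then show "card (V w) < Suc (card (Pow Phi)) \<and> collar w U \<longleftrightarrow> collar w U" by simp
  qed
qed

text \<open>Suppose that the collars of \<open>w\<close> fall into two parts with no comparable pair
  across them, and let \<open>e\<close> be a last point of the same value having collars in both.
  Each successor of \<open>e\<close> has collars in one part only, and the part does not change
  along \<open>R\<close>; by \<open>locally_connected\<close> all successors of \<open>e\<close>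
  choose the same part. But \<open>e\<close> has no nucleus and takes all its collars from its
  successors.\<close>

lemma collars_connected:
  assumes "w \<in> W" "C0 \<subseteq> Collect (collar w)" "C0 \<noteq> {}"
    and closed: "\<And>U U'. U \<in> C0 \<Longrightarrow> collar w U' \<Longrightarrow> U \<subseteq> U' \<or> U' \<subseteq> U \<Longrightarrow> U' \<in> C0"
  shows "C0 = Collect (collar w)"
  using assms
proof (induction "card (V w)" arbitrary: w C0 rule: less_induct)
  case less
  note w = less.prems(1) and C0 = less.prems(2,3) and closed = less.prems(4)
  show ?case
  proof (cases "reflx (V w)")
    case True
    then show ?thesis using C0 collar_of_reflx[OF True] by auto
  next
    case irr: False
    define A where "A = Collect (collar w) - C0"
    show ?thesis
    proof (rule ccontr)
      assume "C0 \<noteq> Collect (collar w)"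
      then have "A \<noteq> {}" using C0 by (auto simp: A_def)
      have fin: "finite (Collect (collar w))"
        using collar_subset[OF _ w] V_Pow[of w] finite_Phi
        by (intro finite_subset[of "Collect (collar w)" "Pow (Pow Phi)"]) auto
      then have finC0: "finite C0" "finite A" using C0 finite_subset by (auto simp: A_def)
      let ?P = "\<lambda>e. V e = V w \<and> (\<exists>U\<in>C0. collar e U) \<and> (\<exists>U\<in>A. collar e U)"
      have "definable ?P"
        using finC0 by (intro definable_conj definable_V definable_bex definable_collar)
      moreover have "?P w" using C0 \<open>A \<noteq> {}\<close> by (auto simp: A_def)
      ultimately obtain e where e: "e \<in> W" "e = w \<or> R w e" "?P e" "\<And>z. z \<in> W \<Longrightarrow> R e z \<Longrightarrow> \<not> ?P z"
        using irreflexive_end[OF w irr, of ?P] by blast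
      have wu: "R w u" if "R e u" for u using e(2) W_trans w that by blast
      have sub: "collar w U" if "u \<in> W" "R e u" "collar u U" for u U
        using collar_upward[OF w that(1) wu[OF that(2)] irr that(3)] .
      let ?Q = "\<lambda>u. \<exists>U\<in>C0. collar u U"
      \<comment> \<open>A successor of unchanged value is one-sided because \<open>e\<close> is
        last; one of smaller value is so by the induction hypothesis.\<close>
      have half: "?Q u \<longleftrightarrow> U \<in> C0" if u: "u \<in> W" "R e u" and U: "collar u U" for u U
      proof (cases "V u = V w")
        case True
        then show ?thesis using e(4)[OF u] sub[OF u] U by (auto simp: A_def)
      next
        case False
        have "Collect (collar u) \<subseteq> C0" if "?Q u"
        proof -
          have "C0 \<inter> Collect (collar u) = Collect (collar u)"
            using False u wu w closed sub[OF u] that by (intro less.hyps card_V_less) auto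
          then show ?thesis by blast
        qed
        then show ?thesis using U by blast
      qed
      have inv: "?Q z = ?Q u" if u: "u \<in> W" "R e u" and z: "z \<in> W" "R u z" for u z
      proof -
        have ez: "R e z" using W_trans e(1) u z by blast
        obtain U where U: "collar z U" using collar_exists z by blast
        show ?thesis
        proof (cases "reflx (V u)")
          case True
          \<comment> \<open>The collar \<open>V u\<close> of \<open>u\<close> contains every collar
            of its successor \<open>z\<close>, hence is comparable with it.\<close>
          have "U \<subseteq> V u" using collar_subset[OF U z(1)] V_antimono[OF u(1) z(2)] by blast
          moreover have "collar u (V u)" using True by (rule collar.here)
          ultimately show ?thesis
            using half[OF z(1) ez U] half[OF u, of "V u"] closed sub[OF u] sub[OF z(1) ez U] by meson
        next
          case False
          then have "collar u U" using collar_upward[OF u(1) z(1) z(2)] U by blast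
          then show ?thesis using half[OF u] half[OF z(1) ez U] by blast
        qed
      qed
      have "definable ?Q" using finC0 by (intro definable_bex definable_collar)
      then have "(\<forall>y\<in>W. R e y \<longrightarrow> ?Q y) \<or> (\<forall>y\<in>W. R e y \<longrightarrow> \<not> ?Q y)"
        by (rule locally_connected[OF _ e(1)]) (use inv in blast)
      moreover have "\<exists>y\<in>W. R e y \<and> collar y U" if "collar e U" for U
        using that e(3) irr by (auto elim: collar.cases)
      moreover obtain U1 U2 where "U1 \<in> C0" "collar e U1" "U2 \<in> A" "collar e U2" using e(3) by blast
      ultimately show False using half by (metis A_def DiffD2)
    qed
  qed
qed

subsection \<open>Representation over the space\<close>

sublocale lab: labelling Ok Bn .

lemma representation:
  "w \<in> W \<Longrightarrow> collar w U0 \<Longrightarrow> lab.rep TYPE('a::{metric_space,perfect_space}) (tau w) (V w) U0"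
proof (induction "card (V w)" arbitrary: w U0 rule: less_induct)
  case less
  note w = less.prems(1)
  have Okw: "Ok (tau w) (V w)" using w by (auto simp: Ok_def)
  have IH: "lab.rep TYPE('a) (tau y) (V y) U" if "y \<in> W" "V y \<subset> V w" "collar y U" for y U
    using less.hyps[of y U] that finite_V psubset_card_mono by blast
  show ?case
  proof (cases "reflx (V w)")
    case True
    have "lab.rep TYPE('a) (tau w) (V w) (V w)"
    proof (rule lab.rep_nucleus[OF finite_V Bn_props[OF True] Okw, of "lower (V w)"])
      fix b' V' assume "(b', V') \<in> lower (V w)"
      then obtain y where y: "y \<in> W" "b' = tau y" "V' = V y" "tau y \<in> V w" "V y \<subset> V w"
        by (auto simp: lower_def)
      then show "b' \<in> V w \<and> V' \<subset> V w \<and> (\<exists>U. lab.rep TYPE('a) b' V' U)"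
        using collar_exists[OF y(1)] IH by blast
    next
      show "V w \<subseteq> Bn (V w) \<union> (\<Union>(b', V')\<in>lower (V w). insert b' V')"
        using Bn(2)[OF True] by (simp add: covers_def)
    qed
    then show ?thesis using less.prems collar_of_reflx[OF True] by simp
  next
    case False
    \<comment> \<open>A child is listed once for each of its collars, so that the walk can use it
      beside different neighbours.\<close>
    define J where "J = {(tau y, V y, U) | y U. y \<in> W \<and> R w y \<and> V y \<noteq> V w \<and> collar y U}"
    have lowV: "V y \<subset> V w" if "R w y" "V y \<noteq> V w" for y using V_antimono w that by blast
    have J: "lab.rep TYPE('a) b' V' U \<and> b' \<in> V w \<and> V' \<subset> V w \<and> U \<subseteq> V' \<and> Bn U \<noteq> {} \<and> Bn U \<subseteq> U \<and>
        (\<forall>c\<in>Bn U. Ok c U) \<and> collar w U" if jJ: "(b', V', U) \<in> J" for b' V' U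
    proof -
      obtain y where y: "b' = tau y" "V' = V y" "y \<in> W" "R w y" "V y \<noteq> V w" "collar y U"
        using jJ by (auto simp: J_def)
      have U: "reflx U" using y collar_reflx by blast
      have "lab.rep TYPE('a) b' V' U" using IH[OF y(3) lowV[OF y(4,5)] y(6)] y by simp
      moreover have "b' \<in> V w" "V' \<subset> V w" using y lowV V_I by auto
      moreover have "U \<subseteq> V'" using collar_subset[OF y(6,3)] y by simp
      moreover have "collar w U" using collar.above[OF False y(3-6)] .
      ultimately show ?thesis using Bn_props[OF U] by blast
    qed
    have J_ex: "\<exists>b' V'. (b', V', U) \<in> J" if "collar w U" for U
      using that
    proof cases
      case (above y)
      then show ?thesis unfolding J_def by blast
    qed (use False in simp)
    have "J \<subseteq> Pow Phi \<times> Pow (Pow Phi) \<times> Pow (Pow Phi)"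
    proof
      fix j assume "j \<in> J"
      moreover obtain b' V' U where j: "j = (b', V', U)" by (cases j) auto
      ultimately have "b' \<in> V w" "V' \<subset> V w" "U \<subseteq> V'" using J[of b' V' U] by simp_all
      then have "b' \<in> Pow Phi" "V' \<in> Pow (Pow Phi)" "U \<in> Pow (Pow Phi)" using V_Pow[of w] by blast+
      then show "j \<in> Pow Phi \<times> Pow (Pow Phi) \<times> Pow (Pow Phi)" by (simp add: j)
    qed
    then have "finite J" by (rule finite_subset) (simp add: finite_Phi)
    obtain b0 V0 where j0: "(b0, V0, U0) \<in> J" using J_ex less.prems by blast
    define cmp where
      "cmp i j \<longleftrightarrow> snd (snd i) \<subseteq> snd (snd j) \<or> snd (snd j) \<subseteq> snd (snd i)"
      for i j :: "'v form set \<times> 'v form set set \<times> 'v form set set"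
    \<comment> \<open>The collars reached from \<open>i\<close> are closed under comparability,
      hence are all collars of \<open>w\<close>. Members of \<open>J\<close> with the same collar
      are adjacent.\<close>
    have conn: "(i, j) \<in> {(i, j). i \<in> J \<and> j \<in> J \<and> cmp i j}\<^sup>*" if i: "i \<in> J" and j: "j \<in> J" for i j
    proof -
      let ?E = "{(i, j). i \<in> J \<and> j \<in> J \<and> cmp i j}"
      let ?C0 = "{snd (snd k) | k. k \<in> J \<and> (i, k) \<in> ?E\<^sup>*}"
      have collar_J: "collar w (snd (snd k))" if "k \<in> J" for k
        using J[of "fst k" "fst (snd k)" "snd (snd k)"] that by simp
      have "?C0 = Collect (collar w)"
      proof (rule collars_connected[OF w])
        show "?C0 \<subseteq> Collect (collar w)" using collar_J by blast
        show "?C0 \<noteq> {}" using i by blast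
        fix U U' assume U: "U \<in> ?C0" "collar w U'" "U \<subseteq> U' \<or> U' \<subseteq> U"
        then obtain k where k: "k \<in> J" "(i, k) \<in> ?E\<^sup>*" "U = snd (snd k)" by blast
        obtain b' V' where k': "(b', V', U') \<in> J" using J_ex U by blast
        then have "(k, (b', V', U')) \<in> ?E" using k U by (auto simp: cmp_def)
        then have "(i, (b', V', U')) \<in> ?E\<^sup>*" using k(2) by (rule rtrancl_into_rtrancl[rotated])
        then show "U' \<in> ?C0" using k' by force
      qed
      then obtain k where k: "k \<in> J" "(i, k) \<in> ?E\<^sup>*" "snd (snd j) = snd (snd k)" using collar_J[OF j] by blast
      then have "(k, j) \<in> ?E" using j by (simp add: cmp_def)
      then show ?thesis using k(2) by (rule rtrancl_into_rtrancl[rotated])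
    qed
    obtain s where s: "s 0 = (b0, V0, U0)" "\<And>n. s n \<in> J" "\<And>n. cmp (s n) (s (Suc n))"
        "\<And>j N. j \<in> J \<Longrightarrow> \<exists>n\<ge>N. s n = j"
      by (rule recurrent_walk[OF \<open>finite J\<close> j0, of cmp]) (use conn in \<open>auto simp: cmp_def\<close>)
    have cover: "V w \<subseteq> (\<Union>(b', V', U)\<in>J. insert b' V')"
    proof
      fix t assume t: "t \<in> V w"
      \<comment> \<open>A last point of this value sees the same types as \<open>w\<close>, but only
        through successors of smaller value, and these are children.\<close>
      obtain e where e: "e \<in> W" "e = w \<or> R w e" "V e = V w" "\<And>z. z \<in> W \<Longrightarrow> R e z \<Longrightarrow> V z \<noteq> V w"
        using irreflexive_end[OF w False definable_V, of "V w"] by blast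
      obtain z where z: "z \<in> W" "R e z" "tau z = t" using t e(3) by (metis V_E)
      have wz: "R w z" using e(2) z W_trans w by blast
      obtain U where "collar z U" using collar_exists z by blast
      then have "(tau z, V z, U) \<in> J" using z wz e(4) by (auto simp: J_def)
      then show "t \<in> (\<Union>(b', V', U)\<in>J. insert b' V')" using z by force
    qed
    show ?thesis
      by (rule lab.rep_shells[OF finite_V Okw _ cover s(2,4)])
        (use J s(1,3) in \<open>auto simp: cmp_def\<close>)
  qed
qed

end

subsection \<open>Truth and completeness\<close>

fun subs :: "'v form \<Rightarrow> 'v form set" where
  "subs (Atom p) = {Atom p}"
| "subs \<^bold>\<top> = {\<^bold>\<top>}"
| "subs (\<^bold>\<not> \<phi>) = insert (\<^bold>\<not> \<phi>) (subs \<phi>)"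
| "subs (\<phi> \<^bold>\<and> \<psi>) = insert (\<phi> \<^bold>\<and> \<psi>) (subs \<phi> \<union> subs \<psi>)"
| "subs (\<^bold>[d\<^bold>] \<phi>) = insert (\<^bold>[d\<^bold>] \<phi>) (subs \<phi>)"
| "subs (\<langle>dt\<rangle> \<Gamma>) = insert (\<langle>dt\<rangle> \<Gamma>) (\<Union>(subs ` fset \<Gamma>))"

lemma finite_subs: "finite (subs \<phi>)"
  by (induction \<phi> rule: subs.induct) auto

lemma subs_refl: "\<phi> \<in> subs \<phi>"
  by (cases \<phi>) auto

lemma subs_closed:
  "\<^bold>\<not> \<phi> \<in> subs \<xi> \<Longrightarrow> \<phi> \<in> subs \<xi>"
  "\<phi> \<^bold>\<and> \<psi> \<in> subs \<xi> \<Longrightarrow> \<phi> \<in> subs \<xi> \<and> \<psi> \<in> subs \<xi>"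
  "\<^bold>[d\<^bold>] \<phi> \<in> subs \<xi> \<Longrightarrow> \<phi> \<in> subs \<xi>"
  "\<langle>dt\<rangle> \<Gamma> \<in> subs \<xi> \<Longrightarrow> fset \<Gamma> \<subseteq> subs \<xi>"
  by (induction \<xi> rule: subs.induct) (auto simp: subs_refl, blast+)

lemma (in tangle_logic) subs_L: "\<phi> \<in> L \<Longrightarrow> subs \<phi> \<subseteq> L"
proof (induction \<phi> rule: subs.induct)
  case (6 \<Gamma>)
  then show ?case using L_Dt[OF 6(2)] by auto
qed (auto simp: L_simps)

context tangle_types begin

lemma good_witness:
  assumes "lab.good f C x"
  obtains w where "w \<in> W" "f x = tau w" "acc f C x = V w"
  using assms unfolding lab.good_def Ok_def by metis

lemma tangle_in_acc:
  assumes "lab.good f C x" "\<langle>dt\<rangle> \<Gamma> \<in> Phi" "t \<in> acc f C x" "\<langle>dt\<rangle> \<Gamma> \<in> t"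
  shows "\<langle>dt\<rangle> \<Gamma> \<in> f x"
proof -
  obtain w where w: "w \<in> W" "f x = tau w" "acc f C x = V w" by (rule good_witness[OF assms(1)])
  obtain y where "y \<in> W" "R w y" "t = tau y" using assms(3) w(3) by (auto elim: V_E)
  then show ?thesis using tangle_backward[of \<Gamma> y w] w assms(2,4) by (auto simp: tau_def)
qed

lemma truth_lemma:
  fixes f :: "'a::{metric_space,perfect_space} \<Rightarrow> 'v form set"
  assumes good: "\<And>x. lab.good f UNIV x"
    and closed: "\<And>\<phi>. \<^bold>\<not> \<phi> \<in> Phi \<Longrightarrow> \<phi> \<in> Phi" "\<And>\<phi> \<psi>. \<phi> \<^bold>\<and> \<psi> \<in> Phi \<Longrightarrow> \<phi> \<in> Phi \<and> \<psi> \<in> Phi"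
      "\<And>\<phi>. \<^bold>[d\<^bold>] \<phi> \<in> Phi \<Longrightarrow> \<phi> \<in> Phi" "\<And>\<Gamma>. \<langle>dt\<rangle> \<Gamma> \<in> Phi \<Longrightarrow> fset \<Gamma> \<subseteq> Phi"
    and "\<phi> \<in> Phi"
  shows "sat (\<lambda>p. {x. Atom p \<in> f x}) x \<phi> \<longleftrightarrow> \<phi> \<in> f x"
  using \<open>\<phi> \<in> Phi\<close>
proof (induction \<phi> arbitrary: x)
  let ?h = "\<lambda>p. {x. Atom p \<in> f x}"
  have fPhi: "f x \<subseteq> Phi" for x by (rule good_witness[OF good[of x]]) (simp add: tau_def)
  then have "finite (range f)" using finite_Phi by (meson PowI finite_Pow_iff finite_subset image_subsetI)
  note nearby = acc_nearby[OF this]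
  {
    case (Atom p)
    show ?case by simp
  next
    case (Tru)
    show ?case
      by (rule good_witness[OF good[of x]]) (use Tru in \<open>simp add: tau_def W_Tru\<close>)
  next
    case (Neg \<phi>)
    have "\<phi> \<in> Phi" "\<phi> \<in> L" using closed(1) Neg.prems Phi_L by blast+
    then show ?case
      by (rule_tac good_witness[OF good[of x]]) (use Neg in \<open>simp add: tau_def W_Neg\<close>)
  next
    case (And \<phi> \<psi>)
    have "\<phi> \<in> Phi" "\<psi> \<in> Phi" using closed(2) And.prems by blast+
    then show ?case
      by (rule_tac good_witness[OF good[of x]]) (use And in \<open>simp add: tau_def W_And\<close>)
  next
    case (Box \<phi>)
    have \<phi>: "\<phi> \<in> Phi" "\<phi> \<in> L" using closed(3) Box.prems Phi_L by blast+
    obtain w where w: "w \<in> W" "f x = tau w" "acc f UNIV x = V w" by (rule good_witness[OF good[of x]])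
    have IH: "sat ?h y \<phi> \<longleftrightarrow> \<phi> \<in> f y" for y using Box.IH \<phi> by blast
    have "sat ?h x (\<^bold>[d\<^bold>] \<phi>) \<longleftrightarrow> (\<forall>t\<in>acc f UNIV x. \<phi> \<in> t)"
    proof
      assume "sat ?h x (\<^bold>[d\<^bold>] \<phi>)"
      then obtain U where U: "open U" "x \<in> U" "\<And>y. y \<in> U \<Longrightarrow> y \<noteq> x \<Longrightarrow> \<phi> \<in> f y" using IH by auto
      show "\<forall>t\<in>acc f UNIV x. \<phi> \<in> t"
      proof
        fix t assume "t \<in> acc f UNIV x"
        then have "x islimpt {y\<in>UNIV. f y = t}" by (simp add: acc_def)
        then obtain y where "y \<in> U" "y \<noteq> x" "f y = t" using islimptE[OF _ U(2,1)] by blast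
        then show "\<phi> \<in> t" using U(3) by blast
      qed
    next
      assume all: "\<forall>t\<in>acc f UNIV x. \<phi> \<in> t"
      obtain T where T: "open T" "x \<in> T" "\<And>y. y \<in> T \<Longrightarrow> y \<in> UNIV \<Longrightarrow> y \<noteq> x \<Longrightarrow> f y \<in> acc f UNIV x"
        by (rule nearby) blast
      then have "\<forall>y\<in>T - {x}. sat ?h y \<phi>" using all IH by auto
      then show "sat ?h x (\<^bold>[d\<^bold>] \<phi>)" using T(1,2) by auto
    qed
    also have "\<dots> \<longleftrightarrow> (\<forall>y\<in>W. R w y \<longrightarrow> \<phi> \<in> y)" using \<phi>(1) by (auto simp: w(3) V_def tau_def)
    also have "\<dots> \<longleftrightarrow> \<^bold>[d\<^bold>] \<phi> \<in> f x" using Box.prems by (simp add: w(2) tau_def W_Box[OF w(1) \<phi>(2)])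
    finally show ?case .
  next
    case (Dt \<Gamma>)
    have sub: "\<gamma> \<in> Phi" if "\<gamma> \<in> fset \<Gamma>" for \<gamma> using closed(4)[OF Dt.prems] that by blast
    have IH: "sat ?h y \<gamma> \<longleftrightarrow> \<gamma> \<in> f y" if "\<gamma> \<in> fset \<Gamma>" for y \<gamma> using Dt.IH[OF that] sub[OF that] by blast
    have \<Gamma>: "\<Gamma> \<noteq> {||}" using L_Dt Dt.prems Phi_L by blast
    show ?case
    proof
      assume x: "\<langle>dt\<rangle> \<Gamma> \<in> f x"
      \<comment> \<open>Unfolding a tangle preserves it, so the points whose labels contain it form
        a witness.\<close>
      let ?S = "{y. \<langle>dt\<rangle> \<Gamma> \<in> f y}"
      have "y islimpt {z. sat ?h z \<gamma>} \<inter> ?S" if y: "y \<in> ?S" and \<gamma>: "\<gamma> \<in> fset \<Gamma>" for y \<gamma>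
      proof -
        obtain w where w: "w \<in> W" "f y = tau w" "acc f UNIV y = V w" by (rule good_witness[OF good[of y]])
        have "\<langle>dt\<rangle> \<Gamma> \<in> w" using y w(2) by (simp add: tau_def)
        then obtain v where v: "v \<in> W" "R w v" "\<gamma> \<in> v" "\<langle>dt\<rangle> \<Gamma> \<in> v" using tangle_unfold w(1) \<gamma> by blast
        then have "tau v \<in> acc f UNIV y" using V_I w(3) by simp
        then have "y islimpt {z\<in>UNIV. f z = tau v}" by (simp add: acc_def)
        moreover have "{z\<in>UNIV. f z = tau v} \<subseteq> {z. sat ?h z \<gamma>} \<inter> ?S"
          using v(3,4) sub[OF \<gamma>] IH[OF \<gamma>] Dt.prems by (auto simp: tau_def)
        ultimately show ?thesis by (rule islimpt_subset)
      qed
      then show "sat ?h x (\<langle>dt\<rangle> \<Gamma>)"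
        using x by (auto simp: deriv_set_def intro!: exI[of _ ?S])
    next
      assume "sat ?h x (\<langle>dt\<rangle> \<Gamma>)"
      then obtain S where S: "x \<in> S" "\<And>y \<gamma>. y \<in> S \<Longrightarrow> \<gamma> \<in> fset \<Gamma> \<Longrightarrow> y islimpt {z. sat ?h z \<gamma>} \<inter> S"
        by (auto simp: deriv_set_def)
      obtain N0 where N0: "open N0" "x \<in> N0" "\<And>y. y \<in> N0 \<Longrightarrow> y \<in> UNIV \<Longrightarrow> y \<noteq> x \<Longrightarrow> f y \<in> acc f UNIV x"
        by (rule nearby) blast
      \<comment> \<open>Least accumulation set in the witness near \<open>x\<close>: points of the
        witness close to \<open>y\<close> cannot have a smaller one, so they share that of
        \<open>y\<close>, and settling puts their labels in one nucleus.\<close>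
      obtain y where y: "y \<in> S" "y \<in> N0"
          and min: "\<And>z. z \<in> S \<Longrightarrow> z \<in> N0 \<Longrightarrow> card (acc f UNIV y) \<le> card (acc f UNIV z)"
        using ex_has_least_nat[of "\<lambda>y. y \<in> S \<and> y \<in> N0" x "\<lambda>y. card (acc f UNIV y)"] S(1) N0(2) by blast
      obtain N1 where N1: "open N1" "y \<in> N1" "\<And>z. z \<in> N1 \<Longrightarrow> z \<in> UNIV \<Longrightarrow> z \<noteq> y \<Longrightarrow> f z \<in> acc f UNIV y"
        by (rule nearby) blast
      have "lab.settles f UNIV (acc f UNIV y) y" using good[of y] by (simp add: lab.good_def)
      then obtain N2 where N2: "open N2" "y \<in> N2"
          "\<And>z. z \<in> N2 \<Longrightarrow> z \<noteq> y \<Longrightarrow> acc f UNIV z = acc f UNIV y \<Longrightarrow> f z \<in> Bn (acc f UNIV y)"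
        unfolding lab.settles_def by blast
      obtain w where w: "w \<in> W" "f y = tau w" "acc f UNIV y = V w" by (rule good_witness[OF good[of y]])
      have fin: "finite (acc f UNIV y)" using w(3) finite_V by simp
      have hit: "\<exists>b\<in>Bn (acc f UNIV y). \<gamma> \<in> b" if \<gamma>: "\<gamma> |\<in>| \<Gamma>" for \<gamma>
      proof -
        have "open (N0 \<inter> N1 \<inter> N2)" "y \<in> N0 \<inter> N1 \<inter> N2" using N0 N1 N2 y by auto
        then obtain z where z: "sat ?h z \<gamma>" "z \<in> S" "z \<in> N0" "z \<in> N1" "z \<in> N2" "z \<noteq> y"
          using islimptE[OF S(2)[OF y(1) \<gamma>], of "N0 \<inter> N1 \<inter> N2"] by blast
        \<comment> \<open>\<open>y\<close> is taken out of \<open>N1\<close> because its own label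
          need not accumulate at \<open>y\<close>.\<close>
        have "acc f UNIV z \<subseteq> acc f UNIV y"
          by (rule acc_subset[of "N1 - {y}"]) (use N1 z in auto)
        then have "acc f UNIV z = acc f UNIV y"
          using min[OF z(2,3)] fin by (simp add: card_seteq)
        then have "f z \<in> Bn (acc f UNIV y)" using N2(3) z by blast
        then show ?thesis using IH[OF \<gamma>] z(1) by blast
      qed
      \<comment> \<open>As \<Gamma> is non-empty, \<open>hit\<close> yields a member of
        \<open>Bn\<close>, which would be empty if there were no nucleus.\<close>
      then have refl: "reflx (acc f UNIV y)" using \<Gamma> by (fastforce simp: Bn_def split: if_splits)
      have "\<exists>b\<in>Bn (acc f UNIV y). \<langle>dt\<rangle> \<Gamma> \<in> b"
        by (rule nucleus_tangle[OF Bn(1)[OF refl] Dt.prems hit])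
      then obtain b where b: "b \<in> Bn (acc f UNIV y)" "\<langle>dt\<rangle> \<Gamma> \<in> b" by blast
      have "\<langle>dt\<rangle> \<Gamma> \<in> f y"
        using tangle_in_acc[OF good Dt.prems _ b(2)] b(1) Bn_props(2)[OF refl] by blast
      then show "\<langle>dt\<rangle> \<Gamma> \<in> f x"
        using tangle_in_acc[OF good[of x] Dt.prems, of "f y"] N0(3)[OF y(2)] by (cases "y = x") auto
    qed
  }
qed

end

theorem (in tangle_logic) completeness:
  fixes X :: "'a::{metric_space,perfect_space} itself"
  assumes "\<phi> \<in> L" "valid_in X \<phi>"
  shows "\<phi> \<in> H"
proof (rule ccontr)
  assume "\<phi> \<notin> H"
  then obtain w where w: "w \<in> W" "\<phi> \<notin> w" using nontheorem_refuted assms(1) by blast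
  interpret tangle_types L H "subs \<phi>"
    by unfold_locales (use finite_subs subs_L[OF assms(1)] in auto)
  obtain U where "collar w U" using collar_exists w by blast
  then have rep: "lab.rep TYPE('a) (tau w) (V w) U" using representation w by blast
  \<comment> \<open>\<open>UNIV\<close> has no frontier, so any collar serves.
    \<open>undefined\<close> is an arbitrary point of the space, chosen to refute \<phi>.\<close>
  have "separated 1 {undefined :: 'a}" by (simp add: separated_def)
  then obtain f where f: "\<And>x::'a. x \<in> UNIV \<Longrightarrow> lab.good f UNIV x" "f undefined = tau w"
    using lab.repD[OF rep open_UNIV subset_UNIV, of 1 "{undefined}"] by (metis insertI1)
  have "sat (\<lambda>p. {x. Atom p \<in> f x}) undefined \<phi> \<longleftrightarrow> \<phi> \<in> f undefined"
    by (rule truth_lemma[OF f(1)[OF UNIV_I] subs_closed subs_refl])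
  then show False using f(2) w(2) assms(2) by (auto simp: tau_def valid_in_def)
qed

subsection \<open>The two systems\<close>

lemma hilbert_subset:
  assumes "Ax \<subseteq> L" "\<And>\<phi>. \<^bold>\<not> \<phi> \<in> L \<longleftrightarrow> \<phi> \<in> L" "\<And>\<phi> \<psi>. \<phi> \<^bold>\<and> \<psi> \<in> L \<longleftrightarrow> \<phi> \<in> L \<and> \<psi> \<in> L"
    "\<And>\<phi>. \<^bold>[d\<^bold>] \<phi> \<in> L \<longleftrightarrow> \<phi> \<in> L"
  shows "hilbert Ax \<subseteq> L"
proof
  fix \<phi> assume "\<phi> \<in> hilbert Ax"
  then show "\<phi> \<in> L" by induction (use assms in auto)
qed

lemma KD4G1_axioms_subset:
  assumes L: "\<^bold>\<top> \<in> L" "\<And>\<phi>. \<^bold>\<not> \<phi> \<in> L \<longleftrightarrow> \<phi> \<in> L" "\<And>\<phi> \<psi>. \<phi> \<^bold>\<and> \<psi> \<in> L \<longleftrightarrow> \<phi> \<in> L \<and> \<psi> \<in> L"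
    "\<And>\<phi>. \<^bold>[d\<^bold>] \<phi> \<in> L \<longleftrightarrow> \<phi> \<in> L"
  shows "KD4G1_axioms L \<subseteq> L"
proof -
  have "pinst \<sigma> \<pi> \<in> L" if "range \<sigma> \<subseteq> L" for \<sigma> \<pi>
    using that by (induction \<pi>) (auto simp: L)
  then have "taut_instances L \<subseteq> L" by (auto simp: taut_instances_def)
  then show ?thesis
    by (auto simp: KD4G1_axioms_def K_scheme_def D_axiom_def four_scheme_def G1_scheme_def
        G1_formula_def Let_def L)
qed

lemma lang_d_simps:
  "\<^bold>\<top> \<in> lang_d" "\<^bold>\<not> \<phi> \<in> lang_d \<longleftrightarrow> \<phi> \<in> lang_d" "\<phi> \<^bold>\<and> \<psi> \<in> lang_d \<longleftrightarrow> \<phi> \<in> lang_d \<and> \<psi> \<in> lang_d"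
  "\<^bold>[d\<^bold>] \<phi> \<in> lang_d \<longleftrightarrow> \<phi> \<in> lang_d" "\<langle>dt\<rangle> \<Gamma> \<notin> lang_d"
  by (auto intro: lang_d.intros elim: lang_d.cases)

lemma lang_dt_simps:
  "\<^bold>\<top> \<in> lang_dt" "\<^bold>\<not> \<phi> \<in> lang_dt \<longleftrightarrow> \<phi> \<in> lang_dt"
  "\<phi> \<^bold>\<and> \<psi> \<in> lang_dt \<longleftrightarrow> \<phi> \<in> lang_dt \<and> \<psi> \<in> lang_dt"
  "\<^bold>[d\<^bold>] \<phi> \<in> lang_dt \<longleftrightarrow> \<phi> \<in> lang_dt" "\<langle>dt\<rangle> \<Gamma> \<in> lang_dt \<longleftrightarrow> \<Gamma> \<noteq> {||} \<and> fset \<Gamma> \<subseteq> lang_dt"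
  by (auto intro: lang_dt.intros elim: lang_dt.cases)

interpretation d: tangle_logic lang_d KD4G1
proof
  show "KD4G1 \<subseteq> lang_d"
    unfolding KD4G1_def by (intro hilbert_subset KD4G1_axioms_subset lang_d_simps)
qed (auto simp: lang_d_simps KD4G1_def KD4G1_axioms_def intro: hilbert.intros)

lemma BigAnd_lang_dt: "BigAnd gs \<in> lang_dt \<longleftrightarrow> set gs \<subseteq> lang_dt"
  by (induction gs rule: BigAnd.induct) (auto simp: lang_dt_simps)

interpretation dt: tangle_logic lang_dt KD4G1t
proof
  have "Fix_scheme lang_dt \<subseteq> lang_dt" "Ind_scheme lang_dt \<subseteq> lang_dt"
    by (auto simp: Fix_scheme_def Ind_scheme_def lang_dt_simps BigAnd_lang_dt, blast+)
  then show "KD4G1t \<subseteq> lang_dt"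
    unfolding KD4G1t_def by (intro hilbert_subset Un_least KD4G1_axioms_subset lang_dt_simps)
next
  fix \<Gamma> and \<gamma> :: "'a form"
  assume "\<langle>dt\<rangle> \<Gamma> \<in> lang_dt" "\<gamma> |\<in>| \<Gamma>"
  then have "\<langle>dt\<rangle> \<Gamma> \<^bold>\<rightarrow> \<langle>d\<rangle> (\<gamma> \<^bold>\<and> \<langle>dt\<rangle> \<Gamma>) \<in> Fix_scheme lang_dt"
    by (auto simp: Fix_scheme_def lang_dt_simps)
  then show "\<langle>dt\<rangle> \<Gamma> \<^bold>\<rightarrow> \<langle>d\<rangle> (\<gamma> \<^bold>\<and> \<langle>dt\<rangle> \<Gamma>) \<in> KD4G1t" by (simp add: KD4G1t_def hilbert.ax)
next
  fix \<Gamma> and \<phi> :: "'a form" and gs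
  assume "\<langle>dt\<rangle> \<Gamma> \<in> lang_dt" "\<phi> \<in> lang_dt" "distinct (gs :: 'a form list)" "set gs = fset \<Gamma>"
  then have "\<box>* (\<phi> \<^bold>\<rightarrow> BigAnd (map (\<lambda>\<gamma>. \<langle>d\<rangle> (\<gamma> \<^bold>\<and> \<phi>)) gs)) \<^bold>\<rightarrow> (\<phi> \<^bold>\<rightarrow> \<langle>dt\<rangle> \<Gamma>) \<in> Ind_scheme lang_dt"
    unfolding Ind_scheme_def lang_dt_simps by blast
  then show "\<box>* (\<phi> \<^bold>\<rightarrow> BigAnd (map (\<lambda>\<gamma>. \<langle>d\<rangle> (\<gamma> \<^bold>\<and> \<phi>)) gs)) \<^bold>\<rightarrow> (\<phi> \<^bold>\<rightarrow> \<langle>dt\<rangle> \<Gamma>) \<in> KD4G1t"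
    by (simp add: KD4G1t_def hilbert.ax)
qed (auto simp: lang_dt_simps KD4G1t_def KD4G1_axioms_def intro: hilbert.intros)

subsection \<open>Soundness\<close>

lemma sat_Dia: "sat h x (\<langle>d\<rangle> \<phi>) \<longleftrightarrow> x islimpt {y. sat h y \<phi>}"
  unfolding islimpt_def by auto

lemma sat_pinst: "sat h x (pinst \<sigma> \<pi>) \<longleftrightarrow> peval (\<lambda>n. sat h x (\<sigma> n)) \<pi>"
  by (induction \<pi>) auto

lemma sat_BigAnd: "sat h x (BigAnd gs) \<longleftrightarrow> (\<forall>g\<in>set gs. sat h x g)"
  by (induction gs rule: BigAnd.induct) auto

lemma valid_K: "valid_in (X :: 'a::topological_space itself) (\<^bold>[d\<^bold>] (\<phi> \<^bold>\<rightarrow> \<psi>) \<^bold>\<rightarrow> (\<^bold>[d\<^bold>] \<phi> \<^bold>\<rightarrow> \<^bold>[d\<^bold>] \<psi>))"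
proof -
  have "sat h x (\<^bold>[d\<^bold>] \<psi>)" if K: "sat h x (\<^bold>[d\<^bold>] (\<phi> \<^bold>\<rightarrow> \<psi>))" "sat h x (\<^bold>[d\<^bold>] \<phi>)" for h and x :: 'a
  proof -
    obtain U T where "open U" "x \<in> U" "\<forall>y\<in>U - {x}. sat h y \<phi> \<longrightarrow> sat h y \<psi>"
        "open T" "x \<in> T" "\<forall>y\<in>T - {x}. sat h y \<phi>"
      using K by auto
    then have "open (U \<inter> T)" "x \<in> U \<inter> T" "\<forall>y\<in>U \<inter> T - {x}. sat h y \<psi>" by auto
    then show ?thesis by (simp only: sat.simps) blast
  qed
  then show ?thesis unfolding valid_in_def by (simp del: sat.simps(5))
qed

lemma valid_D: "valid_in (X :: 'a::perfect_space itself) D_axiom"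
  unfolding valid_in_def D_axiom_def sat_Dia by (simp add: islimpt_UNIV)

text \<open>In a T1 space \<open>U - {x}\<close> is an open neighbourhood of each of its points, so
  the same \<open>U\<close> serves twice.\<close>

lemma valid_four: "valid_in (X :: 'a::t1_space itself) (\<^bold>[d\<^bold>] \<phi> \<^bold>\<rightarrow> \<^bold>[d\<^bold>] \<^bold>[d\<^bold>] \<phi>)"
proof -
  have "sat h x (\<^bold>[d\<^bold>] \<^bold>[d\<^bold>] \<phi>)" if "sat h x (\<^bold>[d\<^bold>] \<phi>)" for h and x :: 'a
  proof -
    obtain U where U: "open U" "x \<in> U" "\<forall>y\<in>U - {x}. sat h y \<phi>" using \<open>sat h x (\<^bold>[d\<^bold>] \<phi>)\<close> by auto
    have "open (U - {x})" using U by auto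
    then have "\<forall>y\<in>U - {x}. sat h y (\<^bold>[d\<^bold>] \<phi>)" using U(3) by (simp only: sat.simps) blast
    then show ?thesis using U by (subst sat.simps) blast
  qed
  then show ?thesis unfolding valid_in_def by (simp del: sat.simps(5))
qed

text \<open>A set witnessing the tangle at one point witnesses it at all of its points.\<close>

lemma valid_Fix:
  fixes X :: "'a::topological_space itself"
  assumes "\<gamma> |\<in>| \<Gamma>"
  shows "valid_in X (\<langle>dt\<rangle> \<Gamma> \<^bold>\<rightarrow> \<langle>d\<rangle> (\<gamma> \<^bold>\<and> \<langle>dt\<rangle> \<Gamma>))"
proof -
  have "sat h x (\<langle>d\<rangle> (\<gamma> \<^bold>\<and> \<langle>dt\<rangle> \<Gamma>))" if "sat h x (\<langle>dt\<rangle> \<Gamma>)" for h and x :: 'a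
  proof -
    obtain S where S: "x \<in> S" "S \<subseteq> (\<Inter>\<delta>\<in>fset \<Gamma>. deriv_set ({y. sat h y \<delta>} \<inter> S))"
      using \<open>sat h x (\<langle>dt\<rangle> \<Gamma>)\<close> by (simp only: sat.simps) blast
    then have "sat h y (\<langle>dt\<rangle> \<Gamma>)" if "y \<in> S" for y using that by (simp only: sat.simps) blast
    moreover have "x islimpt {y. sat h y \<gamma>} \<inter> S" using S assms by (auto simp: deriv_set_def)
    ultimately have "x islimpt {y. sat h y (\<gamma> \<^bold>\<and> \<langle>dt\<rangle> \<Gamma>)}"
      by (elim islimpt_subset) (auto simp only: sat.simps(4))
    then show ?thesis by (simp only: sat_Dia)
  qed
  then show ?thesis unfolding valid_in_def by (simp only: sat.simps(3,4)) blast
qed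

lemma valid_Ind:
  fixes X :: "'a::topological_space itself"
  assumes "set gs = fset \<Gamma>"
  shows "valid_in X (\<box>* (\<phi> \<^bold>\<rightarrow> BigAnd (map (\<lambda>\<gamma>. \<langle>d\<rangle> (\<gamma> \<^bold>\<and> \<phi>)) gs)) \<^bold>\<rightarrow> (\<phi> \<^bold>\<rightarrow> \<langle>dt\<rangle> \<Gamma>))"
proof -
  let ?\<psi> = "\<phi> \<^bold>\<rightarrow> BigAnd (map (\<lambda>\<gamma>. \<langle>d\<rangle> (\<gamma> \<^bold>\<and> \<phi>)) gs)"
  have "sat h x (\<langle>dt\<rangle> \<Gamma>)" if "sat h x (\<box>* ?\<psi>)" "sat h x \<phi>" for h and x :: 'a
  proof -
    obtain U where U: "open U" "x \<in> U" "\<forall>y\<in>U. sat h y ?\<psi>"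
      using \<open>sat h x (\<box>* ?\<psi>)\<close> by (simp only: sat.simps(4,5)) blast
    \<comment> \<open>The witness is cut down to the neighbourhood on which the boxed implication
      holds; its openness preserves the limits.\<close>
    let ?S = "{y\<in>U. sat h y \<phi>}"
    have "y \<in> deriv_set ({z. sat h z \<gamma>} \<inter> ?S)" if y: "y \<in> ?S" and \<gamma>: "\<gamma> \<in> fset \<Gamma>" for y \<gamma>
    proof -
      have "sat h y (BigAnd (map (\<lambda>\<gamma>. \<langle>d\<rangle> (\<gamma> \<^bold>\<and> \<phi>)) gs))" using U(3) y by auto
      then have "sat h y (\<langle>d\<rangle> (\<gamma> \<^bold>\<and> \<phi>))" unfolding sat_BigAnd using \<gamma> assms by auto
      then have "y islimpt {z. sat h z (\<gamma> \<^bold>\<and> \<phi>)} \<inter> U"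
        using y U(1) by (intro islimpt_Int_open) (simp_all only: sat_Dia, auto)
      moreover have "{z. sat h z (\<gamma> \<^bold>\<and> \<phi>)} \<inter> U = {z. sat h z \<gamma>} \<inter> ?S" by auto
      ultimately show ?thesis by (simp add: deriv_set_def)
    qed
    then have "?S \<subseteq> (\<Inter>\<delta>\<in>fset \<Gamma>. deriv_set ({y. sat h y \<delta>} \<inter> ?S))" by (intro INT_greatest subsetI)
    moreover have "x \<in> ?S" using U(2) that(2) by simp
    ultimately show ?thesis unfolding sat.simps(6) by (intro exI[of _ ?S] conjI)
  qed
  then show ?thesis unfolding valid_in_def by (simp only: sat.simps(3,4)) blast
qed

lemma sound_hilbert:
  assumes "\<And>\<phi>. \<phi> \<in> Ax \<Longrightarrow> valid_in X \<phi>"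
  shows "sound_over X (hilbert Ax)"
proof -
  have "valid_in X \<phi>" if "\<phi> \<in> hilbert Ax" for \<phi>
    using that
  proof induction
    case (nec \<phi>)
    then show ?case using open_UNIV by (auto simp: valid_in_def)
  qed (use assms in \<open>auto simp: valid_in_def\<close>)
  then show ?thesis by (simp add: sound_over_def)
qed

lemma valid_KD4G1_axioms:
  fixes X :: "'a::{metric_space,perfect_space} itself"
  assumes "scheme_valid_in X (G1_scheme L)" "\<phi> \<in> KD4G1_axioms L"
  shows "valid_in X \<phi>"
proof -
  have "valid_in X \<phi>" if "\<phi> \<in> taut_instances L"
    using that by (auto simp: taut_instances_def valid_in_def sat_pinst)
  then show ?thesis
    using assms valid_K valid_D valid_four
    by (auto simp: KD4G1_axioms_def K_scheme_def four_scheme_def scheme_valid_in_def)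
qed

theorem theorem9p3:
  fixes X :: "'a::{metric_space, perfect_space} itself"
  shows "(complete_over X lang_d (KD4G1 :: 'v form set) \<and>
          (scheme_valid_in X (G1_scheme (lang_d :: 'v form set)) \<longrightarrow>
             sound_over X (KD4G1 :: 'v form set))) \<and>
         (complete_over X lang_dt (KD4G1t :: 'v form set) \<and>
          (scheme_valid_in X (G1_scheme (lang_dt :: 'v form set)) \<longrightarrow>
             sound_over X (KD4G1t :: 'v form set)))"
proof (intro conjI impI)
  show "complete_over X lang_d (KD4G1 :: 'v form set)"
    unfolding complete_over_def using d.completeness by blast
  show "complete_over X lang_dt (KD4G1t :: 'v form set)"
    unfolding complete_over_def using dt.completeness by blast
  show "sound_over X (KD4G1 :: 'v form set)" if "scheme_valid_in X (G1_scheme (lang_d :: 'v form set))"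
    unfolding KD4G1_def by (rule sound_hilbert) (rule valid_KD4G1_axioms[OF that])
  show "sound_over X (KD4G1t :: 'v form set)" if "scheme_valid_in X (G1_scheme (lang_dt :: 'v form set))"
    unfolding KD4G1t_def
  proof (rule sound_hilbert)
    fix \<phi> :: "'v form"
    assume "\<phi> \<in> KD4G1_axioms lang_dt \<union> Fix_scheme lang_dt \<union> Ind_scheme lang_dt"
    then consider "\<phi> \<in> KD4G1_axioms lang_dt" | "\<phi> \<in> Fix_scheme lang_dt" | "\<phi> \<in> Ind_scheme lang_dt"
      by blast
    then show "valid_in X \<phi>"
    proof cases
      case 1
      then show ?thesis by (rule valid_KD4G1_axioms[OF that])
    next
      case 2
      then show ?thesis unfolding Fix_scheme_def using valid_Fix by blast
    next
      case 3
      then show ?thesis unfolding Ind_scheme_def using valid_Ind by blast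
    qed
  qed
qed

end
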